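(* Let $\Gamma$ be a cubical subdivision of a $d$-dimensional cube $C$. Then $x^d\,\ell_C(\Gamma,1/x)=\ell_C(\Gamma,x)$; equivalently, $\ell_i=\ell_{d-i}$ for $0\le i\le d$, where $\ell_C(\Gamma,x)=\ell_0+\ell_1x+\cdots+\ell_dx^d$.
   Context: A $d$-dimensional (abstract) cube is a poset isomorphic to the poset of all faces (including the empty face) of $[0,1]^d$. A cubical complex is a finite poset $K$ with a minimum element $\varnothing$ (the empty face) such that every interval $[\varnothing,F]$ is a cube and any two elements have a greatest lower bound; elements are faces, $\dim F$ is the dimension of the cube $[\varnothing,F]$, $\mathcal F(K)$ is the set of nonempty faces, subcomplexes are nonempty order ideals, and topological properties refer to the order complex of $\mathcal F(K)$. A face $F$ is regarded as the cubical complex $[\varnothing,F]$; in particular a cube $C$ is a cubical complex. A cubical subdivision of a cubical complex $K$ is a cubical complex $K'$ with a map $\sigma:\mathcal F(K')\to\mathcal F(K)$ such that for every $F\in\mathcal F(K)$: (a) $K'_F:=\sigma^{-1}(\{G\in\mathcal F(K):G\le F\})\cup\{\varnothing\}$ is a subcomplex of $K'$ homeomorphic to a ball of dimension $\dim F$; (b) $\sigma^{-1}(F)$ is the set of interior faces of this ball. Short cubical $h$-polynomial of a cubical complex $L$ of dimension $k$: $h^{(sc)}(L,x)=\sum_{E\in L\setminus\{\varnothing\}}(2x)^{\dim E}(1-x)^{k-\dim E}$. For a cubical subdivision $\Gamma$ of a $d$-dimensional cube $C$, the short cubical local $h$-polynomial is $\ell_C(\Gamma,x)=\sum_{F\in\mathcal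 F(C)}(-1)^{d-\dim F}h^{(sc)}(\Gamma_F,x)$, with $\Gamma_F$ regarded of dimension $\dim F$. *)

theory Defs
  imports "HOL-Analysis.Analysis" "HOL-Analysis.Finite_Function_Topology"
    "HOL-Computational_Algebra.Polynomial"
begin

text \<open>
  A poset is a relation \<open>P\<close> with \<open>Partial_order P\<close>; its underlying set is \<open>Field P\<close>, and the
  subposet induced on a set \<open>S\<close> is \<open>Restr P S\<close>.
\<close>

definition poset_isomorphic :: "'a rel \<Rightarrow> 'b rel \<Rightarrow> bool" where
  "poset_isomorphic P Q \<longleftrightarrow>
     (\<exists>f. bij_betw f (Field P) (Field Q) \<and>
          (\<forall>x\<in>Field P. \<forall>y\<in>Field P. (x, y) \<in> P \<longleftrightarrow> (f x, f y) \<in> Q))"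

text \<open>
  Since \<open>d\<close> varies, \<open>[0,1]\<^sup>d\<close> is placed in the real vector space of finitely supported sequences, so
  that the library notion \<open>face_of\<close> (which admits the empty face) applies.
\<close>

definition unit_cube :: "nat \<Rightarrow> (nat \<Rightarrow>\<^sub>0 real) set" where
  "unit_cube d =
     {x. (\<forall>i<d. 0 \<le> Poly_Mapping.lookup x i \<and> Poly_Mapping.lookup x i \<le> 1) \<and>
         (\<forall>i\<ge>d. Poly_Mapping.lookup x i = 0)}"

definition cube_face_poset :: "nat \<Rightarrow> (nat \<Rightarrow>\<^sub>0 real) set rel" where
  "cube_face_poset d = relation_of (\<subseteq>) {F. F face_of unit_cube d}"

definition is_cube :: "nat \<Rightarrow> 'a rel \<Rightarrow> bool" where
  "is_cube d P \<longleftrightarrow> Partial_order P \<and> poset_isomorphic P (cube_face_poset d)"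

definition is_min_element :: "'a rel \<Rightarrow> 'a \<Rightarrow> bool" where
  "is_min_element P m \<longleftrightarrow> m \<in> Field P \<and> (\<forall>x\<in>Field P. (m, x) \<in> P)"

definition empty_face :: "'a rel \<Rightarrow> 'a" where
  "empty_face K = (THE m. is_min_element K m)"

definition nonempty_faces :: "'a rel \<Rightarrow> 'a set" where
  "nonempty_faces K = Field K - {empty_face K}"

text \<open>The interval from the empty face to \<open>F\<close>; it is \<open>F\<close> regarded as a complex.\<close>

definition face_complex :: "'a rel \<Rightarrow> 'a \<Rightarrow> 'a rel" where
  "face_complex K F = Restr K (under K F)"

text \<open>
  The one-element interval of the empty face has dimension \<open>-1\<close>; as \<open>d\<close> ranges over the naturals
  (a \<open>0\<close>-cube has two faces), the cube condition is imposed on nonempty faces only.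
\<close>

definition cubical_complex :: "'a rel \<Rightarrow> bool" where
  "cubical_complex K \<longleftrightarrow>
     finite (Field K) \<and> Partial_order K \<and> (\<exists>m. is_min_element K m) \<and>
     (\<forall>F\<in>nonempty_faces K. \<exists>d. is_cube d (face_complex K F)) \<and>
     (\<forall>x\<in>Field K. \<forall>y\<in>Field K. \<exists>z. (z, x) \<in> K \<and> (z, y) \<in> K \<and>
        (\<forall>w. (w, x) \<in> K \<and> (w, y) \<in> K \<longrightarrow> (w, z) \<in> K))"

text \<open>Meaningful for nonempty faces only.\<close>

definition face_dim :: "'a rel \<Rightarrow> 'a \<Rightarrow> nat" where
  "face_dim K F = (THE d. is_cube d (face_complex K F))"

definition subcomplex :: "'a rel \<Rightarrow> 'a set \<Rightarrow> bool" where
  "subcomplex K S \<longleftrightarrow> S \<noteq> {} \<and> S \<subseteq> Field K \<and> (\<forall>x\<in>S. under K x \<subseteq> S)"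

text \<open>
  The geometric realization of the order complex of the poset of nonempty faces, in barycentric
  coordinates: points are convex weights supported on a chain.
\<close>

definition realization :: "'a rel \<Rightarrow> ('a \<Rightarrow> real) topology" where
  "realization K = subtopology (powertop_real UNIV)
     {t. (\<forall>x. 0 \<le> t x) \<and> {x. t x \<noteq> 0} \<subseteq> nonempty_faces K \<and>
         {x. t x \<noteq> 0} \<in> Chains K \<and> (\<Sum>x\<in>nonempty_faces K. t x) = 1}"

definition unit_ball :: "nat \<Rightarrow> (nat \<Rightarrow> real) topology" where
  "unit_ball n = subtopology (Euclidean_space n) {x. (\<Sum>i<n. (x i)\<^sup>2) \<le> 1}"

text \<open>
  The boundary of an \<open>n\<close>-ball \<open>X\<close>: the points carried to the unit sphere by a homeomorphism onto the
  standard ball (for \<open>n = 0\<close> the boundary is empty).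
\<close>

definition ball_boundary :: "nat \<Rightarrow> 'a topology \<Rightarrow> 'a set" where
  "ball_boundary n X =
     {p \<in> topspace X. \<exists>f. homeomorphic_map X (unit_ball n) f \<and> (\<Sum>i<n. (f p i)\<^sup>2) = 1}"

text \<open>The faces of an \<open>n\<close>-ball \<open>L\<close> that are not contained in its boundary.\<close>

definition interior_faces :: "nat \<Rightarrow> 'a rel \<Rightarrow> 'a set" where
  "interior_faces n L =
     {E \<in> nonempty_faces L.
        \<not> topspace (realization (face_complex L E)) \<subseteq> ball_boundary n (realization L)}"

text \<open>The set \<open>K'\<^sub>F\<close> for a map \<open>\<sigma>\<close> from the nonempty faces of \<open>K'\<close> to those of \<open>K\<close>.\<close>

definition subdivided_face :: "'a rel \<Rightarrow> 'b rel \<Rightarrow> ('b \<Rightarrow> 'a) \<Rightarrow> 'a \<Rightarrow> 'b set" where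
  "subdivided_face K K' \<sigma> F =
     (\<sigma> -` {G \<in> nonempty_faces K. (G, F) \<in> K} \<inter> nonempty_faces K') \<union> {empty_face K'}"

definition cubical_subdivision :: "'a rel \<Rightarrow> 'b rel \<Rightarrow> ('b \<Rightarrow> 'a) \<Rightarrow> bool" where
  "cubical_subdivision K K' \<sigma> \<longleftrightarrow>
     cubical_complex K \<and> cubical_complex K' \<and>
     \<sigma> \<in> nonempty_faces K' \<rightarrow> nonempty_faces K \<and>
     (\<forall>F\<in>nonempty_faces K.
        subcomplex K' (subdivided_face K K' \<sigma> F) \<and>
        realization (Restr K' (subdivided_face K K' \<sigma> F)) homeomorphic_space
          unit_ball (face_dim K F) \<and>
        \<sigma> -` {F} \<inter> nonempty_faces K' =
          interior_faces (face_dim K F) (Restr K' (subdivided_face K K' \<sigma> F)))"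

text \<open>The short cubical \<open>h\<close>-polynomial of \<open>L\<close>, regarded as a complex of dimension \<open>k\<close>.\<close>

definition short_cubical_h :: "nat \<Rightarrow> 'a rel \<Rightarrow> real poly" where
  "short_cubical_h k L =
     (\<Sum>E\<in>nonempty_faces L. [:0, 2:] ^ face_dim L E * [:1, -1:] ^ (k - face_dim L E))"

definition short_cubical_local_h ::
  "nat \<Rightarrow> 'a rel \<Rightarrow> 'b rel \<Rightarrow> ('b \<Rightarrow> 'a) \<Rightarrow> real poly" where
  "short_cubical_local_h d C \<Gamma> \<sigma> =
     (\<Sum>F\<in>nonempty_faces C. (-1) ^ (d - face_dim C F) *
        short_cubical_h (face_dim C F) (Restr \<Gamma> (subdivided_face C \<Gamma> \<sigma> F)))"

end

theory Submission
  imports "HOL-Homology.Homology" Defs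
begin

text \<open>
  For a cubical complex \<open>L\<close> homeomorphic to an \<open>n\<close>-ball, the key relation is that for every nonempty
  face \<open>E\<close> the sum of \<open>(-1) ^ (n - dim G)\<close> over the faces \<open>G\<close> containing \<open>E\<close> is \<open>1\<close> if \<open>E\<close> is interior and
  \<open>0\<close> otherwise. Both sides compute, up to sign, the local Euler characteristic
  \<open>\<chi>(X) - \<chi>(X - {q})\<close> of \<open>X = |L|\<close> at a point \<open>q\<close> in the relative interior of \<open>E\<close>. In the ball,
  \<open>X - {q}\<close> is contractible if \<open>q\<close> lies on the boundary and is a homotopy sphere otherwise. In the order
  complex, \<open>X - {q}\<close> retracts onto the simplices not containing the carrier of \<open>q\<close>, and the alternating
  sum over the chains containing a given chain depends only on its top element, because the
  intervals in \<open>L\<close> are cubes. Here \<open>\<chi>\<close> is defined by ranks of singular homology groups; excision and the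
  long exact sequence identify it with the simplicial Euler characteristic.

  Summed over all \<open>E\<close>, the relation shows that reversing the short cubical \<open>h\<close>-polynomial of \<open>L\<close> leaves the
  same sum restricted to interior faces. As the faces of \<open>\<Gamma>\<close> are partitioned into the interiors of
  the balls \<open>\<Gamma>\<^sub>F\<close>, both sides of the symmetry become the sum over the nonempty faces \<open>E\<close> of \<open>\<Gamma>\<close> of
  \<open>(2x)\<^bsup>dim E\<^esup> (1-x)\<^bsup>dim \<sigma>(E) - dim E\<^esup> (-x)\<^bsup>d - dim \<sigma>(E)\<^esup>\<close>.
\<close>

subsection \<open>Rank of a subgroup of an abelian group\<close>

text \<open>Only ranks are compared, never homology groups: alternating sums of ranks are additive
  along the long exact sequence, and this is enough to match singular with simplicial Euler
  characteristics one maximal simplex at a time. The boundary of a ball is described through some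
  homeomorphism, which may vary from point to point; the local Euler characteristic does not see
  that choice, so one fixed homeomorphism can be used throughout. A face is interior as soon as one
  of its points is, so the criterion for points has to be carried to the barycenter of the face by a
  limiting argument. The exponents \<open>n - dim E\<close> are subtractions of naturals; that no
  face of an \<open>n\<close>-ball has dimension above \<open>n\<close> comes from invariance of
  domain. The cube enters through one identity: with weight \<open>y\<close> per free and
  \<open>z\<close> per fixed coordinate, its nonempty faces sum to \<open>(y + 2 * z) ^ d\<close>.
  The choice \<open>y = 2x\<close>, \<open>z = 1 - x\<close> makes the base the constant 2, which is
  what the factor 2 in the short cubical polynomial achieves.\<close>

definition torsion_over :: "('a, 'b) monoid_scheme \<Rightarrow> 'a set \<Rightarrow> 'a set \<Rightarrow> bool" where
  "torsion_over G H H' \<longleftrightarrow> (\<forall>g\<in>H'. \<exists>n>0::nat. g [^]\<^bsub>G\<^esub> n \<in> H)"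

text \<open>
  Measuring rank by chains of subgroups with non-torsion quotients, instead of by independent
  elements, makes rank-nullity a matter of intersecting and concatenating chains.
\<close>

inductive flag :: "('a, 'b) monoid_scheme \<Rightarrow> nat \<Rightarrow> 'a set \<Rightarrow> bool" for G where
  flag_0: "subgroup H G \<Longrightarrow> flag G 0 H"
| flag_Suc: "flag G k H \<Longrightarrow> subgroup H' G \<Longrightarrow> H \<subseteq> H' \<Longrightarrow> \<not> torsion_over G H H' \<Longrightarrow> flag G (Suc k) H'"

lemma flag_subgroup: "flag G k H \<Longrightarrow> subgroup H G"
  by (induction rule: flag.induct) auto

lemma flag_mono: "flag G k H \<Longrightarrow> H \<subseteq> H' \<Longrightarrow> subgroup H' G \<Longrightarrow> flag G k H'"
proof (induction arbitrary: H' rule: flag.induct)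
  case (flag_0 H)
  then show ?case by (simp add: flag.flag_0)
next
  case (flag_Suc k H H1)
  show ?case
  proof (rule flag.flag_Suc)
    show "flag G k H" by fact
    show "\<not> torsion_over G H H'"
      using flag_Suc by (auto simp: torsion_over_def)
  qed (use flag_Suc in auto)
qed

lemma flag_SucD: "flag G (Suc k) H \<Longrightarrow> flag G k H"
  by (erule flag.cases) (auto intro: flag_mono)

lemma flag_le: "flag G k H \<Longrightarrow> j \<le> k \<Longrightarrow> flag G j H"
  by (induction k) (auto simp: le_Suc_eq dest: flag_SucD)

definition finite_rank :: "('a, 'b) monoid_scheme \<Rightarrow> 'a set \<Rightarrow> bool" where
  "finite_rank G H \<longleftrightarrow> (\<exists>k. \<not> flag G k H)"

text \<open>For abelian \<open>G\<close> this is the dimension of \<open>H\<close> tensored with the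
  rationals. Flag lengths are closed downwards, so the first missing length marks the maximum; the
  value is meaningful only under \<open>finite_rank\<close>.\<close>

definition subgroup_rank :: "('a, 'b) monoid_scheme \<Rightarrow> 'a set \<Rightarrow> nat" where
  "subgroup_rank G H = (LEAST k. \<not> flag G (Suc k) H)"

lemma flag_iff_le_rank:
  assumes "subgroup H G" "finite_rank G H"
  shows "flag G k H \<longleftrightarrow> k \<le> subgroup_rank G H"
proof -
  have ex: "\<exists>k. \<not> flag G (Suc k) H"
    using assms(2) flag_SucD unfolding finite_rank_def by blast
  have n: "\<not> flag G (Suc (subgroup_rank G H)) H"
    unfolding subgroup_rank_def using LeastI_ex[OF ex] .
  have "flag G (subgroup_rank G H) H"
  proof (cases "subgroup_rank G H")
    case 0
    then show ?thesis using assms(1) by (simp add: flag.flag_0)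
  next
    case (Suc j)
    then have "j < (LEAST k. \<not> flag G (Suc k) H)" by (simp add: subgroup_rank_def)
    then have "flag G (Suc j) H" using not_less_Least by blast
    then show ?thesis using Suc by simp
  qed
  then show ?thesis
    using n by (meson flag_le not_less_eq_eq)
qed

lemma rank_eqI:
  assumes "\<And>k. flag G k H \<longleftrightarrow> k \<le> r"
  shows "finite_rank G H" "subgroup_rank G H = r"
proof -
  show "finite_rank G H"
    unfolding finite_rank_def using assms[of "Suc r"] by auto
  show "subgroup_rank G H = r"
    unfolding subgroup_rank_def assms by (rule Least_equality) auto
qed

lemma (in group) subgroup_nat_pow_closed: "subgroup H G \<Longrightarrow> x \<in> H \<Longrightarrow> x [^] (n::nat) \<in> H"
  by (induction n) (auto intro: subgroup.one_closed subgroup.m_closed)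

text \<open>Intersect the chain with the kernel and push it to the image. A step that became torsion
  on both sides would itself be torsion: some power of \<open>g\<close> differs from an element of
  \<open>H\<close> by an element of the kernel, and a further power brings that element into
  \<open>H\<close>. So each step survives on at least one side.\<close>

lemma (in comm_group) flag_split:
  assumes f: "group_hom G C f" and "flag G k H"
  shows "\<exists>i j. i + j = k \<and> flag G i (H \<inter> kernel G C f) \<and> flag C j (f ` H)"
  using assms(2)
proof (induction rule: flag.induct)
  case (flag_0 H)
  interpret f: group_hom G C f by fact
  show ?case
    using flag_0 f.subgroup_kernel f.subgroup_img_is_subgroup subgroups_Inter_pair
    by (auto intro!: flag.flag_0)
next
  case (flag_Suc k H H')
  interpret f: group_hom G C f by fact
  let ?K = "kernel G C f"
  obtain i j where ij: "i + j = k" "flag G i (H \<inter> ?K)" "flag C j (f ` H)"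
    using flag_Suc by blast
  interpret H: subgroup H G using flag_subgroup flag_Suc by blast
  interpret H': subgroup H' G by fact
  have sub: "subgroup (H' \<inter> ?K) G" "subgroup (f ` H') C"
    using flag_Suc f.subgroup_kernel f.subgroup_img_is_subgroup subgroups_Inter_pair by auto
  have "\<not> torsion_over G (H \<inter> ?K) (H' \<inter> ?K) \<or> \<not> torsion_over C (f ` H) (f ` H')"
  proof (rule ccontr)
    assume "\<not> ?thesis"
    then have a: "torsion_over G (H \<inter> ?K) (H' \<inter> ?K)" and b: "torsion_over C (f ` H) (f ` H')"
      by auto
    have "torsion_over G H H'"
      unfolding torsion_over_def
    proof
      fix g assume g: "g \<in> H'"
      then obtain n :: nat and h where n: "n > 0" "h \<in> H" "f g [^]\<^bsub>C\<^esub> n = f h"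
        using b unfolding torsion_over_def by force
      have gG: "g \<in> carrier G" and hG: "h \<in> carrier G" "h \<in> H'"
        using g n flag_Suc.hyps by auto
      define u where "u = g [^] n \<otimes> inv h"
      have uG: "u \<in> carrier G" using gG hG by (simp add: u_def)
      have "u \<in> H'"
        unfolding u_def using g hG by (simp add: subgroup_nat_pow_closed H'.subgroup_axioms)
      moreover have "u \<in> ?K"
        using gG hG n by (simp add: kernel_def u_def f.hom_nat_pow)
      ultimately obtain m :: nat where m: "m > 0" "u [^] m \<in> H"
        using a unfolding torsion_over_def by blast
      have "g [^] n = u \<otimes> h"
        using gG hG by (simp add: u_def m_assoc)
      then have "g [^] (n * m) = u [^] m \<otimes> h [^] m"
        using uG hG gG by (simp add: nat_pow_pow[symmetric] pow_mult_distrib m_comm)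
      also have "\<dots> \<in> H"
        using m n by (simp add: subgroup_nat_pow_closed H.subgroup_axioms)
      finally show "\<exists>n>0::nat. g [^] n \<in> H"
        using m n by (metis nat_0_less_mult_iff)
    qed
    then show False using flag_Suc by blast
  qed
  then show ?case
  proof
    assume "\<not> torsion_over G (H \<inter> ?K) (H' \<inter> ?K)"
    then have "flag G (Suc i) (H' \<inter> ?K)"
      using ij sub flag_Suc.hyps by (intro flag.flag_Suc) auto
    moreover have "flag C j (f ` H')"
      using ij sub flag_Suc.hyps by (auto intro: flag_mono)
    ultimately show ?thesis using ij by (metis add_Suc)
  next
    assume "\<not> torsion_over C (f ` H) (f ` H')"
    then have "flag C (Suc j) (f ` H')"
      using ij sub flag_Suc.hyps by (intro flag.flag_Suc) auto
    moreover have "flag G i (H' \<inter> ?K)"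
      using ij sub flag_Suc.hyps by (auto intro: flag_mono)
    ultimately show ?thesis using ij by (metis add_Suc_right)
  qed
qed

lemma (in group_hom) subgroup_preimage:
  assumes "subgroup I H"
  shows "subgroup {x \<in> carrier G. h x \<in> I} G"
proof -
  interpret I: subgroup I H by fact
  show ?thesis
    by (rule G.subgroupI) (auto intro: exI[of _ "\<one>\<^bsub>G\<^esub>"])
qed

text \<open>Preimages of subgroups of the image contain the kernel, so they can be stacked on a
  chain that ends there. Torsion between two preimages would push forward to torsion between the
  subgroups, because each of their elements is a value of \<open>h\<close>.\<close>

lemma (in group_hom) flag_combine:
  assumes K: "flag G i (kernel G H h)" and "flag H j I" "I \<subseteq> h ` carrier G"
  shows "flag G (i + j) {x \<in> carrier G. h x \<in> I}"
  using assms(2,3)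
proof (induction rule: flag.induct)
  case (flag_0 I)
  have "flag G i {x \<in> carrier G. h x \<in> I}"
    by (rule flag_mono[OF K])
      (use flag_0 subgroup_preimage subgroup.one_closed in \<open>auto simp: kernel_def\<close>)
  then show ?case by simp
next
  case (flag_Suc k I I')
  have "\<not> torsion_over G {x \<in> carrier G. h x \<in> I} {x \<in> carrier G. h x \<in> I'}"
  proof
    assume t: "torsion_over G {x \<in> carrier G. h x \<in> I} {x \<in> carrier G. h x \<in> I'}"
    have "torsion_over H I I'"
      unfolding torsion_over_def
    proof
      fix y assume y: "y \<in> I'"
      then obtain x where x: "x \<in> carrier G" "y = h x" using flag_Suc by blast
      then obtain n :: nat where "n > 0" "h (x [^]\<^bsub>G\<^esub> n) \<in> I"
        using t y unfolding torsion_over_def by blast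
      then show "\<exists>n>0::nat. y [^]\<^bsub>H\<^esub> n \<in> I"
        using x by (auto simp: hom_nat_pow)
    qed
    then show False using flag_Suc by blast
  qed
  moreover have "flag G (i + k) {x \<in> carrier G. h x \<in> I}"
    using flag_Suc by blast
  ultimately show ?case
    using flag_Suc subgroup_preimage by (auto intro: flag.flag_Suc)
qed

lemma (in comm_group) flag_carrier_iff:
  assumes "group_hom G C f"
  shows "flag G k (carrier G) \<longleftrightarrow>
    (\<exists>i j. i + j = k \<and> flag G i (kernel G C f) \<and> flag C j (f ` carrier G))"
proof
  assume "flag G k (carrier G)"
  moreover have "carrier G \<inter> kernel G C f = kernel G C f" by (auto simp: kernel_def)
  ultimately show "\<exists>i j. i + j = k \<and> flag G i (kernel G C f) \<and> flag C j (f ` carrier G)"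
    using flag_split[OF assms] by metis
next
  assume "\<exists>i j. i + j = k \<and> flag G i (kernel G C f) \<and> flag C j (f ` carrier G)"
  then show "flag G k (carrier G)"
    using group_hom.flag_combine[OF assms] by (metis (no_types, lifting) flag_mono
      mem_Collect_eq subgroup_self subsetI order_refl)
qed

lemma (in comm_group) rank_nullity:
  assumes f: "group_hom G C f"
  shows "finite_rank G (carrier G) \<longleftrightarrow>
      finite_rank G (kernel G C f) \<and> finite_rank C (f ` carrier G)"
    and "finite_rank G (carrier G) \<Longrightarrow>
      subgroup_rank G (carrier G) = subgroup_rank G (kernel G C f) + subgroup_rank C (f ` carrier G)"
proof -
  interpret f: group_hom G C f by fact
  have sub: "subgroup (kernel G C f) G" "subgroup (f ` carrier G) C"
    using f.subgroup_kernel f.img_is_subgroup by auto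
  \<comment> \<open>Chains of length 0 exist on both sides, so a bound on the total length bounds
    each summand.\<close>
  have fl: "flag G 0 (kernel G C f)" "flag C 0 (f ` carrier G)"
    using sub by (auto intro: flag.flag_0)
  have sum: "flag G k (carrier G) \<longleftrightarrow> k \<le> subgroup_rank G (kernel G C f) + subgroup_rank C (f ` carrier G)"
    if "finite_rank G (kernel G C f)" "finite_rank C (f ` carrier G)" for k
    unfolding flag_carrier_iff[OF f] flag_iff_le_rank[OF sub(1) that(1)] flag_iff_le_rank[OF sub(2) that(2)]
  proof
    assume "k \<le> subgroup_rank G (kernel G C f) + subgroup_rank C (f ` carrier G)"
    then show "\<exists>i j. i + j = k \<and> i \<le> subgroup_rank G (kernel G C f) \<and> j \<le> subgroup_rank C (f ` carrier G)"
      by (intro exI[of _ "min k (subgroup_rank G (kernel G C f))"] exI[of _ "k - min k (subgroup_rank G (kernel G C f))"]) auto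
  qed auto
  have imp: "finite_rank G (kernel G C f) \<and> finite_rank C (f ` carrier G)" if "finite_rank G (carrier G)"
    using that fl unfolding finite_rank_def flag_carrier_iff[OF f] by (metis add.right_neutral add_0)
  show "finite_rank G (carrier G) \<longleftrightarrow>
      finite_rank G (kernel G C f) \<and> finite_rank C (f ` carrier G)"
    using imp rank_eqI(1)[OF sum] by blast
  show "subgroup_rank G (carrier G) = subgroup_rank G (kernel G C f) + subgroup_rank C (f ` carrier G)"
    if "finite_rank G (carrier G)"
    using imp[OF that] rank_eqI(2)[OF sum] by blast
qed

lemma (in group) rank_one:
  shows "finite_rank G {\<one>}" "subgroup_rank G {\<one>} = 0"
proof -
  have "flag G k {\<one>} \<longleftrightarrow> k \<le> 0" for k
  proof
    assume "flag G k {\<one>}"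
    then show "k \<le> 0"
    proof cases
      case (flag_Suc j H)
      then have "\<one> \<in> H" using flag_subgroup subgroup.one_closed by blast
      then have "torsion_over G H {\<one>}" by (auto simp: torsion_over_def)
      then show ?thesis using flag_Suc by blast
    qed auto
  qed (auto intro: flag.flag_0 triv_subgroup)
  then show "finite_rank G {\<one>}" "subgroup_rank G {\<one>} = 0" by (rule rank_eqI)+
qed

lemma rank_trivial_group:
  assumes "trivial_group G"
  shows "finite_rank G (carrier G)" "subgroup_rank G (carrier G) = 0"
proof -
  interpret group G using assms by (simp add: trivial_group_def)
  have "carrier G = {\<one>\<^bsub>G\<^esub>}" using assms by (simp add: trivial_group_def)
  then show "finite_rank G (carrier G)" "subgroup_rank G (carrier G) = 0" using rank_one by auto
qed

lemma rank_iso: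
  assumes "comm_group G" "group C" "G \<cong> C"
  shows "finite_rank G (carrier G) \<longleftrightarrow> finite_rank C (carrier C)"
    and "finite_rank G (carrier G) \<Longrightarrow> subgroup_rank G (carrier G) = subgroup_rank C (carrier C)"
proof -
  interpret comm_group G by fact
  obtain f where f: "f \<in> iso G C" using assms by (auto simp: is_iso_def)
  have h: "group_hom G C f"
    using assms f by (auto simp: group_hom_def group_hom_axioms_def iso_def is_group)
  have "kernel G C f = {\<one>\<^bsub>G\<^esub>}" "f ` carrier G = carrier C"
    using f iso_kernel_image[OF is_group assms(2)] by auto
  then show "finite_rank G (carrier G) \<longleftrightarrow> finite_rank C (carrier C)"
    "finite_rank G (carrier G) \<Longrightarrow> subgroup_rank G (carrier G) = subgroup_rank C (carrier C)"
    using rank_nullity[OF h] rank_one by auto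
qed

lemma rank_integer_group: "finite_rank integer_group UNIV" "subgroup_rank integer_group UNIV = 1"
proof -
  have H: "torsion_over integer_group H UNIV" if H: "subgroup H integer_group" "x \<in> H" "x \<noteq> 0" for H x
  proof -
    have "\<exists>n>0. int n * g \<in> H" for g
    proof -
      \<comment> \<open>Natural powers yield only nonnegative multiples of \<open>x\<close>, so the
        multiple of \<open>g\<close> by the absolute value of \<open>x\<close> is written as plus or
        minus such a multiple of \<open>x\<close>.\<close>
      have "int (nat \<bar>x\<bar>) * g = \<bar>g * sgn g\<bar> * x \<or> int (nat \<bar>x\<bar>) * g = - (\<bar>g * sgn g\<bar> * x)"
        by (auto simp: abs_if sgn_if)
      moreover have "int m * x \<in> H" for m
        using H group.subgroup_nat_pow_closed by (metis group_integer_group group_nat_pow_integer_group)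
      moreover have "- y \<in> H" if "y \<in> H" for y
        using subgroup.m_inv_closed[OF H(1) that] by simp
      ultimately have "int (nat \<bar>x\<bar>) * g \<in> H"
        by (metis abs_ge_zero zero_le_imp_eq_int)
      then show ?thesis using H(3) by (intro exI[of _ "nat \<bar>x\<bar>"]) auto
    qed
    then show ?thesis by (auto simp: torsion_over_def)
  qed
  have "flag integer_group k UNIV \<longleftrightarrow> k \<le> 1" for k
  proof
    assume f: "flag integer_group k UNIV"
    show "k \<le> 1"
    proof (rule ccontr)
      assume "\<not> k \<le> 1"
      then have "flag integer_group (Suc (Suc 0)) UNIV" using f flag_le by fastforce
      then obtain H1 where 1: "flag integer_group (Suc 0) H1" "\<not> torsion_over integer_group H1 UNIV"
        by cases auto
      from 1(1) obtain H0 where "subgroup H0 integer_group" "\<not> torsion_over integer_group H0 H1"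
        by cases (auto dest: flag_subgroup)
      moreover have "subgroup H1 integer_group" using 1 flag_subgroup by blast
      \<comment> \<open>A zero \<open>H1\<close> would be torsion over \<open>H0\<close>. A nonzero
        \<open>H1\<close> has torsion quotient in the integers, against the last step of the
        flag.\<close>
      ultimately have "\<exists>x\<in>H1. x \<noteq> 0"
        using subgroup.one_closed[of H0 integer_group]
        unfolding torsion_over_def by (metis group_nat_pow_integer_group mult_zero_right one_integer_group zero_less_one)
      then show False using H 1(2) \<open>subgroup H1 integer_group\<close> by blast
    qed
  next
    have s: "subgroup {0} integer_group" "subgroup UNIV integer_group"
      using group.triv_subgroup[OF group_integer_group] group.subgroup_self[OF group_integer_group] by auto
    have "flag integer_group (Suc 0) UNIV"
      by (rule flag.flag_Suc[OF flag.flag_0[OF s(1)] s(2)]) (auto simp: torsion_over_def intro!: exI[of _ 1])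
    then show "k \<le> 1 \<Longrightarrow> flag integer_group k UNIV"
      using flag_le by auto
  qed
  then show "finite_rank integer_group UNIV" "subgroup_rank integer_group UNIV = 1" by (rule rank_eqI)+
qed

subsection \<open>Euler characteristic of a pair of spaces\<close>

definition betti :: "int \<Rightarrow> 'a topology \<Rightarrow> 'a set \<Rightarrow> nat" where
  "betti p X S =
     subgroup_rank (relative_homology_group p X S) (carrier (relative_homology_group p X S))"

definition finite_homology :: "'a topology \<Rightarrow> 'a set \<Rightarrow> bool" where
  "finite_homology X S \<longleftrightarrow>
     (\<forall>p. finite_rank (relative_homology_group p X S) (carrier (relative_homology_group p X S))) \<and>
     finite {p::nat. betti p X S \<noteq> 0}"

text \<open>Degrees are natural because homology vanishes below degree 0. The value is meaningful
  under \<open>finite_homology\<close>, since a sum over an infinite set is 0.\<close>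

definition euler_char :: "'a topology \<Rightarrow> 'a set \<Rightarrow> int" where
  "euler_char X S = (\<Sum>p | betti (int p) X S \<noteq> 0. (-1) ^ p * int (betti p X S))"

lemma euler_char_eq_sum_atMost:
  assumes "\<And>p. p > N \<Longrightarrow> betti (int p) X S = 0"
  shows "euler_char X S = (\<Sum>p\<le>N. (-1) ^ p * int (betti p X S))"
proof -
  have "{p. betti (int p) X S \<noteq> 0} \<subseteq> {..N}" using assms linorder_not_less by blast
  then show ?thesis
    unfolding euler_char_def by (intro sum.mono_neutral_left) simp_all
qed

lemma finite_homologyE:
  assumes "finite_homology X S"
  obtains N :: nat where "\<And>p::nat. p > N \<Longrightarrow> betti p X S = 0"
proof -
  obtain N where "\<forall>p\<in>{p::nat. betti p X S \<noteq> 0}. p \<le> N"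
    using assms finite_nat_set_iff_bounded_le by (auto simp: finite_homology_def)
  then show thesis by (intro that[of N]) force
qed

lemma finite_homologyI:
  fixes N :: nat
  assumes "\<And>p. finite_rank (relative_homology_group p X S) (carrier (relative_homology_group p X S))"
    and "\<And>p::nat. p > N \<Longrightarrow> betti p X S = 0"
  shows "finite_homology X S"
proof -
  have "{p::nat. betti p X S \<noteq> 0} \<subseteq> {..N}" using assms(2) linorder_not_less by blast
  then have "finite {p::nat. betti p X S \<noteq> 0}" using finite_subset by blast
  then show ?thesis using assms(1) by (simp add: finite_homology_def)
qed

lemma finite_homology_iso:
  assumes "\<And>p. relative_homology_group p X S \<cong> relative_homology_group p Y T"
  shows "finite_homology X S \<longleftrightarrow> finite_homology Y T"
    and "finite_homology X S \<Longrightarrow> euler_char X S = euler_char Y T"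
proof -
  note r = rank_iso[OF abelian_relative_homology_group group_relative_homology_group assms]
  have b: "betti p X S = betti p Y T"
    if "\<forall>p. finite_rank (relative_homology_group p X S) (carrier (relative_homology_group p X S))" for p
    unfolding betti_def using that by (intro r(2)) simp
  have f: "(\<forall>p. finite_rank (relative_homology_group p X S) (carrier (relative_homology_group p X S)))
      \<longleftrightarrow> (\<forall>p. finite_rank (relative_homology_group p Y T) (carrier (relative_homology_group p Y T)))"
    using r(1) by simp
  show "finite_homology X S \<longleftrightarrow> finite_homology Y T"
    unfolding finite_homology_def using f b by (metis (mono_tags, lifting) Collect_cong)
  show "euler_char X S = euler_char Y T" if "finite_homology X S"
    using that b by (simp add: euler_char_def finite_homology_def)
qed

lemma finite_homology_homotopy_equivalent:
  assumes "X homotopy_equivalent_space Y"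
  shows "finite_homology X {} \<longleftrightarrow> finite_homology Y {}"
    and "finite_homology X {} \<Longrightarrow> euler_char X {} = euler_char Y {}"
  using finite_homology_iso[OF homotopy_equivalent_space_imp_isomorphic_homology_groups[OF assms]]
  by simp_all

context
  fixes X :: "'a topology" and S :: "'a set"
begin

private abbreviation "HA p \<equiv> homology_group p (subtopology X S)"
private abbreviation "HX p \<equiv> homology_group p X"
private abbreviation "HR p \<equiv> relative_homology_group p X S"
private abbreviation "I p \<equiv> hom_induced p (subtopology X S) {} X {} id ` carrier (HA p)"
private abbreviation "J p \<equiv> hom_induced p X {} X S id ` carrier (HX p)"
private abbreviation "B p \<equiv> hom_boundary p X S ` carrier (HR p)"

text \<open>Exactness makes each of the images \<open>I\<close>, \<open>J\<close>, \<open>B\<close>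
  the kernel of the next map, so rank-nullity writes every rank in the sequence as a sum of the
  ranks of two neighbouring images.\<close>

private lemma rank_long_exact_sequence:
  shows "finite_rank (HX p) (carrier (HX p)) \<longleftrightarrow> finite_rank (HX p) (I p) \<and> finite_rank (HR p) (J p)"
    and "finite_rank (HR p) (carrier (HR p)) \<longleftrightarrow> finite_rank (HR p) (J p) \<and> finite_rank (HA (p - 1)) (B p)"
    and "finite_rank (HA p) (carrier (HA p)) \<longleftrightarrow> finite_rank (HA p) (B (p + 1)) \<and> finite_rank (HX p) (I p)"
    and "finite_rank (HX p) (carrier (HX p)) \<Longrightarrow>
      betti p X {} = subgroup_rank (HX p) (I p) + subgroup_rank (HR p) (J p)"
    and "finite_rank (HR p) (carrier (HR p)) \<Longrightarrow>
      betti p X S = subgroup_rank (HR p) (J p) + subgroup_rank (HA (p - 1)) (B p)"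
    and "finite_rank (HA p) (carrier (HA p)) \<Longrightarrow>
      betti p (subtopology X S) {} = subgroup_rank (HA p) (B (p + 1)) + subgroup_rank (HX p) (I p)"
proof -
  have 1: "group_hom (HX p) (HR p) (hom_induced p X {} X S id)"
      "kernel (HX p) (HR p) (hom_induced p X {} X S id) = I p"
    using homology_exactness_axiom_3[of p X S]
    by (simp_all add: group_hom_def group_hom_axioms_def)
  have 2: "group_hom (HR p) (HA (p - 1)) (hom_boundary p X S)"
      "kernel (HR p) (HA (p - 1)) (hom_boundary p X S) = J p"
    using homology_exactness_axiom_1[of p X S]
    by (simp_all add: group_hom_def group_hom_axioms_def)
  have 3: "group_hom (HA p) (HX p) (hom_induced p (subtopology X S) {} X {} id)"
      "kernel (HA p) (HX p) (hom_induced p (subtopology X S) {} X {} id) = B (p + 1)"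
    using homology_exactness_axiom_2[of "p + 1" X S]
    by (simp_all add: group_hom_def group_hom_axioms_def)
  note rn = comm_group.rank_nullity[OF abelian_relative_homology_group]
  show "finite_rank (HX p) (carrier (HX p)) \<longleftrightarrow> finite_rank (HX p) (I p) \<and> finite_rank (HR p) (J p)"
    "finite_rank (HX p) (carrier (HX p)) \<Longrightarrow>
      betti p X {} = subgroup_rank (HX p) (I p) + subgroup_rank (HR p) (J p)"
    unfolding betti_def 1(2)[symmetric] by (rule rn[OF 1(1)]; assumption)+
  show "finite_rank (HR p) (carrier (HR p)) \<longleftrightarrow> finite_rank (HR p) (J p) \<and> finite_rank (HA (p - 1)) (B p)"
    "finite_rank (HR p) (carrier (HR p)) \<Longrightarrow>
      betti p X S = subgroup_rank (HR p) (J p) + subgroup_rank (HA (p - 1)) (B p)"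
    unfolding betti_def 2(2)[symmetric] by (rule rn[OF 2(1)]; assumption)+
  show "finite_rank (HA p) (carrier (HA p)) \<longleftrightarrow> finite_rank (HA p) (B (p + 1)) \<and> finite_rank (HX p) (I p)"
    "finite_rank (HA p) (carrier (HA p)) \<Longrightarrow>
      betti p (subtopology X S) {} = subgroup_rank (HA p) (B (p + 1)) + subgroup_rank (HX p) (I p)"
    unfolding betti_def 3(2)[symmetric] by (rule rn[OF 3(1)]; assumption)+
qed

text \<open>Each image rank occurs twice in the combined alternating sum, with opposite signs. The
  rank of \<open>J\<close> is a summand for both \<open>HX\<close> and \<open>HR\<close>, so
  finiteness of either one is enough.\<close>

lemma euler_char_pair:
  assumes "finite_homology (subtopology X S) {}" "finite_homology X {} \<or> finite_homology X S"
  shows "finite_homology X {}" "finite_homology X S"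
    "euler_char X {} = euler_char (subtopology X S) {} + euler_char X S"
proof -
  have fA: "finite_rank (HA p) (carrier (HA p))" for p
    using assms(1) by (simp add: finite_homology_def)
  have fB: "finite_rank (HA (p - 1)) (B p)" for p
    using fA[of "p - 1"] unfolding rank_long_exact_sequence(3) by simp
  have fI: "finite_rank (HX p) (I p)" for p
    using fA[of p] unfolding rank_long_exact_sequence(3) by simp
  have fJ: "finite_rank (HR p) (J p)" for p
    using assms(2) rank_long_exact_sequence(1,2)[of p] by (auto simp: finite_homology_def)
  have fX: "finite_rank (HX p) (carrier (HX p))" and fR: "finite_rank (HR p) (carrier (HR p))" for p
    using fB fI fJ rank_long_exact_sequence(1,2)[of p] by auto
  define i where "i p = subgroup_rank (HX (int p)) (I (int p))" for p
  define j where "j p = subgroup_rank (HR (int p)) (J (int p))" for p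
  define b where "b p = subgroup_rank (HA (int p - 1)) (B (int p))" for p
  have bA: "betti (int p) (subtopology X S) {} = b (Suc p) + i p" for p
    using rank_long_exact_sequence(6)[OF fA] by (simp add: b_def i_def add.commute)
  have bX: "betti (int p) X {} = i p + j p" for p
    using rank_long_exact_sequence(4)[OF fX] by (simp add: i_def j_def)
  have bR: "betti (int p) X S = j p + b p" for p
    using rank_long_exact_sequence(5)[OF fR] by (simp add: b_def j_def)
  \<comment> \<open>The boundary map leaving degree 0 lands in the trivial group of degree -1, so
    the telescoping sum has no initial term.\<close>
  have "B 0 = {\<one>\<^bsub>HA (-1)\<^esub>}"
  proof -
    have "group_hom (HR 0) (HA (-1)) (hom_boundary 0 X S)"
      using homology_exactness_axiom_1[of 0 X S] by (simp add: group_hom_def group_hom_axioms_def)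
    then have "subgroup (B 0) (HA (-1))" by (rule group_hom.img_is_subgroup)
    moreover have "carrier (HA (-1)) = {\<one>\<^bsub>HA (-1)\<^esub>}"
      using trivial_relative_homology_group[of "-1"] by (simp add: trivial_group_def)
    ultimately show ?thesis
      using subgroup.subset subgroup.one_closed by fastforce
  qed
  then have b0: "b 0 = 0"
    using group.rank_one(2)[OF group_relative_homology_group] by (simp add: b_def)
  obtain NA where NA: "\<And>p. p > NA \<Longrightarrow> betti (int p) (subtopology X S) {} = 0"
    using finite_homologyE[OF assms(1)] by blast
  obtain M where M: "(\<forall>p>M. betti (int p) X {} = 0) \<or> (\<forall>p>M. betti (int p) X S = 0)"
    using assms(2) by (metis finite_homologyE)
  define N where "N = Suc (NA + M)"
  have "b p = 0 \<and> i p = 0 \<and> j p = 0" if "p > N" for p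
  proof -
    have "b p = 0" using NA[of "p - 1"] bA[of "p - 1"] that by (simp add: N_def)
    moreover have "i p = 0" using NA[of p] bA[of p] that by (simp add: N_def)
    moreover have "j p = 0" using M bX[of p] bR[of p] that by (auto simp: N_def)
    ultimately show ?thesis by simp
  qed
  note z = this
  show "finite_homology X {}" "finite_homology X S"
    using fX fR z bX bR by (auto intro!: finite_homologyI[of _ _ N])
  \<comment> \<open>Only the \<open>b\<close> terms remain, and they telescope to the last one,
    which vanishes beyond \<open>N\<close>.\<close>
  have t: "(\<Sum>p\<le>n. (-1) ^ p * (int (b (Suc p) + i p) + int (j p + b p) - int (i p + j p))) = (-1) ^ n * int (b (Suc n))" for n
    by (induction n) (auto simp: b0 algebra_simps)
  have "(\<Sum>p\<le>N. (-1) ^ p * int (b (Suc p) + i p)) + (\<Sum>p\<le>N. (-1) ^ p * int (j p + b p))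
      - (\<Sum>p\<le>N. (-1) ^ p * int (i p + j p)) = 0"
    using t[of N] z[of "Suc N"] by (simp add: sum.distrib sum_subtractf algebra_simps)
  moreover have "euler_char (subtopology X S) {} = (\<Sum>p\<le>N. (-1) ^ p * int (b (Suc p) + i p))"
    using euler_char_eq_sum_atMost[of N "subtopology X S" "{}"] z unfolding bA
    by (metis (no_types, lifting) add.right_neutral less_Suc_eq)
  moreover have "euler_char X {} = (\<Sum>p\<le>N. (-1) ^ p * int (i p + j p))"
    using euler_char_eq_sum_atMost[of N X "{}"] z unfolding bX
    by (metis (no_types, lifting) add.right_neutral)
  moreover have "euler_char X S = (\<Sum>p\<le>N. (-1) ^ p * int (j p + b p))"
    using euler_char_eq_sum_atMost[of N X S] z unfolding bR
    by (metis (no_types, lifting) add.right_neutral)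
  ultimately show "euler_char X {} = euler_char (subtopology X S) {} + euler_char X S"
    by simp
qed

end


section \<open>Euler characteristics of contractible spaces, spheres and the empty space\<close>

lemma (in comm_group) rank_subgroup_generated:
  assumes "subgroup K G"
  shows "finite_rank (subgroup_generated G K) (carrier (subgroup_generated G K)) \<longleftrightarrow> finite_rank G K"
    and "finite_rank G K \<Longrightarrow>
      subgroup_rank (subgroup_generated G K) (carrier (subgroup_generated G K)) = subgroup_rank G K"
proof -
  have c: "carrier (subgroup_generated G K) = K"
    using assms by (simp add: subgroup.carrier_subgroup_generated_subgroup)
  interpret K: comm_group "subgroup_generated G K" by (simp add: abelian_subgroup_generated comm_group_axioms)
  have h: "group_hom (subgroup_generated G K) G id"
    using assms subgroup.subset
    by (fastforce simp: group_hom_def group_hom_axioms_def hom_def c K.is_group)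
  have "kernel (subgroup_generated G K) G id = {\<one>}"
    using subgroup.one_closed[OF assms] by (auto simp: kernel_def c)
  then show "finite_rank (subgroup_generated G K) (carrier (subgroup_generated G K)) \<longleftrightarrow> finite_rank G K"
    "finite_rank G K \<Longrightarrow>
      subgroup_rank (subgroup_generated G K) (carrier (subgroup_generated G K)) = subgroup_rank G K"
    using K.rank_nullity[OF h] K.rank_one by (auto simp: c)
qed

text \<open>Reduced homology is the kernel of the map to the homology of a point, taken as a group
  in its own right. The map is onto because a nonempty space retracts onto a point, so rank-nullity
  adds the rank of the homology of a point.\<close>

lemma betti_reduced:
  assumes "topspace X \<noteq> {}"
    and fin: "finite_rank (reduced_homology_group p X) (carrier (reduced_homology_group p X))"
  shows "finite_rank (homology_group p X) (carrier (homology_group p X))"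
    and "betti p X {} = subgroup_rank (reduced_homology_group p X) (carrier (reduced_homology_group p X))
           + (if p = 0 then 1 else 0)"
proof -
  let ?pt = "discrete_topology {()}"
  let ?f = "hom_induced p X {} ?pt {} (\<lambda>x. ())"
  let ?K = "kernel (homology_group p X) (homology_group p ?pt) ?f"
  interpret comm_group "homology_group p X" by simp
  have h: "group_hom (homology_group p X) (homology_group p ?pt) ?f"
    by (simp add: group_hom_def group_hom_axioms_def hom_induced_empty_hom)
  have K: "subgroup ?K (homology_group p X)"
    by (rule group_hom.subgroup_kernel[OF h])
  obtain a where "a \<in> topspace X" using assms(1) by blast
  then have "retraction_map X ?pt (\<lambda>x. ())"
    by (auto simp: retraction_map_def retraction_maps_def intro!: exI[of _ "\<lambda>_. a"])
  then have im: "?f ` carrier (homology_group p X) = carrier (homology_group p ?pt)"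
    using surj_hom_induced_retraction_map by blast
  have pt: "finite_rank (homology_group p ?pt) (carrier (homology_group p ?pt)) \<and>
      subgroup_rank (homology_group p ?pt) (carrier (homology_group p ?pt)) = (if p = 0 then 1 else 0)"
  proof (cases "p = 0")
    case True
    have "homology_group 0 ?pt \<cong> integer_group"
      by (rule homology_coefficients[of _ "()"]) simp
    then show ?thesis
      using rank_iso[of "homology_group 0 ?pt" integer_group] rank_integer_group True by simp
  next
    case False
    then have "trivial_group (homology_group p ?pt)"
      by (intro homology_dimension_axiom[of _ "()"]) auto
    then show ?thesis using rank_trivial_group False by auto
  qed
  have red: "reduced_homology_group p X = subgroup_generated (homology_group p X) ?K"
    by (simp add: reduced_homology_group_def)
  note r = rank_subgroup_generated[OF K]
  have fK: "finite_rank (homology_group p X) ?K" using fin r(1) by (simp add: red)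
  show *: "finite_rank (homology_group p X) (carrier (homology_group p X))"
    unfolding rank_nullity(1)[OF h] im using fK pt by blast
  show "betti p X {} = subgroup_rank (reduced_homology_group p X) (carrier (reduced_homology_group p X))
           + (if p = 0 then 1 else 0)"
    unfolding betti_def rank_nullity(2)[OF h *] im red r(2)[OF fK] using pt by simp
qed

lemma euler_char_contractible:
  assumes "contractible_space X" "topspace X \<noteq> {}"
  shows "finite_homology X {}" "euler_char X {} = 1"
proof -
  have t: "trivial_group (reduced_homology_group p X)" for p
    using assms trivial_reduced_homology_group_contractible_space by blast
  have b: "betti p X {} = (if p = 0 then 1 else 0)" for p
    using betti_reduced(2)[OF assms(2) rank_trivial_group(1)[OF t]] rank_trivial_group(2)[OF t, of p] by simp
  show "finite_homology X {}"
    using betti_reduced(1)[OF assms(2) rank_trivial_group(1)[OF t]] b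
    by (auto intro!: finite_homologyI[of _ _ 0])
  show "euler_char X {} = 1"
    by (subst euler_char_eq_sum_atMost[of 0]) (auto simp: b)
qed

lemma euler_char_nsphere:
  shows "finite_homology (nsphere n) {}" "euler_char (nsphere n) {} = 1 + (-1) ^ n"
proof -
  have ne: "topspace (nsphere n) \<noteq> {}" by simp
  have r: "finite_rank (reduced_homology_group p (nsphere n)) (carrier (reduced_homology_group p (nsphere n)))
      \<and> subgroup_rank (reduced_homology_group p (nsphere n)) (carrier (reduced_homology_group p (nsphere n)))
         = (if p = int n then 1 else 0)" for p
  proof (cases "p = int n")
    case True
    have "comm_group (reduced_homology_group p (nsphere n))"
      unfolding reduced_homology_group_def by (simp add: group.abelian_subgroup_generated)
    then show ?thesis
      using rank_iso[of "reduced_homology_group p (nsphere n)" integer_group] rank_integer_group True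
        reduced_homology_group_nsphere(1)[of n] by simp
  next
    case False
    then show ?thesis using rank_trivial_group[OF reduced_homology_group_nsphere(2)] by simp
  qed
  have b: "betti p (nsphere n) {} = (if p = int n then 1 else 0) + (if p = 0 then 1 else 0)" for p
    using betti_reduced(2)[OF ne] r[of p] by simp
  show "finite_homology (nsphere n) {}"
    using betti_reduced(1)[OF ne] r b by (auto intro!: finite_homologyI[of _ _ n])
  have "euler_char (nsphere n) {} = (\<Sum>p\<le>n. (-1) ^ p * int (betti (int p) (nsphere n) {}))"
    by (rule euler_char_eq_sum_atMost) (auto simp: b)
  also have "\<dots> = (\<Sum>p\<le>n. (if p = n then (-1) ^ p else 0) + (if p = 0 then 1 else 0))"
    by (rule sum.cong) (auto simp: b)
  also have "\<dots> = 1 + (-1) ^ n"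
    by (simp add: sum.distrib)
  finally show "euler_char (nsphere n) {} = 1 + (-1) ^ n" .
qed

lemma euler_char_empty:
  assumes "topspace X = {}"
  shows "finite_homology X {}" "euler_char X {} = 0"
proof -
  have t: "trivial_group (homology_group p X)" for p
    using assms trivial_homology_group_empty by blast
  have b: "betti p X {} = 0" for p
    using rank_trivial_group(2)[OF t] by (simp add: betti_def)
  show "finite_homology X {}"
    using rank_trivial_group(1)[OF t] b by (auto intro!: finite_homologyI[of _ _ 0])
  show "euler_char X {} = 0"
    by (subst euler_char_eq_sum_atMost[of 0]) (auto simp: b)
qed

subsection \<open>Polyhedra in barycentric coordinates\<close>

lemma homotopic_top_of_setI:
  fixes h :: "real \<Rightarrow> 'a::topological_space \<Rightarrow> 'b::topological_space"
  assumes "continuous_on ({0..1} \<times> A) (\<lambda>p. h (fst p) (snd p))"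
    and "\<And>u x. u \<in> {0..1} \<Longrightarrow> x \<in> A \<Longrightarrow> h u x \<in> B"
    and "\<And>x. x \<in> A \<Longrightarrow> h 0 x = f x" and "\<And>x. x \<in> A \<Longrightarrow> h 1 x = g x"
  shows "homotopic_with (\<lambda>x. True) (top_of_set A) (top_of_set B) f g"
proof -
  have "continuous_map (prod_topology (top_of_set {0..1}) (top_of_set A)) (top_of_set B)
      (\<lambda>p. h (fst p) (snd p))"
    using assms(1,2) by (auto simp: prod_topology_subtopology_eu)
  then show ?thesis
    using assms(3,4) by (subst homotopic_with) (auto intro!: exI[of _ "\<lambda>p. h (fst p) (snd p)"])
qed

lemma continuous_on_snd_coordinate [continuous_intros]:
  "continuous_on S (\<lambda>p::'c::topological_space \<times> ('a \<Rightarrow> real). snd p i)"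
  by (rule continuous_on_compose2[of UNIV "\<lambda>t. t i", OF continuous_on_product_coordinates])
    (auto intro: continuous_intros)

lemma contractible_space_starshaped:
  fixes A :: "('a \<Rightarrow> real) set"
  assumes "a \<in> A"
    and "\<And>u x. 0 \<le> u \<Longrightarrow> u \<le> 1 \<Longrightarrow> x \<in> A \<Longrightarrow> (\<lambda>i. (1 - u) * x i + u * a i) \<in> A"
  shows "contractible_space (top_of_set A)"
proof -
  have "homotopic_with (\<lambda>x. True) (top_of_set A) (top_of_set A) id (\<lambda>x. a)"
    by (rule homotopic_top_of_setI[where h = "\<lambda>u x i. (1 - u) * x i + u * a i"])
      (use assms in \<open>auto intro!: continuous_on_coordinatewise_then_product continuous_intros\<close>)
  then show ?thesis by (auto simp: contractible_space_def)
qed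

lemma continuous_on_Min:
  fixes f :: "'i \<Rightarrow> 'a::topological_space \<Rightarrow> real"
  assumes "finite I" "I \<noteq> {}" "\<And>i. i \<in> I \<Longrightarrow> continuous_on S (f i)"
  shows "continuous_on S (\<lambda>x. Min ((\<lambda>i. f i x) ` I))"
  using assms
proof (induction rule: finite_ne_induct)
  case (insert j I)
  have "continuous_on S (\<lambda>x. min (f j x) (Min ((\<lambda>i. f i x) ` I)))"
    using insert by (intro continuous_on_min) auto
  moreover have "Min ((\<lambda>i. f i x) ` insert j I) = min (f j x) (Min ((\<lambda>i. f i x) ` I))" for x
    using insert by simp
  ultimately show ?case by simp
qed auto

section \<open>Realizations of simplicial complexes and removal of a point\<close>

definition supp :: "('a \<Rightarrow> real) \<Rightarrow> 'a set" where
  "supp t = {x. t x \<noteq> 0}"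

text \<open>Complexes here are closed under all subsets, so they contain the empty simplex; it
  carries no point because the weights sum to 1.\<close>

definition polyhedron_of :: "'a set \<Rightarrow> 'a set set \<Rightarrow> ('a \<Rightarrow> real) set" where
  "polyhedron_of V K = {t. (\<forall>x. 0 \<le> t x) \<and> supp t \<in> K \<and> (\<Sum>x\<in>V. t x) = 1}"

definition complex_on :: "'a set \<Rightarrow> 'a set set \<Rightarrow> bool" where
  "complex_on V K \<longleftrightarrow> finite V \<and> K \<subseteq> Pow V \<and> (\<forall>s\<in>K. \<forall>t\<subseteq>s. t \<in> K)"

lemma polyhedron_supp_nonempty:
  assumes "t \<in> polyhedron_of V K"
  shows "supp t \<noteq> {}"
proof
  assume "supp t = {}"
  then have "t x = 0" for x by (auto simp: supp_def)
  then show False using assms by (simp add: polyhedron_of_def)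
qed

context
  fixes V :: "'a set" and K :: "'a set set" and q :: "'a \<Rightarrow> real"
  assumes K: "complex_on V K" and q: "q \<in> polyhedron_of V K"
begin

private lemma finV: "finite V" and downK: "s \<in> K \<Longrightarrow> t \<subseteq> s \<Longrightarrow> t \<in> K" and subV: "s \<in> K \<Longrightarrow> s \<subseteq> V"
  using K by (auto simp: complex_on_def)

private lemma supq: "supp q \<subseteq> V" "finite (supp q)" "supp q \<noteq> {}"
proof -
  show "supp q \<subseteq> V" using q subV by (auto simp: polyhedron_of_def)
  then show "finite (supp q)" using finV finite_subset by blast
  show "supp q \<noteq> {}" using q polyhedron_supp_nonempty by blast
qed

text \<open>For nonnegative \<open>t\<close>, the largest \<open>c\<close> with
  \<open>c * q \<le> t\<close> coordinatewise. It is 0 exactly when \<open>t\<close> vanishes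
  somewhere on \<open>supp q\<close>, that is, when \<open>t\<close> lies outside the open star of
  the carrier of \<open>q\<close>.\<close>

private definition ratio :: "('a \<Rightarrow> real) \<Rightarrow> real" where
  "ratio t = Min ((\<lambda>v. t v / q v) ` supp q)"

private lemma q_pos: "v \<in> supp q \<Longrightarrow> q v > 0" and q_nonneg: "0 \<le> q x"
  using q by (auto simp: polyhedron_of_def supp_def less_le)

private lemma ratio_nonneg: "(\<And>x. 0 \<le> t x) \<Longrightarrow> 0 \<le> ratio t"
  unfolding ratio_def using supq q_pos by (simp add: less_imp_le)

private lemma ratio_le: "(\<And>x. 0 \<le> t x) \<Longrightarrow> ratio t * q x \<le> t x"
proof (cases "x \<in> supp q")
  case True
  then have "ratio t \<le> t x / q x" unfolding ratio_def using supq by simp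
  then show ?thesis using q_pos[OF True] by (simp add: field_simps)
qed (auto simp: supp_def)

private lemma ratio_attained: "\<exists>v\<in>supp q. t v = ratio t * q v"
proof -
  have "ratio t \<in> (\<lambda>v. t v / q v) ` supp q"
    unfolding ratio_def using supq by (intro Min_in) auto
  then show ?thesis using q_pos by force
qed

text \<open>Otherwise \<open>t\<close> dominates \<open>q\<close> in every coordinate with the same
  total weight, hence equals it. This keeps the denominator of \<open>push\<close> positive away
  from \<open>q\<close>.\<close>

private lemma ratio_less_1:
  assumes t: "t \<in> polyhedron_of V K" "t \<noteq> q"
  shows "ratio t < 1"
proof (rule ccontr)
  assume "\<not> ratio t < 1"
  then have le: "q x \<le> t x" for x
    using ratio_le[of t x] t q_nonneg[of x] mult_right_mono[of 1 "ratio t" "q x"]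
    by (auto simp: polyhedron_of_def)
  have "(\<Sum>x\<in>V. t x - q x) = 0"
    using t q by (simp add: polyhedron_of_def sum_subtractf)
  then have "\<forall>x\<in>V. t x = q x"
    using le finV by (simp add: sum_nonneg_eq_0_iff)
  moreover have "t x = q x" if "x \<notin> V" for x
  proof -
    have "supp t \<subseteq> V" using t subV by (simp add: polyhedron_of_def)
    then have "x \<notin> supp t" "x \<notin> supp q" using that supq by auto
    then show ?thesis by (simp add: supp_def)
  qed
  ultimately show False using t(2) by blast
qed

text \<open>Remove the fraction \<open>u\<close> of the largest multiple of \<open>q\<close>
  contained in \<open>t\<close>, then rescale to total weight 1.\<close>

private definition push :: "real \<Rightarrow> ('a \<Rightarrow> real) \<Rightarrow> 'a \<Rightarrow> real" where
  "push u t x = (t x - u * ratio t * q x) / (1 - u * ratio t)"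

private lemma push_denom: "t \<in> polyhedron_of V K \<Longrightarrow> t \<noteq> q \<Longrightarrow> 0 \<le> u \<Longrightarrow> u \<le> 1 \<Longrightarrow> 0 < 1 - u * ratio t"
  using ratio_less_1[of t] mult_left_le_one_le[of "ratio t" u] ratio_nonneg[of t]
  by (auto simp: polyhedron_of_def mult.commute)

private lemma push_supp:
  assumes "t \<in> polyhedron_of V K" "t \<noteq> q" "0 \<le> u" "u \<le> 1"
  shows "0 \<le> push u t x" "supp (push u t) \<subseteq> supp t"
proof -
  have t: "0 \<le> t x" for x using assms by (simp add: polyhedron_of_def)
  have le: "u * ratio t * q x \<le> t x" for x
  proof -
    have "u * (ratio t * q x) \<le> ratio t * q x"
      using assms ratio_nonneg[OF t] q_nonneg[of x] by (intro mult_left_le_one_le) auto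
    then show ?thesis using ratio_le[of t x] t by simp
  qed
  show "0 \<le> push u t x" for x
    unfolding push_def using le push_denom[OF assms] by simp
  show "supp (push u t) \<subseteq> supp t"
  proof -
    have "t x - u * ratio t * q x = 0" if "t x = 0" for x
      using le[of x] that mult_nonneg_nonneg[OF mult_nonneg_nonneg[OF assms(3) ratio_nonneg[of t, OF t]] q_nonneg[of x]]
      by simp
    then show ?thesis by (auto simp: supp_def push_def)
  qed
qed

private lemma push_in:
  assumes "t \<in> polyhedron_of V K" "t \<noteq> q" "0 \<le> u" "u \<le> 1"
  shows "push u t \<in> polyhedron_of V K" "push u t \<noteq> q"
proof -
  note d = push_denom[OF assms]
  have "(\<Sum>x\<in>V. push u t x) = ((\<Sum>x\<in>V. t x) - u * ratio t * (\<Sum>x\<in>V. q x)) / (1 - u * ratio t)"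
    by (simp add: push_def sum_subtractf sum_distrib_left flip: sum_divide_distrib)
  also have "\<dots> = 1" using assms q d by (simp add: polyhedron_of_def)
  finally show "push u t \<in> polyhedron_of V K"
    using push_supp[OF assms] downK assms(1) by (auto simp: polyhedron_of_def)
  \<comment> \<open>The point moves along the line through \<open>q\<close> and \<open>t\<close>, so
    it could only meet \<open>q\<close> by starting there.\<close>
  show "push u t \<noteq> q"
  proof
    assume "push u t = q"
    then have "(t x - u * ratio t * q x) / (1 - u * ratio t) = q x" for x
      by (metis push_def)
    then have "t x = q x" for x
      using d by (simp add: divide_eq_eq algebra_simps)
    then show False using assms(2) by blast
  qed
qed

private abbreviation "L \<equiv> {s \<in> K. \<not> supp q \<subseteq> s}"

private lemma push_1: "t \<in> polyhedron_of V K \<Longrightarrow> t \<noteq> q \<Longrightarrow> push 1 t \<in> polyhedron_of V L"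
proof -
  assume t: "t \<in> polyhedron_of V K" "t \<noteq> q"
  obtain v where "v \<in> supp q" "t v = ratio t * q v" using ratio_attained by blast
  then have "v \<in> supp q" "v \<notin> supp (push 1 t)" by (auto simp: supp_def push_def)
  then show ?thesis using push_in[OF t, of 1] by (auto simp: polyhedron_of_def)
qed

private lemma push_id: "t \<in> polyhedron_of V L \<Longrightarrow> push u t = t"
proof -
  assume t: "t \<in> polyhedron_of V L"
  then obtain v where v: "v \<in> supp q" "t v = 0" by (auto simp: polyhedron_of_def supp_def)
  have "0 \<le> ratio t" using t by (intro ratio_nonneg) (auto simp: polyhedron_of_def)
  moreover have "ratio t \<le> 0"
    unfolding ratio_def using v supq by (intro Min_le) force+
  ultimately have "ratio t = 0" by simp
  then show ?thesis by (auto simp: push_def)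
qed

private lemma continuous_ratio: "continuous_on S (\<lambda>p::real \<times> ('a \<Rightarrow> real). ratio (snd p))"
  unfolding ratio_def using supq q_pos
  by (intro continuous_on_Min continuous_intros) (force simp: supp_def)+

text \<open>Points are pushed away from \<open>q\<close> until the first coordinate in \<open>supp q\<close> vanishes.\<close>

lemma polyhedron_minus_point_homotopy_equivalent:
  "top_of_set (polyhedron_of V K - {q}) homotopy_equivalent_space
   top_of_set (polyhedron_of V {s \<in> K. \<not> supp q \<subseteq> s})"
proof (rule deformation_retraction_imp_homotopy_equivalent_space)
  let ?X = "polyhedron_of V K - {q}"
  have sub: "polyhedron_of V L \<subseteq> ?X" by (auto simp: polyhedron_of_def)
  have c: "continuous_on ({0..1} \<times> ?X) (\<lambda>p. push (fst p) (snd p))"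
    unfolding push_def
    by (intro continuous_on_coordinatewise_then_product continuous_intros continuous_ratio)
      (use push_denom in force)
  show "homotopic_with (\<lambda>x. True) (top_of_set ?X) (top_of_set ?X) (id \<circ> push 1) id"
  \<comment> \<open>Pushing starts at the identity, whereas the retraction criterion asks for a
    homotopy that ends there.\<close>
  proof (subst homotopic_with_sym, rule homotopic_top_of_setI[OF c])
    show "push u x \<in> ?X" if "u \<in> {0..1}" "x \<in> ?X" for u x
      using push_in that by auto
  qed (auto simp: push_def)
  have "continuous_on ?X (push 1)"
    using continuous_on_compose2[OF c, of ?X "\<lambda>x. (1, x)"]
    by (force intro: continuous_on_Pair continuous_on_const continuous_on_id)
  then show "retraction_maps (top_of_set ?X) (top_of_set (polyhedron_of V L)) (push 1) id"
    unfolding retraction_maps_def using push_1 push_id sub by auto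
qed

text \<open>Excise the simplices that do not contain the carrier of \<open>q\<close>: they form a
  closed set, a finite union of zero sets of coordinates, inside the open complement of
  \<open>q\<close>. So the local pair at \<open>q\<close> sees only the open star of its
  carrier.\<close>

lemma excision_open_star:
  "relative_homology_group p (top_of_set {t \<in> polyhedron_of V K. supp q \<subseteq> supp t})
     ({t \<in> polyhedron_of V K. supp q \<subseteq> supp t} - {q})
   \<cong> relative_homology_group p (top_of_set (polyhedron_of V K)) (polyhedron_of V K - {q})"
proof -
  let ?X = "polyhedron_of V K"
  let ?U = "polyhedron_of V L"
  have U: "?U = (\<Union>v\<in>supp q. {t \<in> ?X. t v = 0})"
    by (auto simp: polyhedron_of_def supp_def)
  have "closedin (top_of_set ?X) ?U"
    unfolding U
  proof (rule closedin_Union)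
    fix S assume "S \<in> (\<lambda>v. {t \<in> ?X. t v = 0}) ` supp q"
    then obtain v where S: "S = {t \<in> ?X. t v = 0}" by blast
    have "continuous_on ?X (\<lambda>t. t v)"
      by (rule continuous_on_subset[OF continuous_on_product_coordinates]) simp
    then show "closedin (top_of_set ?X) S"
      unfolding S using continuous_closedin_preimage[of ?X "\<lambda>t. t v" "{0}"] by (simp add: vimage_def Int_def)
  qed (use supq in auto)
  then have "top_of_set ?X closure_of ?U = ?U" by (simp add: closure_of_eq)
  moreover have "openin (top_of_set ?X) (?X - {q})"
  proof -
    have "openin (top_of_set ?X) {t \<in> ?X. t v \<noteq> q v}" for v
    proof -
      have "continuous_on ?X (\<lambda>t. t v)"
        by (rule continuous_on_subset[OF continuous_on_product_coordinates]) simp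
      then show ?thesis
        using continuous_openin_preimage_gen[of ?X "\<lambda>t. t v" "- {q v}"]
        by (simp add: vimage_def Int_def open_Compl)
    qed
    moreover have "?X - {q} = (\<Union>v. {t \<in> ?X. t v \<noteq> q v})" by auto
    ultimately show ?thesis by auto
  qed
  then have "top_of_set ?X interior_of (?X - {q}) = ?X - {q}" by (simp add: interior_of_eq)
  moreover have "?U \<subseteq> ?X - {q}" by (auto simp: polyhedron_of_def)
  ultimately have iso: "hom_induced p (subtopology (top_of_set ?X) (?X - ?U)) (?X - {q} - ?U)
      (subtopology (top_of_set ?X) ?X) (?X - {q}) id
    \<in> iso (relative_homology_group p (subtopology (top_of_set ?X) (?X - ?U)) (?X - {q} - ?U))
        (relative_homology_group p (subtopology (top_of_set ?X) ?X) (?X - {q}))"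
    by (intro homology_excision_axiom) auto
  have e: "?X - ?U = {t \<in> ?X. supp q \<subseteq> supp t}"
    "?X - {q} - ?U = {t \<in> ?X. supp q \<subseteq> supp t} - {q}" by (auto simp: polyhedron_of_def)
  have e': "subtopology (top_of_set ?X) {t \<in> ?X. supp q \<subseteq> supp t} = top_of_set {t \<in> ?X. supp q \<subseteq> supp t}"
    "subtopology (top_of_set ?X) ?X = top_of_set ?X"
    by (simp_all add: subtopology_subtopology Int_absorb1)
  show ?thesis using is_isoI[OF iso] unfolding e e' .
qed

end

section \<open>Agreement of singular and simplicial Euler characteristics\<close>

definition simplicial_euler :: "'a set set \<Rightarrow> int" where
  "simplicial_euler K = (\<Sum>s\<in>K - {{}}. (-1) ^ (card s + 1))"

lemma simplicial_euler_remove: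
  assumes "finite K" "s \<in> K" "s \<noteq> {}"
  shows "simplicial_euler K = simplicial_euler (K - {s}) + (-1) ^ (card s + 1)"
proof -
  have "K - {{}} = insert s (K - {s} - {{}})" using assms by auto
  then show ?thesis using assms by (simp add: simplicial_euler_def)
qed

text \<open>Toggling one fixed vertex pairs the subsets of \<open>s\<close> with opposite signs, so
  all of them sum to 0; leaving out the empty one gives 1.\<close>

lemma simplicial_euler_Pow:
  assumes "finite s" "s \<noteq> {}"
  shows "simplicial_euler (Pow s) = 1"
proof -
  obtain a where a: "a \<in> s" using assms by blast
  define s' where "s' = s - {a}"
  have s: "s = insert a s'" "a \<notin> s'" "finite s'" using a assms by (auto simp: s'_def)
  have "(\<Sum>t\<in>Pow s. (-1::int) ^ (card t + 1))
      = (\<Sum>t\<in>Pow s'. (-1) ^ (card t + 1)) + (\<Sum>t\<in>insert a ` Pow s'. (-1) ^ (card t + 1))"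
    unfolding s(1) Pow_insert using s by (intro sum.union_disjoint) auto
  also have "(\<Sum>t\<in>insert a ` Pow s'. (-1::int) ^ (card t + 1)) = (\<Sum>t\<in>Pow s'. (-1) ^ (card (insert a t) + 1))"
    using s by (subst sum.reindex) (auto simp: inj_on_def)
  also have "\<dots> = (\<Sum>t\<in>Pow s'. - ((-1) ^ (card t + 1)))"
  proof (rule sum.cong)
    fix t assume "t \<in> Pow s'"
    then have "card (insert a t) = Suc (card t)"
      using s finite_subset[of t s'] by (subst card_insert_disjoint) auto
    then show "(-1::int) ^ (card (insert a t) + 1) = - ((-1) ^ (card t + 1))" by simp
  qed simp
  finally have "(\<Sum>t\<in>Pow s. (-1::int) ^ (card t + 1)) = 0" by (simp add: sum_negf)
  moreover have "(\<Sum>t\<in>Pow s. (-1::int) ^ (card t + 1)) = (-1) ^ (card {} + 1) + simplicial_euler (Pow s)"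
    unfolding simplicial_euler_def using assms by (subst sum.remove[of _ "{}"]) auto
  ultimately show ?thesis by simp
qed

lemma barycenter:
  assumes "finite V" "s \<subseteq> V" "s \<noteq> {}" "s \<in> K"
  obtains q where "q \<in> polyhedron_of V K" "supp q = s"
proof -
  define q where "q x = (if x \<in> s then 1 / real (card s) else 0)" for x
  have f: "finite s" "card s \<noteq> 0" using assms(1-3) finite_subset[of s V] by auto
  then have sq: "supp q = s" by (auto simp: supp_def q_def)
  have "(\<Sum>x\<in>V. q x) = (\<Sum>x\<in>s. 1 / real (card s))"
    unfolding q_def using assms by (simp add: sum.If_cases Int_absorb1)
  then have "(\<Sum>x\<in>V. q x) = 1" using f by simp
  then have "q \<in> polyhedron_of V K"
    using sq assms by (auto simp: polyhedron_of_def q_def)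
  then show thesis using sq that by blast
qed

lemma polyhedron_simplex_contractible:
  assumes "finite V" "s \<subseteq> V" "s \<noteq> {}"
  shows "contractible_space (top_of_set (polyhedron_of V (Pow s)))"
proof -
  obtain q where q: "q \<in> polyhedron_of V (Pow s)"
    using barycenter[OF assms, of "Pow s"] by blast
  show ?thesis
  proof (rule contractible_space_starshaped[OF q])
    fix u :: real and x assume u: "0 \<le> u" "u \<le> 1" and x: "x \<in> polyhedron_of V (Pow s)"
    have "(\<Sum>i\<in>V. (1 - u) * x i + u * q i) = (1 - u) * (\<Sum>i\<in>V. x i) + u * (\<Sum>i\<in>V. q i)"
      by (simp add: sum.distrib sum_distrib_left)
    also have "\<dots> = 1" using x q by (simp add: polyhedron_of_def)
    finally have "(\<Sum>i\<in>V. (1 - u) * x i + u * q i) = 1" .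
    moreover have "supp (\<lambda>i. (1 - u) * x i + u * q i) \<subseteq> supp x \<union> supp q"
      by (auto simp: supp_def)
    ultimately show "(\<lambda>i. (1 - u) * x i + u * q i) \<in> polyhedron_of V (Pow s)"
      using u x q unfolding polyhedron_of_def by (auto intro!: add_nonneg_nonneg)
  qed
qed

lemma complex_on_remove_maximal:
  assumes "complex_on V K" "\<And>t. t \<in> K \<Longrightarrow> s \<subseteq> t \<Longrightarrow> t = s"
  shows "complex_on V (K - {s})"
  unfolding complex_on_def
proof (intro conjI ballI allI impI)
  fix a b assume "a \<in> K - {s}" "b \<subseteq> a"
  then show "b \<in> K - {s}" using assms by (auto simp: complex_on_def)
qed (use assms in \<open>auto simp: complex_on_def\<close>)

text \<open>Induction on the number of simplices: puncture at the barycenter \<open>q\<close> of a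
  maximal simplex \<open>s\<close>. The punctured space is equivalent to the realization of
  \<open>K - {s}\<close>. By excision the local term at \<open>q\<close> is the one in
  \<open>Pow s\<close>, where it is a difference of two Euler characteristics known by induction.
  The sign \<open>(-1) ^ (card s + 1)\<close> is the parity of the dimension
  \<open>card s - 1\<close>.\<close>

theorem euler_char_polyhedron:
  assumes "complex_on V K"
  shows "finite_homology (top_of_set (polyhedron_of V K)) {} \<and>
    euler_char (top_of_set (polyhedron_of V K)) {} = simplicial_euler K"
  using assms
proof (induction "card K" arbitrary: K rule: less_induct)
  case less
  have V: "finite V" and KV: "K \<subseteq> Pow V" using less.prems by (auto simp: complex_on_def)
  then have finK: "finite K" using finite_subset by blast
  show ?case
  proof (cases "K \<subseteq> {{}}")
    case True
    have "t \<notin> polyhedron_of V K" for t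
    proof
      assume t: "t \<in> polyhedron_of V K"
      then have "supp t \<in> K" by (simp add: polyhedron_of_def)
      then show False using polyhedron_supp_nonempty[OF t] True by blast
    qed
    then have "polyhedron_of V K = {}" by blast
    moreover have "simplicial_euler K = 0"
      unfolding simplicial_euler_def using True by (intro sum.neutral) auto
    ultimately show ?thesis
      using euler_char_empty[of "top_of_set (polyhedron_of V K)"] by simp
  next
    case False
    then obtain a where a: "a \<in> K" "a \<noteq> {}" by blast
    obtain s where s: "s \<in> K" "a \<subseteq> s" and max: "\<And>t. t \<in> K \<Longrightarrow> s \<subseteq> t \<Longrightarrow> t = s"
      using finite_has_maximal2[OF finK a(1)] by blast
    have s0: "s \<noteq> {}" "s \<subseteq> V" "finite s" using a s KV V finite_subset[of s V] by auto
    have PsK: "Pow s \<subseteq> K" using less.prems s by (auto simp: complex_on_def)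
    obtain q where q: "q \<in> polyhedron_of V (Pow s)" "supp q = s"
      using barycenter[OF V s0(2,1), of "Pow s"] by blast
    then have qK: "q \<in> polyhedron_of V K" using s by (auto simp: polyhedron_of_def)
    show ?thesis
    \<comment> \<open>When \<open>K\<close> is a single closed simplex, the induction hypothesis
      cannot be applied to \<open>Pow s\<close>; contractibility supplies the value.\<close>
    proof (cases "K = Pow s")
      case True
      then show ?thesis
        using euler_char_contractible[OF polyhedron_simplex_contractible[OF V s0(2,1)]] q
          simplicial_euler_Pow[OF s0(3,1)] by auto
    next
      case False
      have cP: "complex_on V (Pow s)" using V s0 by (auto simp: complex_on_def)
      have IH: "finite_homology (top_of_set (polyhedron_of V K')) {} \<and>
          euler_char (top_of_set (polyhedron_of V K')) {} = simplicial_euler K'"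
        if "complex_on V K'" "K' \<subset> K" for K'
        using less.hyps[OF psubset_card_mono[OF finK that(2)] that(1)] .
      \<comment> \<open>Formulated for \<open>K'\<close> so as to serve both \<open>K\<close> and
        \<open>Pow s\<close>. By maximality, puncturing at \<open>q\<close> costs just the simplex
        \<open>s\<close>.\<close>
      have local: "finite_homology (top_of_set (polyhedron_of V K' - {q})) {} \<and>
          euler_char (top_of_set (polyhedron_of V K' - {q})) {} = simplicial_euler (K' - {s})"
        if K': "complex_on V K'" "K' \<subseteq> K" "s \<in> K'" for K'
      proof -
        have qK': "q \<in> polyhedron_of V K'" using q K' by (auto simp: polyhedron_of_def)
        have "{t \<in> K'. \<not> supp q \<subseteq> t} = K' - {s}" using q max K' by auto
        then have he: "top_of_set (polyhedron_of V K' - {q}) homotopy_equivalent_space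
            top_of_set (polyhedron_of V (K' - {s}))"
          using polyhedron_minus_point_homotopy_equivalent[OF K'(1) qK'] by simp
        have "complex_on V (K' - {s})"
          using complex_on_remove_maximal[OF K'(1)] max K'(2) by blast
        then have "finite_homology (top_of_set (polyhedron_of V (K' - {s}))) {} \<and>
            euler_char (top_of_set (polyhedron_of V (K' - {s}))) {} = simplicial_euler (K' - {s})"
          using IH[of "K' - {s}"] K'(2,3) by blast
        then show ?thesis
          using finite_homology_homotopy_equivalent[OF he] by auto
      qed
      let ?P = "polyhedron_of V (Pow s)" and ?X = "polyhedron_of V K"
      have subt: "subtopology (top_of_set A) (A - {q}) = top_of_set (A - {q})" for A
        by (simp add: subtopology_subtopology Int_absorb1 Diff_subset)
      have P: "finite_homology (top_of_set ?P) {} \<and> euler_char (top_of_set ?P) {} = simplicial_euler (Pow s)"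
        using IH[OF cP] PsK False by blast
      note lP = local[OF cP PsK] and lK = local[OF less.prems order_refl s(1)]
      have pair: "finite_homology (top_of_set ?P) (?P - {q})"
          "euler_char (top_of_set ?P) (?P - {q}) = (-1) ^ (card s + 1)"
        using euler_char_pair[of "top_of_set ?P" "?P - {q}"] P lP simplicial_euler_remove[of "Pow s" s] s0
        by (auto simp: subt)
      \<comment> \<open>A carrier containing the maximal simplex \<open>s\<close> equals
        \<open>s\<close>, so the open stars in \<open>K\<close> and in \<open>Pow s\<close> coincide
        and excision links the two local pairs.\<close>
      have star: "{t \<in> ?X. supp q \<subseteq> supp t} = {t \<in> ?P. supp q \<subseteq> supp t}"
        using q max PsK by (auto simp: polyhedron_of_def)
      have iso: "relative_homology_group p (top_of_set ?P) (?P - {q}) \<cong>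
          relative_homology_group p (top_of_set ?X) (?X - {q})" for p
        using excision_open_star[OF cP q(1), of p] excision_open_star[OF less.prems qK, of p]
        unfolding star by (meson iso_trans group.iso_sym[OF group_relative_homology_group])
      have X: "finite_homology (top_of_set ?X) (?X - {q})"
          "euler_char (top_of_set ?X) (?X - {q}) = (-1) ^ (card s + 1)"
        using finite_homology_iso[OF iso] pair by auto
      show ?thesis
        using euler_char_pair[of "top_of_set ?X" "?X - {q}"] X lK simplicial_euler_remove[OF finK s(1) s0(1)]
        by (simp add: subt)
    qed
  qed
qed

subsection \<open>Local Euler characteristic of the ball\<close>

definition ball_set :: "nat \<Rightarrow> (nat \<Rightarrow> real) set" where
  "ball_set n = {x. (\<forall>i\<ge>n. x i = 0) \<and> (\<Sum>i<n. (x i)\<^sup>2) \<le> 1}"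

lemma unit_ball_eq: "unit_ball n = top_of_set (ball_set n)"
  unfolding unit_ball_def Euclidean_space_def ball_set_def
  by (simp add: subtopology_subtopology euclidean_product_topology Collect_conj_eq)

lemma sum_squares_L2: "(\<Sum>i<n. (x i)\<^sup>2) = (L2_set x {..<n})\<^sup>2"
  by (simp add: L2_set_def sum_nonneg)

lemma ball_set_L2: "ball_set n = {x. (\<forall>i\<ge>n. x i = 0) \<and> L2_set x {..<n} \<le> 1}"
  unfolding ball_set_def sum_squares_L2 by (simp add: abs_square_le_1 L2_set_nonneg)

lemma ball_set_combine:
  assumes "x \<in> ball_set n" "y \<in> ball_set n" "0 \<le> u" "u \<le> 1"
  shows "(\<lambda>i. (1 - u) * x i + u * y i) \<in> ball_set n"
proof -
  have "L2_set (\<lambda>i. (1 - u) * x i + u * y i) {..<n}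
      \<le> L2_set (\<lambda>i. (1 - u) * x i) {..<n} + L2_set (\<lambda>i. u * y i) {..<n}"
    by (rule L2_set_triangle_ineq)
  also have "\<dots> = (1 - u) * L2_set x {..<n} + u * L2_set y {..<n}"
    using assms by (simp add: L2_set_right_distrib)
  also have "\<dots> \<le> (1 - u) * 1 + u * 1"
    using assms by (intro add_mono mult_left_mono) (auto simp: ball_set_L2)
  finally show ?thesis using assms by (auto simp: ball_set_L2)
qed

lemma zero_in_ball_set: "(\<lambda>i. 0) \<in> ball_set n"
  by (simp add: ball_set_def)

lemma contractible_unit_ball: "contractible_space (unit_ball n)"
  unfolding unit_ball_eq
  by (rule contractible_space_starshaped[OF zero_in_ball_set]) (rule ball_set_combine[OF _ zero_in_ball_set])

text \<open>The punctured ball is starshaped about the centre: the point \<open>(1 - u) x\<close>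
  can have norm 1 only for \<open>u = 0\<close>, so no segment towards the centre runs through
  \<open>p\<close>.\<close>

lemma contractible_ball_minus_boundary_point:
  assumes p: "p \<in> ball_set n" "(\<Sum>i<n. (p i)\<^sup>2) = 1"
  shows "contractible_space (top_of_set (ball_set n - {p}))" "(\<lambda>i. 0) \<in> ball_set n - {p}"
proof -
  show 0: "(\<lambda>i. 0) \<in> ball_set n - {p}"
    using p zero_in_ball_set by auto
  show "contractible_space (top_of_set (ball_set n - {p}))"
  proof (rule contractible_space_starshaped[OF 0])
    fix u :: real and x assume u: "0 \<le> u" "u \<le> 1" and x: "x \<in> ball_set n - {p}"
    have "(\<lambda>i. (1 - u) * x i + u * 0) \<noteq> p"
    proof
      assume eq: "(\<lambda>i. (1 - u) * x i + u * 0) = p"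
      then have "(\<Sum>i<n. ((1 - u) * x i)\<^sup>2) = 1" using p by force
      then have "(1 - u)\<^sup>2 * (\<Sum>i<n. (x i)\<^sup>2) = 1" by (simp add: power_mult_distrib sum_distrib_left)
      moreover have "(1 - u)\<^sup>2 * (\<Sum>i<n. (x i)\<^sup>2) \<le> (1 - u)\<^sup>2 * 1"
        using x by (intro mult_left_mono) (auto simp: ball_set_def)
      ultimately have "1 \<le> 1 - u" using u abs_le_square_iff[of 1 "1 - u"] by simp
      then have "u = 0" using u by simp
      then show False using eq x by auto
    qed
    then show "(\<lambda>i. (1 - u) * x i + u * 0) \<in> ball_set n - {p}"
      using ball_set_combine[OF _ zero_in_ball_set, of x n u] x u by auto
  qed
qed

lemma L2_set_scale: "L2_set (\<lambda>i. c * f i) A = \<bar>c\<bar> * L2_set f A"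
proof -
  have "L2_set (\<lambda>i. c * f i) A = L2_set (\<lambda>i. \<bar>c\<bar> * f i) A"
    by (simp add: L2_set_def power_mult_distrib)
  then show ?thesis by (simp add: L2_set_right_distrib)
qed

lemma nsphere_eq_L2: "nsphere m = top_of_set {x. (\<forall>i\<ge>Suc m. x i = 0) \<and> L2_set x {..<Suc m} = 1}"
proof -
  have "(\<Sum>i\<le>m. (x i)\<^sup>2) = 1 \<longleftrightarrow> L2_set x {..<Suc m} = 1" for x
    unfolding lessThan_Suc_atMost L2_set_def by simp
  then have "{x. (\<Sum>i\<le>m. (x i)\<^sup>2) = 1 \<and> (\<forall>i>m. x i = 0)}
      = {x. (\<forall>i\<ge>Suc m. x i = 0) \<and> L2_set x {..<Suc m} = 1}"
    by (auto simp: Suc_le_eq)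
  then show ?thesis by (simp add: nsphere euclidean_product_topology)
qed

text \<open>
  The sphere is included as a small sphere centred at \<open>p\<close>, onto which the ball is projected
  radially.
\<close>

lemma ball_minus_interior_point_homotopy_equivalent:
  assumes p: "p \<in> ball_set (Suc m)" "(\<Sum>i<Suc m. (p i)\<^sup>2) < 1"
  shows "top_of_set (ball_set (Suc m) - {p}) homotopy_equivalent_space nsphere m"
proof -
  let ?n = "Suc m"
  let ?N = "\<lambda>x. L2_set x {..<?n}"
  let ?X = "ball_set ?n - {p}" and ?S = "{x. (\<forall>i\<ge>?n. x i = 0) \<and> ?N x = 1}"
  \<comment> \<open>The distance from \<open>p\<close> to the unit sphere; by the triangle
    inequality the sphere of this radius about \<open>p\<close> stays in the ball.\<close>
  define r where "r = 1 - ?N p"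
  have r: "0 < r"
    using p(2) unfolding sum_squares_L2 r_def by (simp add: abs_square_less_1 L2_set_nonneg)
  define D where "D x = ?N (\<lambda>i. x i - p i)" for x
  define f where "f x i = (x i - p i) / D x" for x i
  define g where "g u i = p i + r * u i" for u i
  have p0: "p i = 0" if "i \<ge> ?n" for i using p that by (auto simp: ball_set_def)
  have D: "D x > 0" if "x \<in> ?X" for x
  proof -
    have "\<exists>i. x i \<noteq> p i" using that by auto
    then obtain i where i: "x i \<noteq> p i" by blast
    then have "i < ?n" using that p0 by (force simp: ball_set_def not_le[symmetric])
    then have "D x \<noteq> 0" unfolding D_def using i by (subst L2_set_eq_0_iff) auto
    then show ?thesis unfolding D_def using L2_set_nonneg[of "\<lambda>i. x i - p i" "{..<?n}"] by linarith
  qed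
  have contD: "continuous_on T D" for T
    unfolding D_def L2_set_def
    by (intro continuous_intros continuous_on_subset[OF continuous_on_product_coordinates] subset_UNIV)
  have contD2: "continuous_on T (\<lambda>p. D (snd p))" for T :: "(real \<times> (nat \<Rightarrow> real)) set"
    unfolding D_def L2_set_def by (intro continuous_intros)
  have fS: "f x \<in> ?S" if "x \<in> ?X" for x
  proof -
    have "?N (f x) = ?N (\<lambda>i. (1 / D x) * (x i - p i))" by (simp add: f_def[abs_def])
    also have "\<dots> = 1" using D[OF that] by (subst L2_set_scale) (simp add: D_def)
    finally show ?thesis using that p0 by (auto simp: f_def ball_set_def)
  qed
  have gX: "g u \<in> ?X" if "u \<in> ?S" for u
  proof -
    have "?N (g u) \<le> ?N p + ?N (\<lambda>i. r * u i)" unfolding g_def by (rule L2_set_triangle_ineq)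
    also have "\<dots> = 1" using that r by (subst L2_set_scale) (simp add: r_def)
    finally have "g u \<in> ball_set ?n" using that p0 by (auto simp: ball_set_L2 g_def)
    moreover have "g u \<noteq> p"
    proof
      assume "g u = p"
      then have "p i + r * u i = p i" for i by (metis g_def)
      then have "u i = 0" for i using r by simp
      then have "?N u = 0" by (simp add: L2_set_def)
      then show False using that by simp
    qed
    ultimately show ?thesis by simp
  qed
  have fg: "f (g u) = u" if "u \<in> ?S" for u
  proof -
    have "D (g u) = r" using that r unfolding D_def g_def by (simp add: L2_set_scale)
    then show ?thesis using r by (auto simp: f_def g_def)
  qed
  have cf: "continuous_map (top_of_set ?X) (top_of_set ?S) f"
  proof -
    have "continuous_on ?X f" unfolding f_def
      by (intro continuous_on_coordinatewise_then_product continuous_intros contD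
          continuous_on_subset[OF continuous_on_product_coordinates] subset_UNIV) (use D in force)
    then show ?thesis using fS by auto
  qed
  have cg: "continuous_map (top_of_set ?S) (top_of_set ?X) g"
  proof -
    have "continuous_on ?S g" unfolding g_def
      by (intro continuous_on_coordinatewise_then_product continuous_intros
          continuous_on_subset[OF continuous_on_product_coordinates] subset_UNIV)
    then show ?thesis using gX by auto
  qed
  have "homotopic_with (\<lambda>x. True) (top_of_set ?X) (top_of_set ?X) (g \<circ> f) id"
  proof (rule homotopic_top_of_setI[where h = "\<lambda>u x i. (1 - u) * (p i + r * ((x i - p i) / D x)) + u * x i"])
    show "continuous_on ({0..1} \<times> ?X)
        (\<lambda>z i. (1 - fst z) * (p i + r * ((snd z i - p i) / D (snd z))) + fst z * snd z i)"
      by (intro continuous_on_coordinatewise_then_product continuous_intros contD2) (use D in force)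
    fix u :: real and x assume u: "u \<in> {0..1}" and x: "x \<in> ?X"
    have "(\<lambda>i. (1 - u) * g (f x) i + u * x i) \<in> ball_set ?n"
      using gX[OF fS[OF x]] x u by (intro ball_set_combine) auto
    moreover have "(\<lambda>i. (1 - u) * g (f x) i + u * x i) \<noteq> p"
    proof
      assume eq: "(\<lambda>i. (1 - u) * g (f x) i + u * x i) = p"
      \<comment> \<open>A point between the projection and \<open>x\<close> is \<open>p\<close> plus
        a positive multiple of \<open>x - p\<close>, so it differs from \<open>p\<close>.\<close>
      have "((1 - u) * (r / D x) + u) * (x i - p i) = 0" for i
        using fun_cong[OF eq, of i] D[OF x] by (simp add: g_def f_def field_simps)
      moreover have "(1 - u) * (r / D x) + u > 0"
        using u r D[OF x] by (cases "u = 0") (auto intro: add_nonneg_pos)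
      ultimately have "x i = p i" for i by (metis eq_iff_diff_eq_0 less_irrefl mult_eq_0_iff)
      then show False using x by auto
    qed
    ultimately show "(\<lambda>i. (1 - u) * (p i + r * ((x i - p i) / D x)) + u * x i) \<in> ?X"
      by (simp add: g_def f_def)
  qed (auto simp: g_def f_def)
  moreover have "homotopic_with (\<lambda>x. True) (top_of_set ?S) (top_of_set ?S) (f \<circ> g) id"
    by (rule homotopic_with_equal) (use continuous_map_compose[OF cg cf] fg in simp_all)
  ultimately show ?thesis
    unfolding homotopy_equivalent_space_def nsphere_eq_L2 using cf cg by blast
qed

text \<open>A boundary point leaves a contractible space, giving 1 - 1. An interior point leaves a
  sphere of dimension one less, giving \<open>1 - (1 + (-1) ^ m)\<close> with
  \<open>n = Suc m\<close>.\<close>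

lemma euler_char_ball_minus_point:
  assumes "p \<in> ball_set n"
  shows "finite_homology (top_of_set (ball_set n - {p})) {}"
    "1 - euler_char (top_of_set (ball_set n - {p})) {} = (if (\<Sum>i<n. (p i)\<^sup>2) = 1 then 0 else (-1) ^ n)"
proof -
  let ?X = "top_of_set (ball_set n - {p})"
  have "finite_homology ?X {} \<and> 1 - euler_char ?X {} = (if (\<Sum>i<n. (p i)\<^sup>2) = 1 then 0 else (-1) ^ n)"
  proof (cases "(\<Sum>i<n. (p i)\<^sup>2) = 1")
    case True
    have "topspace ?X \<noteq> {}"
      using contractible_ball_minus_boundary_point(2)[OF assms True] by auto
    then show ?thesis
      using euler_char_contractible[OF contractible_ball_minus_boundary_point(1)[OF assms True]] True by simp
  next
    case False
    then have lt: "(\<Sum>i<n. (p i)\<^sup>2) < 1" using assms by (auto simp: ball_set_def)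
    show ?thesis
    proof (cases n)
      \<comment> \<open>The punctured 0-ball is empty, with Euler characteristic 0: it stands in for
        a sphere of dimension -1.\<close>
      case 0
      then have "ball_set n = {p}" using assms by (auto simp: ball_set_def)
      then have "topspace ?X = {}" by simp
      then show ?thesis using euler_char_empty[of ?X] 0 by simp
    next
      case (Suc m)
      have "?X homotopy_equivalent_space nsphere m"
        using ball_minus_interior_point_homotopy_equivalent[of p m] assms lt Suc by simp
      then show ?thesis
        using finite_homology_homotopy_equivalent[of ?X "nsphere m"] euler_char_nsphere[of m] False Suc by auto
    qed
  qed
  then show "finite_homology ?X {}"
    "1 - euler_char ?X {} = (if (\<Sum>i<n. (p i)\<^sup>2) = 1 then 0 else (-1) ^ n)" by auto
qed

text \<open>Valid for every homeomorphism \<open>f\<close>, while the left side does not mention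
  \<open>f\<close>: whether a point lands on the unit sphere is independent of the choice.\<close>

lemma local_euler_char_ball:
  assumes f: "homeomorphic_map X (unit_ball n) f" and q: "q \<in> topspace X"
  shows "euler_char X {} - euler_char (subtopology X (topspace X - {q})) {}
    = (if (\<Sum>i<n. (f q i)\<^sup>2) = 1 then 0 else (-1) ^ n)"
proof -
  have bij: "inj_on f (topspace X)" "f ` topspace X = ball_set n"
    using f by (auto simp: homeomorphic_imp_injective_map homeomorphic_imp_surjective_map unit_ball_eq)
  have X: "X homeomorphic_space unit_ball n"
    using f homeomorphic_map_imp_homeomorphic_space by blast
  have "euler_char X {} = 1"
    using euler_char_contractible[OF contractible_unit_ball] zero_in_ball_set
      finite_homology_homotopy_equivalent[OF homeomorphic_imp_homotopy_equivalent_space[OF X]]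
    by (metis empty_iff topspace_euclidean_subtopology unit_ball_eq)
  moreover have "subtopology X (topspace X - {q}) homeomorphic_space top_of_set (ball_set n - {f q})"
  proof -
    have "homeomorphic_map (subtopology X (topspace X - {q})) (subtopology (unit_ball n) (ball_set n - {f q})) f"
      by (rule homeomorphic_map_subtopologies[OF f])
        (use bij q in \<open>auto simp: unit_ball_eq inj_on_def\<close>)
    then show ?thesis
      using homeomorphic_map_imp_homeomorphic_space
      by (fastforce simp: unit_ball_eq subtopology_subtopology Int_absorb1 Diff_subset)
  qed
  then have "euler_char (subtopology X (topspace X - {q})) {} = euler_char (top_of_set (ball_set n - {f q})) {}"
    using finite_homology_homotopy_equivalent homeomorphic_imp_homotopy_equivalent_space
      euler_char_ball_minus_point(1)[of "f q" n] bij q by blast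
  ultimately show ?thesis
    using euler_char_ball_minus_point(2)[of "f q" n] bij(2) q by (metis imageI)
qed

subsection \<open>Faces of the cube as sign vectors\<close>

abbreviation coord :: "(nat \<Rightarrow>\<^sub>0 real) \<Rightarrow> nat \<Rightarrow> real" where
  "coord \<equiv> Poly_Mapping.lookup"

lemma coord_scaleR [simp]: "coord (r *\<^sub>R x) i = r * coord x i"
proof -
  have "finite {i. r * coord x i \<noteq> 0}"
    by (rule finite_subset[OF _ finite_lookup[of x]]) auto
  then show ?thesis by (simp add: scaleR_poly_mapping_def Abs_poly_mapping_inverse)
qed

text \<open>
  \<open>None\<close> marks a free coordinate, \<open>Some b\<close> a coordinate fixed to \<open>0\<close> or \<open>1\<close>; the dimension of a face
  is recovered from its number \<open>3 ^ k\<close> of nonempty faces.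
\<close>

definition signs :: "nat \<Rightarrow> (nat \<Rightarrow> bool option) set" where
  "signs d = PiE {..<d} (\<lambda>_. UNIV)"

definition sign_face :: "nat \<Rightarrow> (nat \<Rightarrow> bool option) \<Rightarrow> (nat \<Rightarrow>\<^sub>0 real) set" where
  "sign_face d g = {x \<in> unit_cube d. \<forall>i<d. \<forall>b. g i = Some b \<longrightarrow> coord x i = of_bool b}"

definition sign_le :: "nat \<Rightarrow> (nat \<Rightarrow> bool option) \<Rightarrow> (nat \<Rightarrow> bool option) \<Rightarrow> bool" where
  "sign_le d g h \<longleftrightarrow> (\<forall>i<d. h i = None \<or> h i = g i)"

lemma unit_cube_segment:
  assumes "a \<in> unit_cube d" "b \<in> unit_cube d" "0 \<le> u" "u \<le> 1"
  shows "(1 - u) *\<^sub>R a + u *\<^sub>R b \<in> unit_cube d"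
proof -
  have "0 \<le> (1 - u) * coord a i + u * coord b i \<and> (1 - u) * coord a i + u * coord b i \<le> 1" if "i < d" for i
    using assms that convex_bound_le[of "coord a i" 1 "coord b i" "1 - u" u]
    by (auto simp: unit_cube_def)
  then show ?thesis using assms by (auto simp: unit_cube_def lookup_add)
qed

text \<open>An average with positive weights of two numbers in the unit interval is 0 or 1 only if
  both numbers are.\<close>

lemma sign_face_face_of: "sign_face d g face_of unit_cube d"
  unfolding face_of_def
proof (intro conjI ballI impI)
  show "sign_face d g \<subseteq> unit_cube d" by (auto simp: sign_face_def)
  show "convex (sign_face d g)"
    unfolding convex_alt
  proof (intro ballI allI impI)
    fix x y and u :: real assume "x \<in> sign_face d g" "y \<in> sign_face d g" "0 \<le> u \<and> u \<le> 1"
    then show "(1 - u) *\<^sub>R x + u *\<^sub>R y \<in> sign_face d g"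
      using unit_cube_segment[of x d y u]
      by (auto simp: sign_face_def lookup_add simp flip: distrib_right)
  qed
  fix a b x assume a: "a \<in> unit_cube d" and b: "b \<in> unit_cube d" and x: "x \<in> sign_face d g"
    and seg: "x \<in> open_segment a b"
  obtain u where u: "0 < u" "u < 1" "x = (1 - u) *\<^sub>R a + u *\<^sub>R b"
    using seg by (auto simp: in_segment)
  have "coord a i = of_bool c \<and> coord b i = of_bool c" if "i < d" "g i = Some c" for i c
  proof -
    have ab: "0 \<le> coord a i" "coord a i \<le> 1" "0 \<le> coord b i" "coord b i \<le> 1"
      using a b that by (auto simp: unit_cube_def)
    have eq: "(1 - u) * coord a i + u * coord b i = of_bool c"
      using x that u by (auto simp: sign_face_def lookup_add)
    show ?thesis
    proof (cases c)
      case False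
      then have "(1 - u) * coord a i = 0 \<and> u * coord b i = 0"
        using eq ab u by (simp add: add_nonneg_eq_0_iff)
      then show ?thesis using u False by simp
    next
      case True
      then have "(1 - u) * (1 - coord a i) + u * (1 - coord b i) = 0"
        using eq by (simp add: algebra_simps)
      then have "(1 - u) * (1 - coord a i) = 0 \<and> u * (1 - coord b i) = 0"
        using ab u by (simp add: add_nonneg_eq_0_iff)
      then show ?thesis using u True by simp
    qed
  qed
  then show "a \<in> sign_face d g" "b \<in> sign_face d g" using a b by (auto simp: sign_face_def)
qed

lemma sign_face_nonempty: "sign_face d g \<noteq> {}"
proof -
  let ?v = "\<lambda>i. if i < d \<and> g i = Some True then 1 else (0::real)"
  have "finite {i. ?v i \<noteq> 0}" by (rule finite_subset[of _ "{..<d}"]) auto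
  then have "coord (Abs_poly_mapping ?v) = ?v" by (rule Abs_poly_mapping_inverse[OF CollectI])
  then have "Abs_poly_mapping ?v \<in> sign_face d g"
    by (auto simp: sign_face_def unit_cube_def split: if_splits)
  then show ?thesis by blast
qed

lemma sign_face_subset_iff: "sign_face d g \<subseteq> sign_face d h \<longleftrightarrow> sign_le d g h"
proof
  assume "sign_le d g h"
  then have "g i = Some b" if "i < d" "h i = Some b" for i b
    using that unfolding sign_le_def by (metis option.distinct(1))
  then show "sign_face d g \<subseteq> sign_face d h" by (auto simp: sign_face_def)
next
  assume sub: "sign_face d g \<subseteq> sign_face d h"
  show "sign_le d g h"
    unfolding sign_le_def
  proof (intro allI impI)
    fix i assume i: "i < d"
    have val: "coord x i = of_bool b" if "h i = Some b" "x \<in> sign_face d g" for x b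
      using sub that i by (auto simp: sign_face_def)
    \<comment> \<open>Two vertices of the smaller face, with its free coordinates all 0 or all 1.
      They differ wherever \<open>g\<close> is free, so a coordinate fixed by \<open>h\<close> must
      be fixed by \<open>g\<close>, to the same value.\<close>
    define w where "w c j = (if j < d then (case g j of None \<Rightarrow> c | Some b \<Rightarrow> of_bool b) else (0::real))" for c j
    have fin: "finite {j. w c j \<noteq> 0}" for c
      by (rule finite_subset[of _ "{..<d}"]) (auto simp: w_def split: if_splits)
    have cw: "coord (Abs_poly_mapping (w c)) = w c" for c
      using fin[of c] by (intro Abs_poly_mapping_inverse) simp
    have mem: "Abs_poly_mapping (w c) \<in> sign_face d g" if "c \<in> {0, 1}" for c
      using that by (auto simp: sign_face_def unit_cube_def cw) (auto simp: w_def split: option.splits)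
    show "h i = None \<or> h i = g i"
    proof (cases "h i")
      case (Some b)
      have "w 0 i = of_bool b" "w 1 i = of_bool b"
        using val[OF Some mem] cw by auto
      then show ?thesis using Some i by (auto simp: w_def split: option.splits)
    qed simp
  qed
qed

lemma sign_le_antisym: "g \<in> signs d \<Longrightarrow> h \<in> signs d \<Longrightarrow> sign_le d g h \<Longrightarrow> sign_le d h g \<Longrightarrow> g = h"
  unfolding signs_def sign_le_def by (rule PiE_ext) (assumption, assumption, metis lessThan_iff)

text \<open>Fix the coordinates that are constantly 0 or constantly 1 on \<open>F\<close>. Averaging
  yields a point \<open>z\<close> of \<open>F\<close> strictly inside in all other coordinates. Each
  other \<open>y\<close> in the sign face is then an endpoint of a segment of the cube with
  \<open>z\<close> in its interior, and the face property puts \<open>y\<close> in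
  \<open>F\<close>.\<close>

lemma face_of_unit_cubeD:
  assumes F: "F face_of unit_cube d" and ne: "F \<noteq> {}"
  shows "\<exists>g\<in>signs d. F = sign_face d g"
proof -
  have FC: "F \<subseteq> unit_cube d" and conv: "convex F" using F by (auto simp: face_of_def)
  define g where "g = (\<lambda>i\<in>{..<d}. if \<forall>x\<in>F. coord x i = 0 then Some False
      else if \<forall>x\<in>F. coord x i = 1 then Some True else None)"
  have g: "g \<in> signs d" by (simp add: g_def signs_def)
  have cube: "0 \<le> coord x i" "coord x i \<le> 1" if "x \<in> unit_cube d" "i < d" for x i
    using that by (auto simp: unit_cube_def)
  have sub: "F \<subseteq> sign_face d g"
    using FC by (auto simp: sign_face_def g_def split: if_splits)
  have mid: "(1/2) *\<^sub>R x + (1/2) *\<^sub>R y \<in> F" if "x \<in> F" "y \<in> F" for x y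
    using convexD[OF conv that, of "1/2" "1/2"] by simp
  have "\<exists>z\<in>F. \<forall>i\<in>I. 0 < coord z i \<and> coord z i < 1" if "finite I" "I \<subseteq> {i. i < d \<and> g i = None}" for I
    using that
  proof (induction I rule: finite_induct)
    case empty
    then show ?case using ne by auto
  next
    case (insert i I)
    then obtain z where z: "z \<in> F" "\<forall>j\<in>I. 0 < coord z j \<and> coord z j < 1" by auto
    have i: "i < d" "g i = None" using insert by auto
    then obtain x y where xy: "x \<in> F" "y \<in> F" "coord x i \<noteq> 0" "coord y i \<noteq> 1"
      by (auto simp: g_def split: if_splits)
    \<comment> \<open>At \<open>i\<close>, \<open>x\<close> avoids 0 and \<open>y\<close> avoids 1,
      so their midpoint is strictly inside; averaging with \<open>z\<close> preserves strictness at
      the earlier coordinates.\<close>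
    define m where "m = (1/2) *\<^sub>R x + (1/2) *\<^sub>R y"
    define w where "w = (1/2) *\<^sub>R z + (1/2) *\<^sub>R m"
    have m: "m \<in> F" and w: "w \<in> F" using mid xy z by (auto simp: m_def w_def)
    have xyzC: "x \<in> unit_cube d" "y \<in> unit_cube d" "z \<in> unit_cube d" "m \<in> unit_cube d"
      using xy z m FC by auto
    have "0 < coord m i" "coord m i < 1"
      using xy(3,4) cube[OF xyzC(1) i(1)] cube[OF xyzC(2) i(1)] by (auto simp: m_def lookup_add)
    then have "0 < coord w i \<and> coord w i < 1"
      using cube[OF xyzC(3) i(1)] by (auto simp: w_def lookup_add)
    moreover have "0 < coord w j \<and> coord w j < 1" if "j \<in> I" for j
    proof -
      have "j < d" using that insert by auto
      then show ?thesis using bspec[OF z(2) that] cube[OF xyzC(4)] by (fastforce simp: w_def lookup_add)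
    qed
    ultimately show ?case using w by auto
  qed
  from this[of "{i. i < d \<and> g i = None}"]
  obtain z where z: "z \<in> F" "\<And>i. i < d \<Longrightarrow> g i = None \<Longrightarrow> 0 < coord z i \<and> coord z i < 1"
    by auto
  have "sign_face d g \<subseteq> F"
  proof
    fix y assume y: "y \<in> sign_face d g"
    show "y \<in> F"
    proof (cases "y = z")
      case False
      \<comment> \<open>A margin by which \<open>z\<close> can move in every free direction. The
        inserted 1 covers the case of no free coordinate.\<close>
      define e where "e = Min (insert 1 ((\<lambda>i. min (coord z i) (1 - coord z i)) ` {i. i < d \<and> g i = None}))"
      have e: "0 < e" unfolding e_def using z by (subst Min_gr_iff) auto
      have ei: "e \<le> coord z i" "e \<le> 1 - coord z i" if "i < d" "g i = None" for i
      proof -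
        have "e \<le> min (coord z i) (1 - coord z i)"
          unfolding e_def using that by (intro Min_le) auto
        then show "e \<le> coord z i" "e \<le> 1 - coord z i" by auto
      qed
      \<comment> \<open>The segment from \<open>y\<close> to \<open>z\<close> is prolonged beyond
        \<open>z\<close> by the fraction \<open>e\<close> of its length, which places
        \<open>z\<close> at parameter \<open>1 / (1 + e)\<close>.\<close>
      define y' where "y' = z + e *\<^sub>R (z - y)"
      have cy': "coord y' i = coord z i + e * (coord z i - coord y i)" for i
        by (simp add: y'_def lookup_add lookup_minus)
      have zC: "z \<in> unit_cube d" and yC: "y \<in> unit_cube d" using z y FC by (auto simp: sign_face_def)
      have "0 \<le> coord y' i \<and> coord y' i \<le> 1" if i: "i < d" for i
      proof (cases "g i")
        case None
        have "\<bar>coord z i - coord y i\<bar> \<le> 1" using cube[OF zC i] cube[OF yC i] by (auto simp: abs_if)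
        then have "\<bar>e * (coord z i - coord y i)\<bar> \<le> e" using e by (simp add: abs_mult)
        then show ?thesis using ei[OF i None] unfolding cy' by linarith
      next
        case (Some b)
        then have "coord y i = of_bool b" "coord z i = of_bool b"
          using y z(1) sub i by (auto simp: sign_face_def)
        then show ?thesis unfolding cy' by simp
      qed
      moreover have "coord y' i = 0" if "i \<ge> d" for i
        using zC yC that unfolding cy' by (auto simp: unit_cube_def)
      ultimately have y'C: "y' \<in> unit_cube d" by (auto simp: unit_cube_def)
      have "z \<in> open_segment y y'"
        unfolding in_segment
      proof (intro conjI exI[of _ "1 / (1 + e)"])
        show "y \<noteq> y'"
        proof
          assume "y = y'"
          then have "(1 + e) *\<^sub>R (z - y) = 0" by (simp add: y'_def algebra_simps)
          then show False using e False by simp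
        qed
        show "z = (1 - 1 / (1 + e)) *\<^sub>R y + (1 / (1 + e)) *\<^sub>R y'"
        proof (rule poly_mapping_eqI)
          fix i
          define u where "u = 1 / (1 + e)"
          have u: "u * (1 + e) = 1" using e by (simp add: u_def)
          have "(1 - u) * coord y i + u * (coord z i + e * (coord z i - coord y i))
              = (u * (1 + e)) * coord z i + (1 - u * (1 + e)) * coord y i"
            by (simp add: algebra_simps)
          also have "\<dots> = coord z i" unfolding u by simp
          finally show "coord z i = coord ((1 - 1 / (1 + e)) *\<^sub>R y + (1 / (1 + e)) *\<^sub>R y') i"
            by (simp add: lookup_add cy' u_def)
        qed
      qed (use e in auto)
      then show ?thesis using F z(1) yC y'C unfolding face_of_def by blast
    qed (use z in simp)
  qed
  then show ?thesis using sub g by blast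
qed

lemma Field_cube_face_poset: "Field (cube_face_poset d) = {F. F face_of unit_cube d}"
  by (auto simp: cube_face_poset_def relation_of_def Field_def)

lemma is_cube_signs:
  assumes cube: "is_cube d P" and m: "is_min_element P m"
  obtains \<phi> where "bij_betw \<phi> (Field P - {m}) (signs d)"
    "\<And>x y. x \<in> Field P - {m} \<Longrightarrow> y \<in> Field P - {m} \<Longrightarrow> (x, y) \<in> P \<longleftrightarrow> sign_le d (\<phi> x) (\<phi> y)"
proof -
  obtain f where f: "bij_betw f (Field P) {F. F face_of unit_cube d}"
    and ord: "\<And>x y. x \<in> Field P \<Longrightarrow> y \<in> Field P \<Longrightarrow> (x, y) \<in> P \<longleftrightarrow> (f x, f y) \<in> cube_face_poset d"
    using cube by (auto simp: is_cube_def poset_isomorphic_def Field_cube_face_poset)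
  have ord': "(x, y) \<in> P \<longleftrightarrow> f x \<subseteq> f y" if "x \<in> Field P" "y \<in> Field P" for x y
    using ord[OF that] f that by (auto simp: cube_face_poset_def relation_of_def bij_betw_def)
  have mF: "m \<in> Field P" using m by (simp add: is_min_element_def)
  obtain e where e: "e \<in> Field P" "f e = {}"
    using f empty_face_of[of "unit_cube d"] by (metis bij_betw_imp_surj_on imageE mem_Collect_eq)
  \<comment> \<open>The minimum \<open>m\<close> lies below \<open>e\<close>, so its image is
    contained in the empty polytope face.\<close>
  have "f m = {}" using ord'[OF mF e(1)] m e by (auto simp: is_min_element_def)
  then have f': "bij_betw f (Field P - {m}) ({F. F face_of unit_cube d} - {{}})"
    using f mF by (metis bij_betw_DiffI bij_betw_singletonI empty_face_of empty_subsetI insert_subset mem_Collect_eq)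
  have inj: "inj_on (sign_face d) (signs d)"
    by (rule inj_onI) (metis order_refl sign_face_subset_iff sign_le_antisym)
  have "F \<in> sign_face d ` signs d" if "F \<in> {F. F face_of unit_cube d} - {{}}" for F
    using face_of_unit_cubeD[of F d] that by blast
  then have "sign_face d ` signs d = {F. F face_of unit_cube d} - {{}}"
    using sign_face_face_of sign_face_nonempty by auto
  then have "bij_betw (sign_face d) (signs d) ({F. F face_of unit_cube d} - {{}})"
    using inj by (simp add: bij_betw_def)
  then have b: "bij_betw (the_inv_into (signs d) (sign_face d)) ({F. F face_of unit_cube d} - {{}}) (signs d)"
    and inv: "\<And>F. F \<in> {F. F face_of unit_cube d} - {{}} \<Longrightarrow> sign_face d (the_inv_into (signs d) (sign_face d) F) = F"
    by (auto simp: bij_betw_the_inv_into f_the_inv_into_f_bij_betw)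
  show thesis
  proof (rule that[of "the_inv_into (signs d) (sign_face d) \<circ> f"])
    show "bij_betw (the_inv_into (signs d) (sign_face d) \<circ> f) (Field P - {m}) (signs d)"
      using bij_betw_trans[OF f' b] .
    fix x y assume xy: "x \<in> Field P - {m}" "y \<in> Field P - {m}"
    then have "f x \<in> {F. F face_of unit_cube d} - {{}}" "f y \<in> {F. F face_of unit_cube d} - {{}}"
      using f' by (auto dest: bij_betwE)
    then show "(x, y) \<in> P \<longleftrightarrow> sign_le d ((the_inv_into (signs d) (sign_face d) \<circ> f) x) ((the_inv_into (signs d) (sign_face d) \<circ> f) y)"
      using ord'[of x y] xy by (simp add: inv flip: sign_face_subset_iff)
  qed
qed

subsection \<open>Face numbers in cubical complexes\<close>

text \<open>The dimension of the corresponding face of the cube.\<close>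

definition stars :: "nat \<Rightarrow> (nat \<Rightarrow> bool option) \<Rightarrow> nat" where
  "stars d g = card {i. i < d \<and> g i = None}"

lemma UNIV_bool_option: "UNIV = {None, Some False, Some True}"
  by (auto simp: UNIV_option_conv UNIV_bool)

lemma stars_le: "stars d g \<le> d"
proof -
  have "stars d g \<le> card {..<d}" unfolding stars_def by (intro card_mono) auto
  then show ?thesis by simp
qed

lemma card_not_star: "card {i \<in> {..<d}. g i \<noteq> None} = d - stars d g"
proof -
  have "{i \<in> {..<d}. g i \<noteq> None} = {..<d} - {i. i < d \<and> g i = None}" by auto
  then show ?thesis by (simp add: stars_def card_Diff_subset subset_eq)
qed

lemma prod_if_power:
  fixes y z :: "'b::comm_monoid_mult"
  assumes "finite I"
  shows "(\<Prod>i\<in>I. if P i then y else z) = y ^ card {i \<in> I. P i} * z ^ card {i \<in> I. \<not> P i}"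
  using assms by (simp add: prod.If_cases Int_def)

lemma sign_below_eq_PiE:
  assumes "g \<in> signs d"
  shows "{h \<in> signs d. sign_le d h g} = PiE {..<d} (\<lambda>i. if g i = None then UNIV else {g i})"
proof (rule Set.set_eqI)
  fix h
  have "(\<forall>i<d. g i = None \<or> g i = h i) \<longleftrightarrow> (\<forall>i<d. h i \<in> (if g i = None then UNIV else {g i}))"
    by (metis UNIV_I singletonD singletonI)
  then show "h \<in> {h \<in> signs d. sign_le d h g} \<longleftrightarrow> h \<in> PiE {..<d} (\<lambda>i. if g i = None then UNIV else {g i})"
    unfolding signs_def sign_le_def PiE_def
    by (simp only: Pi_iff mem_Collect_eq Int_iff Pi_UNIV UNIV_I simp_thms Ball_def lessThan_iff conj_commute)
qed

lemma card_sign_below: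
  assumes "g \<in> signs d"
  shows "card {h \<in> signs d. sign_le d h g} = 3 ^ stars d g"
proof -
  have c: "card (UNIV :: bool option set) = 3" by (simp add: UNIV_bool_option)
  have "card {h \<in> signs d. sign_le d h g} = (\<Prod>i<d. if g i = None then 3 else 1)"
    unfolding sign_below_eq_PiE[OF assms] by (subst card_PiE) (auto intro!: prod.cong simp: c)
  then show ?thesis by (simp add: prod_if_power stars_def)
qed

lemma sign_above_eq_PiE:
  assumes "g \<in> signs d"
  shows "{h \<in> signs d. sign_le d g h} = PiE {..<d} (\<lambda>i. {None, g i})"
  unfolding signs_def sign_le_def PiE_def by (simp add: set_eq_iff Pi_iff Ball_def conj_commute)

text \<open>The sum factors over the coordinates: each contributes \<open>y\<close> once when free
  and \<open>z\<close> twice when fixed, to 0 or to 1.\<close>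

lemma sum_signs:
  fixes y z :: "'b::comm_ring_1"
  shows "(\<Sum>g\<in>signs d. y ^ stars d g * z ^ (d - stars d g)) = (y + 2 * z) ^ d"
proof -
  have "(y + 2 * z) ^ d = (\<Prod>i<d. \<Sum>a\<in>UNIV. if a = (None :: bool option) then y else z)"
    by (simp add: UNIV_bool_option)
  also have "\<dots> = (\<Sum>g\<in>signs d. \<Prod>i<d. if g i = None then y else z)"
    unfolding signs_def by (subst prod_sum_PiE) (auto simp: UNIV_bool_option)
  also have "\<dots> = (\<Sum>g\<in>signs d. y ^ stars d g * z ^ (d - stars d g))"
  proof (rule sum.cong)
    fix g :: "nat \<Rightarrow> bool option"
    show "(\<Prod>i<d. if g i = None then y else z) = y ^ stars d g * z ^ (d - stars d g)"
      unfolding prod_if_power[OF finite_lessThan] card_not_star by (simp add: stars_def)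
  qed simp
  finally show ?thesis by simp
qed

text \<open>Above \<open>g\<close> its free coordinates stay free and each fixed one is either freed
  or kept, so the sum factors again. For \<open>y = -1\<close>, \<open>z = 1\<close> it expresses
  that the alternating sum over a proper interval vanishes.\<close>

lemma sum_signs_above:
  fixes y z :: "'b::comm_ring_1"
  assumes g: "g \<in> signs d"
  shows "(\<Sum>h | h \<in> signs d \<and> sign_le d g h. y ^ (stars d h - stars d g) * z ^ (d - stars d h))
    = (y + z) ^ (d - stars d g)"
proof -
  \<comment> \<open>Where \<open>g\<close> is free the choice set \<open>{None, g i}\<close> has one
    element, and weight 1 makes that factor disappear.\<close>
  define c where "c i a = (if g i = None then 1 else if a = None then y else z)" for i and a :: "bool option"
  have "(\<Prod>i<d. \<Sum>a\<in>{None, g i}. c i a) = (\<Prod>i<d. if g i = None then 1 else y + z)"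
    by (rule prod.cong) (auto simp: c_def)
  also have "\<dots> = (y + z) ^ (d - stars d g)"
    unfolding prod_if_power[OF finite_lessThan] card_not_star by simp
  finally have "(y + z) ^ (d - stars d g) = (\<Prod>i<d. \<Sum>a\<in>{None, g i}. c i a)" ..
  also have "\<dots> = (\<Sum>h\<in>PiE {..<d} (\<lambda>i. {None, g i}). \<Prod>i<d. c i (h i))"
    by (rule prod_sum_PiE) auto
  also have "\<dots> = (\<Sum>h | h \<in> signs d \<and> sign_le d g h. y ^ (stars d h - stars d g) * z ^ (d - stars d h))"
    unfolding sign_above_eq_PiE[OF g, symmetric]
  proof (rule sum.cong)
    fix h assume h: "h \<in> {h \<in> signs d. sign_le d g h}"
    have gh: "h i = None" if "i < d" "g i = None" for i
      using h that by (auto simp: sign_le_def)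
    have "(\<Prod>i<d. c i (h i)) = (\<Prod>i<d. (if g i \<noteq> None \<and> h i = None then y else 1) * (if h i \<noteq> None then z else 1))"
      using gh by (intro prod.cong) (auto simp: c_def)
    also have "\<dots> = y ^ card {i \<in> {..<d}. g i \<noteq> None \<and> h i = None} * z ^ card {i \<in> {..<d}. h i \<noteq> None}"
      unfolding prod.distrib prod_if_power[OF finite_lessThan] by simp
    also have "card {i \<in> {..<d}. g i \<noteq> None \<and> h i = None} = stars d h - stars d g"
    proof -
      have "{i \<in> {..<d}. g i \<noteq> None \<and> h i = None} = {i. i < d \<and> h i = None} - {i. i < d \<and> g i = None}"
        by auto
      moreover have "{i. i < d \<and> g i = None} \<subseteq> {i. i < d \<and> h i = None}" using gh by auto
      ultimately show ?thesis by (simp add: stars_def card_Diff_subset)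
    qed
    finally show "(\<Prod>i<d. c i (h i)) = y ^ (stars d h - stars d g) * z ^ (d - stars d h)"
      unfolding card_not_star .
  qed auto
  finally show ?thesis ..
qed

lemma card_signs: "card (signs d) = 3 ^ d"
proof -
  have "card (UNIV :: bool option set) = 3" by (simp add: UNIV_bool_option)
  then show ?thesis by (simp add: signs_def card_PiE)
qed

section \<open>Faces of a cubical complex in sign coordinates\<close>

definition below :: "'a rel \<Rightarrow> 'a \<Rightarrow> 'a set" where
  "below K F = {E \<in> nonempty_faces K. (E, F) \<in> K}"

locale cubical =
  fixes K :: "'a rel"
  assumes K: "cubical_complex K"
begin

lemma po: "Partial_order K" and finite_Field: "finite (Field K)"
  using K by (auto simp: cubical_complex_def)

lemma reflK: "x \<in> Field K \<Longrightarrow> (x, x) \<in> K"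
  using po by (auto simp: order_on_defs refl_on_def)

lemma transK: "(x, y) \<in> K \<Longrightarrow> (y, z) \<in> K \<Longrightarrow> (x, z) \<in> K"
  using po by (auto simp: order_on_defs dest: transD)

lemma antisymK: "(x, y) \<in> K \<Longrightarrow> (y, x) \<in> K \<Longrightarrow> x = y"
  using po by (auto simp: order_on_defs dest: antisymD)

lemma empty_face_unique: "is_min_element K m \<Longrightarrow> empty_face K = m"
  unfolding empty_face_def
  by (rule the_equality) (auto simp: is_min_element_def intro: antisymK)

lemma min_empty_face: "is_min_element K (empty_face K)"
  using K empty_face_unique by (auto simp: cubical_complex_def)

lemma empty_face_le: "x \<in> Field K \<Longrightarrow> (empty_face K, x) \<in> K"
  using min_empty_face by (auto simp: is_min_element_def)

lemma finite_nonempty_faces: "finite (nonempty_faces K)"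
  using finite_Field by (simp add: nonempty_faces_def)

lemma nonempty_FieldD: "F \<in> nonempty_faces K \<Longrightarrow> F \<in> Field K"
  by (simp add: nonempty_faces_def)

lemma above_nonempty: "E \<in> nonempty_faces K \<Longrightarrow> (E, F) \<in> K \<Longrightarrow> F \<in> nonempty_faces K"
  using empty_face_le antisymK by (auto simp: nonempty_faces_def Field_def)

lemma Field_face_complex: "F \<in> Field K \<Longrightarrow> Field (face_complex K F) = under K F"
  using reflK by (auto simp: face_complex_def under_def Field_def)

lemma face_complex_min:
  assumes "F \<in> Field K"
  shows "is_min_element (face_complex K F) (empty_face K)"
  unfolding is_min_element_def Field_face_complex[OF assms]
  using empty_face_le[OF assms] empty_face_le by (auto simp: under_def face_complex_def FieldI1)

lemma below_eq: "F \<in> Field K \<Longrightarrow> Field (face_complex K F) - {empty_face K} = below K F"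
  unfolding Field_face_complex by (auto simp: under_def below_def nonempty_faces_def FieldI1)

lemma self_below: "F \<in> nonempty_faces K \<Longrightarrow> F \<in> below K F"
  using reflK by (auto simp: below_def nonempty_FieldD)

lemma finite_below: "finite (below K F)"
  using finite_nonempty_faces by (simp add: below_def)

lemma is_cube_face_signs:
  assumes F: "F \<in> nonempty_faces K" and d: "is_cube d (face_complex K F)"
  obtains \<phi> where "bij_betw \<phi> (below K F) (signs d)"
    "\<And>x y. x \<in> below K F \<Longrightarrow> y \<in> below K F \<Longrightarrow> (x, y) \<in> K \<longleftrightarrow> sign_le d (\<phi> x) (\<phi> y)"
proof -
  have FF: "F \<in> Field K" using F nonempty_FieldD by blast
  obtain \<phi> where \<phi>: "bij_betw \<phi> (below K F) (signs d)"
    "\<And>x y. x \<in> below K F \<Longrightarrow> y \<in> below K F \<Longrightarrow> (x, y) \<in> face_complex K F \<longleftrightarrow> sign_le d (\<phi> x) (\<phi> y)"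
    using is_cube_signs[OF d face_complex_min[OF FF]] unfolding below_eq[OF FF] by metis
  moreover have "(x, y) \<in> face_complex K F \<longleftrightarrow> (x, y) \<in> K" if "x \<in> below K F" "y \<in> below K F" for x y
    using that by (auto simp: face_complex_def under_def below_def)
  ultimately show thesis using that by metis
qed

lemma is_cube_card:
  assumes "F \<in> nonempty_faces K" "is_cube d (face_complex K F)"
  shows "card (below K F) = 3 ^ d"
  using is_cube_face_signs[OF assms] bij_betw_same_card card_signs by metis

lemma is_cube_face_dim:
  assumes F: "F \<in> nonempty_faces K"
  shows "is_cube (face_dim K F) (face_complex K F)"
  unfolding face_dim_def
proof (rule theI')
  obtain d where d: "is_cube d (face_complex K F)" using K F by (auto simp: cubical_complex_def)
  show "\<exists>!d. is_cube d (face_complex K F)"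
  proof (rule ex1I)
    show "is_cube d (face_complex K F)" by fact
    fix e assume "is_cube e (face_complex K F)"
    then have "(3::nat) ^ e = 3 ^ d" using is_cube_card[OF F] d by metis
    then show "e = d" by simp
  qed
qed

text \<open>The dimension of a smaller face is defined by its own interval; counting the faces below
  it in two ways, as powers of 3, shows that it can be read off in the coordinates of
  \<open>F\<close>.\<close>

lemma face_signs:
  assumes F: "F \<in> nonempty_faces K"
  obtains \<phi> where "bij_betw \<phi> (below K F) (signs (face_dim K F))"
    "\<And>x y. x \<in> below K F \<Longrightarrow> y \<in> below K F \<Longrightarrow> (x, y) \<in> K \<longleftrightarrow> sign_le (face_dim K F) (\<phi> x) (\<phi> y)"
    "\<And>x. x \<in> below K F \<Longrightarrow> face_dim K x = stars (face_dim K F) (\<phi> x)"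
proof -
  let ?d = "face_dim K F"
  obtain \<phi> where b: "bij_betw \<phi> (below K F) (signs ?d)"
    and ord: "\<And>x y. x \<in> below K F \<Longrightarrow> y \<in> below K F \<Longrightarrow> (x, y) \<in> K \<longleftrightarrow> sign_le ?d (\<phi> x) (\<phi> y)"
    using is_cube_face_signs[OF F is_cube_face_dim[OF F]] by blast
  have "face_dim K x = stars ?d (\<phi> x)" if x: "x \<in> below K F" for x
  proof -
    have xN: "x \<in> nonempty_faces K" using x by (simp add: below_def)
    have sub: "below K x \<subseteq> below K F" using x transK by (auto simp: below_def)
    have "\<phi> ` below K x = {h \<in> signs ?d. sign_le ?d h (\<phi> x)}"
    proof
      show "\<phi> ` below K x \<subseteq> {h \<in> signs ?d. sign_le ?d h (\<phi> x)}"
      proof clarify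
        fix y assume y: "y \<in> below K x"
        then have "y \<in> below K F" "(y, x) \<in> K" using sub by (auto simp: below_def)
        then show "\<phi> y \<in> signs ?d \<and> sign_le ?d (\<phi> y) (\<phi> x)"
          using ord x bij_betwE[OF b] by blast
      qed
      show "{h \<in> signs ?d. sign_le ?d h (\<phi> x)} \<subseteq> \<phi> ` below K x"
      proof clarify
        fix h assume h: "h \<in> signs ?d" "sign_le ?d h (\<phi> x)"
        then obtain y where y: "y \<in> below K F" "h = \<phi> y"
          using bij_betw_imp_surj_on[OF b] by blast
        then have "(y, x) \<in> K" using ord x h by blast
        then show "h \<in> \<phi> ` below K x" using y by (auto simp: below_def)
      qed
    qed
    moreover have "inj_on \<phi> (below K x)"
      using inj_on_subset[OF bij_betw_imp_inj_on[OF b] sub] .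
    ultimately have "card (below K x) = 3 ^ stars ?d (\<phi> x)"
      using card_sign_below[of "\<phi> x" ?d] b x by (metis bij_betwE card_image)
    then have "(3::nat) ^ face_dim K x = 3 ^ stars ?d (\<phi> x)"
      using is_cube_card[OF xN is_cube_face_dim[OF xN]] by simp
    then show ?thesis by simp
  qed
  then show thesis using that[OF b ord] by blast
qed

lemma face_dim_mono:
  assumes "F \<in> nonempty_faces K" "E \<in> below K F"
  shows "face_dim K E \<le> face_dim K F"
  by (rule face_signs[OF assms(1)]) (simp add: assms(2) stars_le)

text \<open>Full dimension forces every coordinate to be free, and only one sign vector is like
  that.\<close>

lemma face_dim_less:
  assumes F: "F \<in> nonempty_faces K" and E: "E \<in> below K F" "E \<noteq> F"
  shows "face_dim K E < face_dim K F"
proof -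
  let ?d = "face_dim K F"
  obtain \<phi> where \<phi>: "bij_betw \<phi> (below K F) (signs ?d)"
    "\<And>x. x \<in> below K F \<Longrightarrow> face_dim K x = stars ?d (\<phi> x)"
    using face_signs[OF F] by metis
  have all: "\<phi> x i = None" if "x \<in> below K F" "face_dim K x = ?d" "i < ?d" for x i
  proof -
    have "card {i. i < ?d \<and> \<phi> x i = None} = card {..<?d}"
      using \<phi>(2)[OF that(1)] that(2) by (simp add: stars_def)
    then have "{i. i < ?d \<and> \<phi> x i = None} = {..<?d}" by (intro card_subset_eq) auto
    then show ?thesis using that(3) by auto
  qed
  have "face_dim K E \<noteq> ?d"
  proof
    assume eq: "face_dim K E = ?d"
    have "\<phi> E = \<phi> F"
    proof (rule PiE_ext)
      show "\<phi> E \<in> PiE {..<?d} (\<lambda>_. UNIV)" "\<phi> F \<in> PiE {..<?d} (\<lambda>_. UNIV)"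
        using bij_betwE[OF \<phi>(1)] E self_below[OF F] unfolding signs_def by blast+
      show "\<phi> E i = \<phi> F i" if "i \<in> {..<?d}" for i
        using all[OF E(1) eq] all[OF self_below[OF F] refl] that by simp
    qed
    then show False using inj_onD[OF bij_betw_imp_inj_on[OF \<phi>(1)]] E self_below[OF F] by blast
  qed
  then show ?thesis using face_dim_mono[OF F E(1)] by simp
qed

lemma sum_below:
  fixes y z :: "'b::comm_ring_1"
  assumes F: "F \<in> nonempty_faces K"
  shows "(\<Sum>E\<in>below K F. y ^ face_dim K E * z ^ (face_dim K F - face_dim K E)) = (y + 2 * z) ^ face_dim K F"
proof -
  let ?d = "face_dim K F"
  obtain \<phi> where \<phi>: "bij_betw \<phi> (below K F) (signs ?d)"
    "\<And>x. x \<in> below K F \<Longrightarrow> face_dim K x = stars ?d (\<phi> x)"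
    using face_signs[OF F] by metis
  have "(\<Sum>E\<in>below K F. y ^ face_dim K E * z ^ (?d - face_dim K E))
      = (\<Sum>E\<in>below K F. y ^ stars ?d (\<phi> E) * z ^ (?d - stars ?d (\<phi> E)))"
    using \<phi>(2) by simp
  also have "\<dots> = (\<Sum>g\<in>signs ?d. y ^ stars ?d g * z ^ (?d - stars ?d g))"
    by (rule sum.reindex_bij_betw[OF \<phi>(1)])
  finally show ?thesis by (simp add: sum_signs)
qed

lemma sum_between:
  fixes y z :: "'b::comm_ring_1"
  assumes F: "F \<in> nonempty_faces K" and E: "E \<in> below K F"
  shows "(\<Sum>G | G \<in> below K F \<and> (E, G) \<in> K.
      y ^ (face_dim K G - face_dim K E) * z ^ (face_dim K F - face_dim K G))
    = (y + z) ^ (face_dim K F - face_dim K E)"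
proof -
  let ?d = "face_dim K F"
  obtain \<phi> where \<phi>: "bij_betw \<phi> (below K F) (signs ?d)"
    "\<And>x y. x \<in> below K F \<Longrightarrow> y \<in> below K F \<Longrightarrow> (x, y) \<in> K \<longleftrightarrow> sign_le ?d (\<phi> x) (\<phi> y)"
    "\<And>x. x \<in> below K F \<Longrightarrow> face_dim K x = stars ?d (\<phi> x)"
    by (rule face_signs[OF F]) (rule that)
  have b: "bij_betw \<phi> {G. G \<in> below K F \<and> (E, G) \<in> K} {h. h \<in> signs ?d \<and> sign_le ?d (\<phi> E) h}"
    unfolding bij_betw_def
  proof
    show "inj_on \<phi> {G. G \<in> below K F \<and> (E, G) \<in> K}"
      by (rule inj_on_subset[OF bij_betw_imp_inj_on[OF \<phi>(1)]]) auto
    have "\<phi> ` {G \<in> below K F. sign_le ?d (\<phi> E) (\<phi> G)} = {h. h \<in> signs ?d \<and> sign_le ?d (\<phi> E) h}"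
      unfolding bij_betw_imp_surj_on[OF \<phi>(1), symmetric] by blast
    then show "\<phi> ` {G. G \<in> below K F \<and> (E, G) \<in> K} = {h. h \<in> signs ?d \<and> sign_le ?d (\<phi> E) h}"
      using \<phi>(2)[OF E] by (simp cong: conj_cong)
  qed
  have "(\<Sum>G | G \<in> below K F \<and> (E, G) \<in> K. y ^ (face_dim K G - face_dim K E) * z ^ (?d - face_dim K G))
      = (\<Sum>G | G \<in> below K F \<and> (E, G) \<in> K. y ^ (stars ?d (\<phi> G) - stars ?d (\<phi> E)) * z ^ (?d - stars ?d (\<phi> G)))"
    using \<phi>(3) E by simp
  also have "\<dots> = (\<Sum>h | h \<in> signs ?d \<and> sign_le ?d (\<phi> E) h. y ^ (stars ?d h - stars ?d (\<phi> E)) * z ^ (?d - stars ?d h))"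
    by (rule sum.reindex_bij_betw[OF b])
  also have "\<dots> = (y + z) ^ (?d - stars ?d (\<phi> E))"
    by (rule sum_signs_above) (rule bij_betw_apply[OF \<phi>(1) E])
  finally show ?thesis using \<phi>(3)[OF E] by simp
qed

lemma facet_exists:
  assumes F: "F \<in> nonempty_faces K" and d: "face_dim K F = Suc m"
  obtains E where "E \<in> below K F" "face_dim K E = m"
proof -
  obtain \<phi> where \<phi>: "bij_betw \<phi> (below K F) (signs (Suc m))"
    "\<And>x. x \<in> below K F \<Longrightarrow> face_dim K x = stars (Suc m) (\<phi> x)"
    by (rule face_signs[OF F, unfolded d]) (rule that)
  define g where "g = (\<lambda>i\<in>{..<Suc m}. if i = m then Some False else None)"
  have "g \<in> signs (Suc m)" by (simp add: g_def signs_def)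
  then have "g \<in> \<phi> ` below K F" by (simp only: bij_betw_imp_surj_on[OF \<phi>(1)])
  then obtain E where E: "E \<in> below K F" "\<phi> E = g" by (metis imageE)
  have "{i. i < Suc m \<and> g i = None} = {..<m}" by (auto simp: g_def split: if_splits)
  then have "face_dim K E = m" using \<phi>(2)[OF E(1)] E(2) by (simp add: stars_def)
  then show thesis by (rule that[OF E(1)])
qed

end

subsection \<open>Chains of faces\<close>

definition face_chains :: "'a rel \<Rightarrow> 'a set set" where
  "face_chains K = {s. s \<subseteq> nonempty_faces K \<and> s \<in> Chains K}"

definition is_chain_top :: "'a rel \<Rightarrow> 'a set \<Rightarrow> 'a \<Rightarrow> bool" where
  "is_chain_top K s G \<longleftrightarrow> G \<in> s \<and> (\<forall>x\<in>s. (x, G) \<in> K)"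

lemma realization_eq:
  "realization K = top_of_set (polyhedron_of (nonempty_faces K) (face_chains K))"
  unfolding realization_def polyhedron_of_def face_chains_def supp_def euclidean_product_topology
  by (rule arg_cong[where f = top_of_set]) auto

lemma face_chains_subset: "s \<in> face_chains K \<Longrightarrow> t \<subseteq> s \<Longrightarrow> t \<in> face_chains K"
  unfolding face_chains_def Chains_def by blast

context cubical
begin

lemma complex_on_face_chains: "complex_on (nonempty_faces K) (face_chains K)"
  unfolding complex_on_def using finite_nonempty_faces face_chains_subset
  by (auto simp: face_chains_def)

lemma finite_face_chains: "finite (face_chains K)"
  by (rule finite_subset[of _ "Pow (nonempty_faces K)"])
    (auto simp: face_chains_def finite_nonempty_faces)

lemma finite_chain: "s \<in> face_chains K \<Longrightarrow> finite s"
  using finite_nonempty_faces finite_subset by (auto simp: face_chains_def)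

lemma chain_top_exists:
  assumes "s \<in> face_chains K" "s \<noteq> {}"
  shows "\<exists>G. is_chain_top K s G"
proof -
  have "finite s" using finite_chain assms by blast
  then show ?thesis
    using assms(2,1)
  proof (induction rule: finite_ne_induct)
    case (singleton x)
    then have "(x, x) \<in> K" using reflK nonempty_FieldD by (auto simp: face_chains_def)
    then show ?case by (auto simp: is_chain_top_def)
  next
    case (insert x s)
    then obtain G where G: "is_chain_top K s G"
      using face_chains_subset[of "insert x s" K s] by blast
    have x: "(x, x) \<in> K" using insert.prems reflK nonempty_FieldD by (auto simp: face_chains_def)
    have "(x, G) \<in> K \<or> (G, x) \<in> K"
      using insert.prems G by (auto simp: face_chains_def Chains_def is_chain_top_def)
    then show ?case
    proof
      assume "(x, G) \<in> K"
      then have "is_chain_top K (insert x s) G" using G by (simp add: is_chain_top_def)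
      then show ?thesis by blast
    next
      assume "(G, x) \<in> K"
      then have "\<forall>y\<in>s. (y, x) \<in> K" using G transK unfolding is_chain_top_def by blast
      then have "is_chain_top K (insert x s) x" using x by (simp add: is_chain_top_def)
      then show ?thesis by blast
    qed
  qed
qed

lemma chain_top_unique: "is_chain_top K s G \<Longrightarrow> is_chain_top K s H \<Longrightarrow> G = H"
  unfolding is_chain_top_def using antisymK by blast

lemma chain_top_nonempty: "s \<in> face_chains K \<Longrightarrow> is_chain_top K s G \<Longrightarrow> G \<in> nonempty_faces K"
  by (auto simp: face_chains_def is_chain_top_def)

lemma chain_insert:
  assumes "s \<in> face_chains K" "G \<in> nonempty_faces K" "\<forall>x\<in>s. (x, G) \<in> K"
  shows "insert G s \<in> face_chains K"
  using assms reflK[OF nonempty_FieldD[OF assms(2)]]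
  unfolding face_chains_def Chains_def by auto

lemma sum_chains_by_top:
  fixes f :: "'a set \<Rightarrow> int"
  assumes A: "A \<subseteq> face_chains K" "{} \<notin> A" and T: "finite T"
    and top: "\<And>s G. s \<in> A \<Longrightarrow> is_chain_top K s G \<Longrightarrow> G \<in> T"
  shows "sum f A = (\<Sum>G\<in>T. \<Sum>s | s \<in> A \<and> is_chain_top K s G. f s)"
proof -
  define g where "g s = (THE G. is_chain_top K s G)" for s
  have g: "is_chain_top K s G \<longleftrightarrow> g s = G" if "s \<in> A" for s G
  proof -
    obtain H where H: "is_chain_top K s H" using chain_top_exists[of s] A \<open>s \<in> A\<close> by blast
    then have "g s = H" unfolding g_def using chain_top_unique by (intro the_equality)
    then show ?thesis using H chain_top_unique by blast
  qed
  have "finite A" using A(1) finite_face_chains finite_subset by blast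
  then have "(\<Sum>G\<in>T. \<Sum>s | s \<in> A \<and> g s = G. f s) = sum f A"
    by (rule sum.group[OF _ T]) (use top g in blast)
  moreover have "{s. s \<in> A \<and> g s = G} = {s. s \<in> A \<and> is_chain_top K s G}" for G
    using g by blast
  ultimately show ?thesis by simp
qed

definition chains_with_top :: "'a set \<Rightarrow> 'a \<Rightarrow> 'a set set" where
  "chains_with_top t G = {s \<in> face_chains K. t \<subseteq> s \<and> is_chain_top K s G}"

text \<open>Induction on the dimension of \<open>G\<close>. Deleting \<open>G\<close> flips the
  sign, and grouping the remaining chains by their top leaves an alternating sum over faces. For
  empty \<open>u\<close> these are the proper faces of a cube, plus a term for the empty chain;
  otherwise they form a proper interval of a cube without its top. Both cases give the same value,
  so \<open>t\<close> drops out.\<close>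

lemma sum_chains_with_top:
  assumes "t \<in> face_chains K" "G \<in> nonempty_faces K" "\<forall>x\<in>t. (x, G) \<in> K"
  shows "(\<Sum>s\<in>chains_with_top t G. (-1::int) ^ (card s + 1)) = (-1) ^ face_dim K G"
  using assms
proof (induction "face_dim K G" arbitrary: t G rule: less_induct)
  case less
  \<comment> \<open>Whether \<open>t\<close> contains \<open>G\<close> makes no difference, since
    every chain counted contains \<open>G\<close>.\<close>
  define u where "u = t - {G}"
  have u: "u \<in> face_chains K" "\<forall>x\<in>u. (x, G) \<in> K" "G \<notin> u"
    using less.prems face_chains_subset[of t K u] by (auto simp: u_def)
  have eq: "chains_with_top t G = chains_with_top u G"
    by (auto simp: chains_with_top_def u_def is_chain_top_def)
  define R where "R = {s \<in> face_chains K. u \<subseteq> s \<and> (\<forall>x\<in>s. (x, G) \<in> K \<and> x \<noteq> G)}"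
  have finR: "finite R" using finite_face_chains by (simp add: R_def)
  have img: "chains_with_top u G = insert G ` R"
  proof
    show "insert G ` R \<subseteq> chains_with_top u G"
      using chain_insert[OF _ less.prems(2)] reflK[OF nonempty_FieldD[OF less.prems(2)]]
      by (auto simp: R_def chains_with_top_def is_chain_top_def)
    show "chains_with_top u G \<subseteq> insert G ` R"
    proof
      fix s assume s: "s \<in> chains_with_top u G"
      then have "s = insert G (s - {G})" by (auto simp: chains_with_top_def is_chain_top_def)
      moreover have "s - {G} \<in> R"
        using s u(3) face_chains_subset[of s K "s - {G}"]
        by (auto simp: R_def chains_with_top_def is_chain_top_def)
      ultimately show "s \<in> insert G ` R" by blast
    qed
  qed
  have inj: "inj_on (insert G) R"
    by (rule inj_onI) (auto simp: R_def)
  have "(\<Sum>s\<in>chains_with_top t G. (-1::int) ^ (card s + 1)) = (\<Sum>s\<in>R. (-1) ^ (card (insert G s) + 1))"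
    unfolding eq img by (simp add: sum.reindex[OF inj])
  also have "\<dots> = (\<Sum>s\<in>R. - ((-1) ^ (card s + 1)))"
  proof (rule sum.cong)
    fix s assume "s \<in> R"
    then have "finite s" "G \<notin> s" using finite_chain by (auto simp: R_def)
    then show "(-1::int) ^ (card (insert G s) + 1) = - ((-1) ^ (card s + 1))" by simp
  qed simp
  also have "\<dots> = - (\<Sum>s\<in>R. (-1) ^ (card s + 1))" by (simp add: sum_negf)
  finally have red: "(\<Sum>s\<in>chains_with_top t G. (-1::int) ^ (card s + 1)) = - (\<Sum>s\<in>R. (-1) ^ (card s + 1))" .
  define W where "W = {H \<in> below K G. H \<noteq> G \<and> (\<forall>x\<in>u. (x, H) \<in> K)}"
  have finW: "finite W" using finite_below by (simp add: W_def)
  have "(\<Sum>s\<in>R - {{}}. (-1::int) ^ (card s + 1))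
      = (\<Sum>H\<in>W. \<Sum>s | s \<in> R - {{}} \<and> is_chain_top K s H. (-1) ^ (card s + 1))"
  proof (rule sum_chains_by_top[OF _ _ finW])
    fix s H assume "s \<in> R - {{}}" "is_chain_top K s H"
    then show "H \<in> W" by (auto simp: R_def W_def is_chain_top_def below_def face_chains_def)
  qed (auto simp: R_def)
  also have "\<dots> = (\<Sum>H\<in>W. (-1) ^ face_dim K H)"
  proof (rule sum.cong)
    fix H assume H: "H \<in> W"
    then have HG: "H \<in> below K G" "H \<noteq> G" and HN: "H \<in> nonempty_faces K" "(H, G) \<in> K"
      and Hu: "\<forall>x\<in>u. (x, H) \<in> K" by (auto simp: W_def below_def)
    have "{s. s \<in> R - {{}} \<and> is_chain_top K s H} = chains_with_top u H"
    proof
      show "{s. s \<in> R - {{}} \<and> is_chain_top K s H} \<subseteq> chains_with_top u H"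
        by (auto simp: R_def chains_with_top_def)
      have "x \<noteq> G \<and> (x, G) \<in> K" if "(x, H) \<in> K" for x
        using that HN(2) HG(2) transK antisymK by blast
      then show "chains_with_top u H \<subseteq> {s. s \<in> R - {{}} \<and> is_chain_top K s H}"
        by (auto simp: R_def chains_with_top_def is_chain_top_def)
    qed
    then show "(\<Sum>s | s \<in> R - {{}} \<and> is_chain_top K s H. (-1::int) ^ (card s + 1)) = (-1) ^ face_dim K H"
      using less.hyps[OF face_dim_less[OF less.prems(2) HG] u(1) HN(1) Hu] by simp
  qed simp
  finally have RW: "(\<Sum>s\<in>R - {{}}. (-1::int) ^ (card s + 1)) = (\<Sum>H\<in>W. (-1) ^ face_dim K H)" .
  have "(\<Sum>s\<in>R. (-1::int) ^ (card s + 1)) = - ((-1) ^ face_dim K G)"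
  proof (cases "u = {}")
    case True
    then have "{} \<in> R" using u(1) by (auto simp: R_def)
    \<comment> \<open>The empty chain has weight -1, which offsets the alternating sum 1 over all
      nonempty faces of a cube.\<close>
    then have "(\<Sum>s\<in>R. (-1::int) ^ (card s + 1)) = - 1 + (\<Sum>s\<in>R - {{}}. (-1) ^ (card s + 1))"
      using finR by (simp add: sum.remove)
    moreover have "below K G = insert G W" "G \<notin> W"
      using self_below[OF less.prems(2)] True by (auto simp: W_def)
    then have "(\<Sum>H\<in>below K G. (-1::int) ^ face_dim K H) = (-1) ^ face_dim K G + (\<Sum>H\<in>W. (-1) ^ face_dim K H)"
      using finW by simp
    moreover have "(\<Sum>H\<in>below K G. (-1::int) ^ face_dim K H) = 1"
      using sum_below[OF less.prems(2), of "-1::int" 1] by simp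
    ultimately show ?thesis using RW by simp
  next
    case False
    then have "R - {{}} = R" by (auto simp: R_def)
    moreover obtain E where E: "is_chain_top K u E" using chain_top_exists[OF u(1) False] by blast
    have EG: "E \<in> below K G" "E \<noteq> G"
      using E u chain_top_nonempty[OF u(1) E] by (auto simp: is_chain_top_def below_def)
    have "(\<forall>x\<in>u. (x, H) \<in> K) \<longleftrightarrow> (E, H) \<in> K" for H
      using E transK unfolding is_chain_top_def by blast
    then have "{H. H \<in> below K G \<and> (E, H) \<in> K} = insert G W" "G \<notin> W"
      using self_below[OF less.prems(2)] EG by (auto simp: W_def below_def)
    then have "(\<Sum>H | H \<in> below K G \<and> (E, H) \<in> K. (-1::int) ^ face_dim K H)
        = (-1) ^ face_dim K G + (\<Sum>H\<in>W. (-1) ^ face_dim K H)"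
      using finW by simp
    \<comment> \<open>As \<open>E\<close> lies strictly below \<open>G\<close>, the weights -1 and 1
      turn \<open>sum_between\<close> into a positive power of 0.\<close>
    moreover have "(\<Sum>H | H \<in> below K G \<and> (E, H) \<in> K. (-1::int) ^ face_dim K H) = 0"
    proof -
      have "(\<Sum>H | H \<in> below K G \<and> (E, H) \<in> K. (-1::int) ^ face_dim K H)
          = (\<Sum>H | H \<in> below K G \<and> (E, H) \<in> K. (-1) ^ face_dim K E *
              ((-1) ^ (face_dim K H - face_dim K E) * 1 ^ (face_dim K G - face_dim K H)))"
      proof (rule sum.cong)
        fix H assume "H \<in> {H. H \<in> below K G \<and> (E, H) \<in> K}"
        then have "face_dim K E \<le> face_dim K H"
          using EG by (intro face_dim_mono) (auto simp: below_def)
        then show "(-1::int) ^ face_dim K H = (-1) ^ face_dim K E *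
              ((-1) ^ (face_dim K H - face_dim K E) * 1 ^ (face_dim K G - face_dim K H))"
          by (simp flip: power_add)
      qed simp
      also have "\<dots> = (-1) ^ face_dim K E * (-1 + 1) ^ (face_dim K G - face_dim K E)"
        unfolding sum_distrib_left[symmetric] sum_between[OF less.prems(2) EG(1)] ..
      also have "\<dots> = 0" using face_dim_less[OF less.prems(2) EG] by simp
      finally show ?thesis .
    qed
    ultimately show ?thesis using RW by simp
  qed
  then show ?case using red by simp
qed

text \<open>Grouping by the top element turns the count of chains into a count of faces, in which
  only the top of \<open>t\<close> is still visible.\<close>

lemma sum_chains_above:
  assumes t: "t \<in> face_chains K" "is_chain_top K t E"
  shows "(\<Sum>s | s \<in> face_chains K \<and> t \<subseteq> s. (-1::int) ^ (card s + 1))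
    = (\<Sum>G | (E, G) \<in> K. (-1) ^ face_dim K G)"
proof -
  have E: "E \<in> nonempty_faces K" using chain_top_nonempty[OF t] .
  have "finite {G. (E, G) \<in> K}"
    by (rule finite_subset[OF _ finite_Field]) (auto simp: Field_def)
  then have "(\<Sum>s | s \<in> face_chains K \<and> t \<subseteq> s. (-1::int) ^ (card s + 1))
      = (\<Sum>G | (E, G) \<in> K. \<Sum>s | s \<in> {s. s \<in> face_chains K \<and> t \<subseteq> s} \<and> is_chain_top K s G. (-1) ^ (card s + 1))"
  proof (rule sum_chains_by_top[rotated 2])
    show "{} \<notin> {s \<in> face_chains K. t \<subseteq> s}" using t(2) by (auto simp: is_chain_top_def)
    fix s G assume "s \<in> {s \<in> face_chains K. t \<subseteq> s}" "is_chain_top K s G"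
    then show "G \<in> {G. (E, G) \<in> K}" using t(2) by (auto simp: is_chain_top_def)
  qed auto
  also have "\<dots> = (\<Sum>G | (E, G) \<in> K. (-1) ^ face_dim K G)"
  proof (rule sum.cong)
    fix G assume G: "G \<in> {G. (E, G) \<in> K}"
    have "\<forall>x\<in>t. (x, G) \<in> K" using t(2) G transK unfolding is_chain_top_def by blast
    then have "(\<Sum>s\<in>chains_with_top t G. (-1::int) ^ (card s + 1)) = (-1) ^ face_dim K G"
      using sum_chains_with_top[OF t(1) above_nonempty[OF E]] G by blast
    then show "(\<Sum>s | s \<in> {s. s \<in> face_chains K \<and> t \<subseteq> s} \<and> is_chain_top K s G. (-1::int) ^ (card s + 1))
        = (-1) ^ face_dim K G"
      by (simp add: chains_with_top_def)
  qed simp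
  finally show ?thesis .
qed

text \<open>Descend facet by facet. The chain spans a simplex of dimension
  \<open>face_dim K E\<close>, which serves to bound dimensions of faces in a ball.\<close>

lemma exists_full_chain:
  assumes "E \<in> nonempty_faces K"
  obtains s where "s \<in> face_chains K" "is_chain_top K s E" "card s = Suc (face_dim K E)"
proof -
  have "\<exists>s\<in>face_chains K. is_chain_top K s E \<and> card s = Suc (face_dim K E)"
    using assms
  proof (induction "face_dim K E" arbitrary: E)
    case 0
    have r: "(E, E) \<in> K" using 0 reflK nonempty_FieldD by blast
    then have "{E} \<in> face_chains K" using 0 by (auto simp: face_chains_def Chains_def)
    then show ?case using 0 r by (intro bexI[of _ "{E}"]) (auto simp: is_chain_top_def)
  next
    case (Suc m)
    obtain F where F: "F \<in> below K E" "face_dim K F = m"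
      using facet_exists[OF Suc.prems Suc.hyps(2)[symmetric]] .
    then have FN: "F \<in> nonempty_faces K" "(F, E) \<in> K" by (auto simp: below_def)
    then obtain s where s: "s \<in> face_chains K" "is_chain_top K s F" "card s = Suc m"
      using Suc.hyps(1)[of F] F(2) by auto
    have le: "\<forall>x\<in>s. (x, E) \<in> K" using s(2) FN(2) transK unfolding is_chain_top_def by blast
    have "E \<notin> s"
    proof
      assume "E \<in> s"
      then have "(E, F) \<in> K" using s(2) by (simp add: is_chain_top_def)
      then have "E = F" using FN(2) antisymK by blast
      then show False using F(2) Suc.hyps(2) by simp
    qed
    then have "card (insert E s) = Suc (face_dim K E)"
      using s finite_chain Suc.hyps(2) by simp
    moreover have "is_chain_top K (insert E s) E"
      using le reflK nonempty_FieldD Suc.prems by (auto simp: is_chain_top_def)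
    ultimately show ?case using chain_insert[OF s(1) Suc.prems le] by blast
  qed
  then show thesis using that by blast
qed

end

subsection \<open>Local Euler relations in a cubical ball\<close>

context cubical
begin

abbreviation body :: "('a \<Rightarrow> real) set" where
  "body \<equiv> polyhedron_of (nonempty_faces K) (face_chains K)"

definition local_sum :: "'a \<Rightarrow> int" where
  "local_sum E = (\<Sum>G | (E, G) \<in> K. (-1) ^ face_dim K G)"

text \<open>Puncturing at \<open>q\<close> removes, up to homotopy, the chains that contain the
  carrier of \<open>q\<close>.\<close>

lemma local_euler_char:
  assumes q: "q \<in> body" and E: "is_chain_top K (supp q) E"
  shows "euler_char (top_of_set body) {} - euler_char (top_of_set (body - {q})) {} = local_sum E"
proof -
  let ?C = "face_chains K" and ?L = "{s \<in> face_chains K. \<not> supp q \<subseteq> s}"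
  have sq: "supp q \<in> ?C" using q by (simp add: polyhedron_of_def)
  have L: "complex_on (nonempty_faces K) ?L"
    using complex_on_face_chains by (auto simp: complex_on_def)
  have "euler_char (top_of_set body) {} = simplicial_euler ?C"
    using euler_char_polyhedron[OF complex_on_face_chains] by blast
  moreover have "euler_char (top_of_set (body - {q})) {} = simplicial_euler ?L"
    using euler_char_polyhedron[OF L] finite_homology_homotopy_equivalent
      [OF polyhedron_minus_point_homotopy_equivalent[OF complex_on_face_chains q]] by auto
  moreover have "simplicial_euler ?C = simplicial_euler ?L + (\<Sum>s | s \<in> ?C \<and> supp q \<subseteq> s. (-1) ^ (card s + 1))"
  proof -
    have "?C - {{}} = (?L - {{}}) \<union> {s. s \<in> ?C \<and> supp q \<subseteq> s}"
      using polyhedron_supp_nonempty[OF q] by auto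
    then show ?thesis
      unfolding simplicial_euler_def using finite_face_chains by (simp add: sum.union_disjoint[symmetric] disjoint_iff)
  qed
  ultimately show ?thesis
    using sum_chains_above[OF sq E] by (simp add: local_sum_def)
qed

lemma local_sum_ball:
  assumes f: "homeomorphic_map (realization K) (unit_ball n) f"
    and q: "q \<in> body" "is_chain_top K (supp q) E"
  shows "local_sum E = (if (\<Sum>i<n. (f q i)\<^sup>2) = 1 then 0 else (-1) ^ n)"
proof -
  have "subtopology (top_of_set body) (body - {q}) = top_of_set (body - {q})"
    by (simp add: subtopology_subtopology Int_absorb1 Diff_subset)
  then show ?thesis
    using local_euler_char_ball[OF f, of q] local_euler_char[OF q] q(1) by (simp add: realization_eq)
qed

text \<open>The homeomorphism in \<open>ball_boundary\<close> may depend on the point, but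
  \<open>local_sum E\<close> depends on none; as 0 and \<open>(-1) ^ n\<close> differ, its value
  decides membership.\<close>

lemma ball_boundary_iff:
  assumes hom: "realization K homeomorphic_space unit_ball n"
    and q: "q \<in> body" "is_chain_top K (supp q) E"
  shows "q \<in> ball_boundary n (realization K) \<longleftrightarrow> local_sum E = 0"
    and "q \<notin> ball_boundary n (realization K) \<longleftrightarrow> local_sum E = (-1) ^ n"
proof -
  obtain f where f: "homeomorphic_map (realization K) (unit_ball n) f"
    using hom by (auto simp: homeomorphic_space)
  have "q \<in> ball_boundary n (realization K) \<Longrightarrow> local_sum E = 0"
    using local_sum_ball[OF _ q] by (auto simp: ball_boundary_def)
  moreover have "q \<notin> ball_boundary n (realization K) \<Longrightarrow> local_sum E = (-1) ^ n"
    using local_sum_ball[OF f q] f q(1) by (auto simp: ball_boundary_def realization_eq)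
  ultimately show "q \<in> ball_boundary n (realization K) \<longleftrightarrow> local_sum E = 0"
    "q \<notin> ball_boundary n (realization K) \<longleftrightarrow> local_sum E = (-1) ^ n"
    by (metis power_eq_0_iff zero_neq_neg_one)+
qed

text \<open>A face is a vertex of the order complex; this point plays the part of its
  barycenter.\<close>

lemma vertex_in_body:
  assumes "E \<in> nonempty_faces K"
  obtains q where "q \<in> body" "supp q = {E}"
proof -
  have "(E, E) \<in> K" using assms reflK nonempty_FieldD by blast
  then have "{E} \<in> face_chains K" using assms by (auto simp: face_chains_def Chains_def)
  then show thesis
    using barycenter[OF finite_nonempty_faces, of "{E}" "face_chains K"] assms that by auto
qed

text \<open>Weights are functions on the whole type, zero off their carrier, so the realization of a
  face is literally a subset of \<open>body\<close>.\<close>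

lemma topspace_face_complex:
  assumes E: "E \<in> nonempty_faces K"
  shows "topspace (realization (face_complex K E)) = {t \<in> body. supp t \<subseteq> below K E}"
proof -
  have EF: "E \<in> Field K" using E nonempty_FieldD by blast
  have "empty_face (face_complex K E) = empty_face K"
    unfolding empty_face_def[of "face_complex K E"]
  proof (rule the_equality)
    show "is_min_element (face_complex K E) (empty_face K)" by (rule face_complex_min[OF EF])
    fix m assume "is_min_element (face_complex K E) m"
    then have "(m, empty_face K) \<in> face_complex K E" "(empty_face K, m) \<in> face_complex K E"
      using face_complex_min[OF EF] by (auto simp: is_min_element_def)
    then show "m = empty_face K" using antisymK by (auto simp: face_complex_def)
  qed
  then have N: "nonempty_faces (face_complex K E) = below K E"
    using below_eq[OF EF] by (simp add: nonempty_faces_def)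
  have bN: "below K E \<subseteq> nonempty_faces K" by (auto simp: below_def)
  have C: "face_chains (face_complex K E) = {s \<in> face_chains K. s \<subseteq> below K E}"
  proof -
    have "(x, y) \<in> face_complex K E \<longleftrightarrow> (x, y) \<in> K" if "x \<in> below K E" "y \<in> below K E" for x y
      using that by (auto simp: face_complex_def under_def below_def)
    then show ?thesis unfolding face_chains_def N Chains_def using bN by blast
  qed
  have "(\<Sum>x\<in>below K E. t x) = (\<Sum>x\<in>nonempty_faces K. t x)" if "supp t \<subseteq> below K E" for t
    using bN that finite_nonempty_faces by (intro sum.mono_neutral_left) (auto simp: supp_def)
  then show ?thesis
    unfolding realization_eq N C by (auto simp: polyhedron_of_def)
qed

text \<open>
  A point of \<open>E\<close> outside the boundary is a limit of points in the relative interior of \<open>E\<close>, and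
  the boundary is closed.
\<close>

lemma interior_face_iff:
  assumes hom: "realization K homeomorphic_space unit_ball n" and E: "E \<in> nonempty_faces K"
  shows "local_sum E = (if E \<in> interior_faces n K then (-1) ^ n else 0)"
proof -
  obtain v where v: "v \<in> body" "supp v = {E}" using vertex_in_body[OF E] .
  have EE: "(E, E) \<in> K" using E reflK nonempty_FieldD by blast
  have vtop: "is_chain_top K (supp v) E" using v EE by (simp add: is_chain_top_def)
  have int: "E \<in> interior_faces n K \<longleftrightarrow>
      (\<exists>q\<in>body. supp q \<subseteq> below K E \<and> q \<notin> ball_boundary n (realization K))"
    using E topspace_face_complex[OF E] by (auto simp: interior_faces_def)
  have "v \<notin> ball_boundary n (realization K)" if inE: "E \<in> interior_faces n K"
  proof
    assume "v \<in> ball_boundary n (realization K)"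
    then have zero: "local_sum E = 0" using ball_boundary_iff(1)[OF hom v(1) vtop] by blast
    obtain q where q: "q \<in> body" "supp q \<subseteq> below K E" "q \<notin> ball_boundary n (realization K)"
      using inE int by blast
    obtain f where f: "homeomorphic_map (realization K) (unit_ball n) f"
      using hom by (auto simp: homeomorphic_space)
    \<comment> \<open>The segment from \<open>q\<close> to the barycenter \<open>v\<close>. As soon
      as \<open>u > 0\<close>, the carrier has top \<open>E\<close>, where the local sum is
      0.\<close>
    define r where "r u x = (1 - u) * q x + u * v x" for u x
    have r_body: "r u \<in> body \<and> is_chain_top K (supp (r u)) E" if u: "0 < u" "u \<le> 1" for u
    proof -
      have nonneg: "0 \<le> q x" "0 \<le> v x" for x using q v by (auto simp: polyhedron_of_def)
      have rn: "0 \<le> r u x" for x using nonneg u by (simp add: r_def)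
      have "v E > 0" using v(2) nonneg(2)[of E] by (auto simp: supp_def less_le)
      then have "r u E > 0" using u nonneg(1)[of E] by (auto simp: r_def intro: add_nonneg_pos)
      then have rE: "E \<in> supp (r u)" by (simp add: supp_def)
      have "v x = 0" if "x \<noteq> E" for x using v(2) that by (auto simp: supp_def)
      then have sub: "supp (r u) \<subseteq> insert E (supp q)" by (auto simp: supp_def r_def)
      have qE: "\<forall>x\<in>supp q. (x, E) \<in> K" using q(2) by (auto simp: below_def)
      have "supp q \<in> face_chains K" using q(1) by (simp add: polyhedron_of_def)
      then have "supp (r u) \<in> face_chains K"
        using face_chains_subset[OF chain_insert[OF _ E qE] sub] by blast
      moreover have "(\<Sum>x\<in>nonempty_faces K. r u x) = 1"
      proof -
        have "(\<Sum>x\<in>nonempty_faces K. r u x)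
            = (1 - u) * (\<Sum>x\<in>nonempty_faces K. q x) + u * (\<Sum>x\<in>nonempty_faces K. v x)"
          by (simp add: r_def sum.distrib sum_distrib_left)
        then show ?thesis using q(1) v(1) by (simp add: polyhedron_of_def)
      qed
      ultimately have "r u \<in> body" using rn by (simp add: polyhedron_of_def)
      moreover have "is_chain_top K (supp (r u)) E"
        using rE sub qE EE unfolding is_chain_top_def by blast
      ultimately show ?thesis by blast
    qed
    have r0: "r 0 = q" by (auto simp: r_def)
    have "continuous_on {0..1} (\<lambda>u. \<Sum>i<n. (f (r u) i)\<^sup>2)"
    proof -
      have "continuous_on {0..1} r"
        unfolding r_def by (intro continuous_on_coordinatewise_then_product continuous_intros)
      moreover have "r ` {0..1} \<subseteq> body"
      proof
        fix y assume "y \<in> r ` {0..1}"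
        then obtain u where "u \<in> {0..1}" "y = r u" by blast
        then show "y \<in> body" using r_body[of u] r0 q(1) by (cases "u = 0") auto
      qed
      moreover have "continuous_on body f"
        using homeomorphic_imp_continuous_map[OF f] by (simp add: realization_eq unit_ball_eq)
      ultimately have c: "continuous_on {0..1} (\<lambda>u. f (r u))"
        using continuous_on_compose2 by blast
      have "continuous_on {0..1} (\<lambda>u. f (r u) i)" for i
        by (rule continuous_on_compose2[of UNIV "\<lambda>t. t i", OF continuous_on_product_coordinates c]) simp
      then show ?thesis by (intro continuous_intros)
    qed
    \<comment> \<open>The one homeomorphism \<open>f\<close> serves the whole segment, because
      \<open>local_sum_ball\<close> holds for each of them; continuity then reaches
      \<open>u = 0\<close>.\<close>
    moreover have "(\<Sum>i<n. (f (r u) i)\<^sup>2) = 1" if "u \<in> {0<..1}" for u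
      using local_sum_ball[OF f, of "r u" E] r_body[of u] that zero by (auto split: if_splits)
    ultimately have "(\<Sum>i<n. (f (r 0) i)\<^sup>2) = 1"
      using continuous_constant_on_closure[of "{0<..1::real}" "\<lambda>u. \<Sum>i<n. (f (r u) i)\<^sup>2" 1 0] by simp
    then have "q \<in> ball_boundary n (realization K)"
      using f q(1) r0 by (auto simp: ball_boundary_def realization_eq)
    then show False using q(3) by blast
  qed
  moreover have "E \<in> interior_faces n K" if "v \<notin> ball_boundary n (realization K)"
    unfolding int using v that self_below[OF E] by (intro bexI[of _ v]) auto
  ultimately show ?thesis
    using ball_boundary_iff[OF hom v(1) vtop] by (cases "E \<in> interior_faces n K") auto
qed

text \<open>A face of dimension \<open>m > n\<close> would put an open \<open>m\<close>-simplex into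
  the \<open>n\<close>-ball. Inside Euclidean \<open>m\<close>-space its image is open by invariance
  of domain, yet coordinate \<open>n\<close> vanishes on it.\<close>

lemma face_dim_le_ball:
  assumes hom: "realization K homeomorphic_space unit_ball n" and E: "E \<in> nonempty_faces K"
  shows "face_dim K E \<le> n"
proof (rule ccontr)
  define m where "m = face_dim K E"
  assume "\<not> face_dim K E \<le> n"
  then have nm: "n < m" by (simp add: m_def)
  obtain f where f: "homeomorphic_map (realization K) (unit_ball n) f"
    using hom by (auto simp: homeomorphic_space)
  have fcont: "continuous_on body f" and fim: "f ` body = ball_set n" and finj: "inj_on f body"
    using homeomorphic_imp_continuous_map[OF f] homeomorphic_imp_surjective_map[OF f]
      homeomorphic_imp_injective_map[OF f] by (auto simp: realization_eq unit_ball_eq)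
  obtain s where s: "s \<in> face_chains K" "card s = Suc m"
    using exists_full_chain[OF E] by (auto simp: m_def)
  have fins: "finite s" using s(1) finite_chain by blast
  obtain e where e: "bij_betw e {..<Suc m} s"
    using ex_bij_betw_nat_finite[OF fins] s(2) by (auto simp: atLeast0LessThan)
  define idx where "idx = the_inv_into {..<Suc m} e"
  have idx: "idx (e i) = i" if "i < Suc m" for i
    unfolding idx_def using e that by (intro the_inv_into_f_f) (auto simp: bij_betw_def)
  have es: "e i \<in> s" if "i < Suc m" for i using e that by (auto dest: bij_betwE)
  \<comment> \<open>Barycentric weights along the chain: \<open>m\<close> free parameters, with the
    remainder going to the last vertex.\<close>
  define b where "b x y = (if y \<in> s then if idx y < m then x (idx y) else 1 - (\<Sum>j<m. x j) else 0)"
    for x :: "nat \<Rightarrow> real" and y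
  have be: "b x (e i) = x i" if "i < m" for x i using that es[of i] idx[of i] by (simp add: b_def)
  have bm: "b x (e m) = 1 - (\<Sum>j<m. x j)" for x using es[of m] idx[of m] by (simp add: b_def)
  define U where "U = {x::nat \<Rightarrow> real. (\<forall>i\<ge>m. x i = 0) \<and> (\<forall>i<m. 0 < x i) \<and> (\<Sum>i<m. x i) < 1}"
  have bU: "b x \<in> body" if x: "x \<in> U" for x
  proof -
    have "supp (b x) \<subseteq> s" by (auto simp: supp_def b_def)
    then have "supp (b x) \<in> face_chains K" using face_chains_subset[OF s(1)] by blast
    moreover have "0 \<le> b x y" for y using x by (auto simp: b_def U_def less_imp_le)
    moreover have "(\<Sum>y\<in>nonempty_faces K. b x y) = 1"
    proof -
      have "s \<subseteq> nonempty_faces K" using s(1) by (simp add: face_chains_def)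
      then have "(\<Sum>y\<in>nonempty_faces K. b x y) = (\<Sum>y\<in>s. b x y)"
        using finite_nonempty_faces by (intro sum.mono_neutral_right) (auto simp: b_def)
      also have "\<dots> = (\<Sum>i<Suc m. b x (e i))"
        by (rule sum.reindex_bij_betw[OF e, symmetric])
      also have "\<dots> = 1" by (simp add: be bm)
      finally show ?thesis .
    qed
    ultimately show ?thesis by (simp add: polyhedron_of_def)
  qed
  have coord: "continuous_on T (\<lambda>x. x i)" for T :: "(nat \<Rightarrow> real) set" and i
    by (rule continuous_on_subset[OF continuous_on_product_coordinates]) simp
  have bcont: "continuous_on U b"
  proof (rule continuous_on_coordinatewise_then_product)
    fix y
    consider "y \<notin> s" | "y \<in> s" "idx y < m" | "y \<in> s" "\<not> idx y < m" by blast
    then show "continuous_on U (\<lambda>x. b x y)"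
      by cases (simp_all add: b_def coord continuous_on_diff continuous_on_sum)
  qed
  have hcont: "continuous_on U (\<lambda>x. f (b x))"
    by (rule continuous_on_compose2[OF fcont bcont]) (use bU in auto)
  have hball: "f (b x) \<in> ball_set n" if "x \<in> U" for x using bU[OF that] fim by blast
  have UE: "topspace (subtopology (Euclidean_space m) U) = U"
    by (auto simp: topspace_Euclidean_space U_def)
  have h0: "f (b x) i = 0" if "x \<in> U" "i \<ge> n" for x i
    using hball[OF that(1)] that(2) by (simp add: ball_set_def)
  have openU: "openin (Euclidean_space m) U"
  proof -
    have U: "U = {x. \<forall>i\<ge>m. x i = 0} \<inter> ((\<Inter>i\<in>{..<m}. {x. 0 < x i}) \<inter> {x. (\<Sum>i<m. x i) < 1})"
      by (auto simp: U_def)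
    have "open ((\<Inter>i\<in>{..<m}. {x. 0 < x i}) \<inter> {x::nat \<Rightarrow> real. (\<Sum>i<m. x i) < 1})"
      by (intro open_Int open_INT ballI open_Collect_less continuous_intros coord) auto
    then show ?thesis
      unfolding Euclidean_space_def euclidean_product_topology U by (rule openin_open_Int)
  qed
  have "openin (Euclidean_space m) ((\<lambda>x. f (b x)) ` U)"
  proof (rule invariance_of_domain_Euclidean_space[OF openU])
    show "continuous_map (subtopology (Euclidean_space m) U) (Euclidean_space m) (\<lambda>x. f (b x))"
      unfolding cm_Euclidean_space_iff_continuous_on UE
      using hcont h0 nm by (auto simp: topspace_Euclidean_space)
    show "inj_on (\<lambda>x. f (b x)) U"
    proof (rule inj_onI)
      fix x y assume xy: "x \<in> U" "y \<in> U" "f (b x) = f (b y)"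
      then have "b x = b y" using finj bU by (auto dest: inj_onD)
      then have "x i = y i" if "i < m" for i using be[OF that] by metis
      moreover have "x i = y i" if "\<not> i < m" for i using xy that by (auto simp: U_def)
      ultimately show "x = y" by blast
    qed
  qed
  moreover have "(\<lambda>i. if i < m then 1 / (real m + 1) else 0) \<in> U"
    by (auto simp: U_def divide_simps)
  then obtain p where p: "p \<in> (\<lambda>x. f (b x)) ` U" by blast
  then have pn: "p i = 0" if "i \<ge> n" for i using h0 that by auto
  \<comment> \<open>A line through \<open>p\<close> in direction \<open>n\<close>: it stays in
    \<open>m\<close>-space but leaves the subspace of the ball at once, so it meets the image only
    at \<open>p\<close>.\<close>
  have "continuous_map euclideanreal (Euclidean_space m) (\<lambda>u. p(n := u))"
    unfolding Euclidean_space_def continuous_map_in_subtopology continuous_map_componentwise_UNIV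
    using nm pn by (auto simp: fun_upd_def intro: continuous_intros)
  ultimately have "openin euclideanreal {u \<in> topspace euclideanreal. p(n := u) \<in> (\<lambda>x. f (b x)) ` U}"
    by (intro openin_continuous_map_preimage)
  moreover have "{u \<in> topspace euclideanreal. p(n := u) \<in> (\<lambda>x. f (b x)) ` U} = {0}"
  proof -
    have "u = 0" if u: "p(n := u) \<in> (\<lambda>x. f (b x)) ` U" for u
    proof -
      obtain x where "x \<in> U" "p(n := u) = f (b x)" using u by blast
      then show ?thesis using h0[of x n] by (metis fun_upd_same order_refl)
    qed
    moreover have "p(n := 0) = p" using pn[of n] by auto
    ultimately show ?thesis using p by auto
  qed
  ultimately show False by (simp add: not_open_singleton)
qed

end

subsection \<open>Symmetry of the short cubical local \<open>h\<close>-polynomial\<close>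

context cubical
begin

text \<open>\<open>(-1) ^ n * local_sum E\<close> is the indicator of interior faces. Once the sums
  over \<open>E\<close> and \<open>G\<close> are exchanged, the inner sum over the faces of the cube
  \<open>G\<close> has a closed form.\<close>

lemma reversed_short_cubical_h:
  fixes x :: real
  assumes hom: "realization K homeomorphic_space unit_ball n" and x: "x \<noteq> 0"
  shows "x ^ n * poly (short_cubical_h n K) (1 / x)
    = (\<Sum>E\<in>interior_faces n K. (2 * x) ^ face_dim K E * (1 - x) ^ (n - face_dim K E))"
proof -
  let ?N = "nonempty_faces K" and ?d = "face_dim K"
  have le: "?d E \<le> n" if "E \<in> ?N" for E using face_dim_le_ball[OF hom that] .
  have "(\<Sum>E\<in>interior_faces n K. (2 * x) ^ ?d E * (1 - x) ^ (n - ?d E))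
      = (\<Sum>E\<in>?N. of_int ((-1) ^ n * local_sum E) * ((2 * x) ^ ?d E * (1 - x) ^ (n - ?d E)))"
  proof (rule sum.mono_neutral_cong_left[OF finite_nonempty_faces])
    show "interior_faces n K \<subseteq> ?N" by (auto simp: interior_faces_def)
    show "\<forall>E\<in>?N - interior_faces n K. of_int ((-1) ^ n * local_sum E) * ((2 * x) ^ ?d E * (1 - x) ^ (n - ?d E)) = 0"
      using interior_face_iff[OF hom] by simp
    fix E assume E: "E \<in> interior_faces n K"
    then have "E \<in> ?N" by (auto simp: interior_faces_def)
    then have "(-1) ^ n * local_sum E = 1"
      using interior_face_iff[OF hom, of E] E by (simp flip: power_mult_distrib)
    then show "(2 * x) ^ ?d E * (1 - x) ^ (n - ?d E)
        = of_int ((-1) ^ n * local_sum E) * ((2 * x) ^ ?d E * (1 - x) ^ (n - ?d E))" by simp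
  qed
  also have "\<dots> = (\<Sum>E\<in>?N. \<Sum>G | G \<in> ?N \<and> (E, G) \<in> K.
      (-1) ^ (n + ?d G) * ((2 * x) ^ ?d E * (1 - x) ^ (n - ?d E)))"
  proof (rule sum.cong)
    fix E assume "E \<in> ?N"
    then have "{G. G \<in> ?N \<and> (E, G) \<in> K} = {G. (E, G) \<in> K}" using above_nonempty by blast
    then show "of_int ((-1) ^ n * local_sum E) * ((2 * x) ^ ?d E * (1 - x) ^ (n - ?d E))
        = (\<Sum>G | G \<in> ?N \<and> (E, G) \<in> K. (-1) ^ (n + ?d G) * ((2 * x) ^ ?d E * (1 - x) ^ (n - ?d E)))"
      by (simp add: local_sum_def sum_distrib_left sum_distrib_right power_add)
  qed simp
  also have "\<dots> = (\<Sum>G\<in>?N. \<Sum>E\<in>below K G. (-1) ^ (n + ?d G) * ((2 * x) ^ ?d E * (1 - x) ^ (n - ?d E)))"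
    unfolding below_def by (rule sum.swap_restrict) (auto simp: finite_nonempty_faces)
  also have "\<dots> = (\<Sum>G\<in>?N. 2 ^ ?d G * (x - 1) ^ (n - ?d G))"
  proof (rule sum.cong)
    fix G assume G: "G \<in> ?N"
    \<comment> \<open>The exponents have equal parity because \<open>?d G \<le> n\<close>; the sign
      then turns the power of \<open>1 - x\<close> into one of \<open>x - 1\<close>.\<close>
    have pm: "(-1::real) ^ (n + ?d G) = (-1) ^ (n - ?d G)"
      using le[OF G] by (metis le_add_diff_inverse2 minus_one_power_iff even_add)
    have "(\<Sum>E\<in>below K G. (-1) ^ (n + ?d G) * ((2 * x) ^ ?d E * (1 - x) ^ (n - ?d E)))
        = (\<Sum>E\<in>below K G. (-1) ^ (n + ?d G) * (1 - x) ^ (n - ?d G) * ((2 * x) ^ ?d E * (1 - x) ^ (?d G - ?d E)))"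
    proof (rule sum.cong)
      fix E assume "E \<in> below K G"
      then have "n - ?d E = (n - ?d G) + (?d G - ?d E)" using face_dim_mono[OF G] le[OF G] by fastforce
      then show "(-1) ^ (n + ?d G) * ((2 * x) ^ ?d E * (1 - x) ^ (n - ?d E))
          = (-1) ^ (n + ?d G) * (1 - x) ^ (n - ?d G) * ((2 * x) ^ ?d E * (1 - x) ^ (?d G - ?d E))"
        by (simp add: power_add)
    qed simp
    also have "\<dots> = (-1) ^ (n + ?d G) * (1 - x) ^ (n - ?d G) * (2 * x + 2 * (1 - x)) ^ ?d G"
      by (simp only: sum_distrib_left[symmetric] sum_below[OF G])
    also have "\<dots> = 2 ^ ?d G * (x - 1) ^ (n - ?d G)"
      unfolding pm by (simp flip: power_mult_distrib)
    finally show "(\<Sum>E\<in>below K G. (-1) ^ (n + ?d G) * ((2 * x) ^ ?d E * (1 - x) ^ (n - ?d E)))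
        = 2 ^ ?d G * (x - 1) ^ (n - ?d G)" .
  qed simp
  also have "\<dots> = (\<Sum>G\<in>?N. x ^ n * ((2 / x) ^ ?d G * (1 - 1 / x) ^ (n - ?d G)))"
  proof (rule sum.cong)
    fix G assume G: "G \<in> ?N"
    have "x ^ n = x ^ ?d G * x ^ (n - ?d G)" using le[OF G] by (simp flip: power_add)
    then have "x ^ n * ((2 / x) ^ ?d G * (1 - 1 / x) ^ (n - ?d G))
        = (x * (2 / x)) ^ ?d G * (x * (1 - 1 / x)) ^ (n - ?d G)"
      by (simp only: power_mult_distrib mult_ac)
    also have "\<dots> = 2 ^ ?d G * (x - 1) ^ (n - ?d G)"
      using x by (simp add: algebra_simps)
    finally show "2 ^ ?d G * (x - 1) ^ (n - ?d G) = x ^ n * ((2 / x) ^ ?d G * (1 - 1 / x) ^ (n - ?d G))" ..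
  qed simp
  also have "\<dots> = x ^ n * poly (short_cubical_h n K) (1 / x)"
    unfolding short_cubical_h_def by (simp add: poly_sum sum_distrib_left)
  finally show ?thesis ..
qed

text \<open>An order ideal keeps the intervals below its faces, hence their dimensions, and contains
  the meets of its members because these lie below them.\<close>

lemma restrict_subcomplex:
  assumes S: "subcomplex K S" "empty_face K \<in> S"
  shows "cubical_complex (Restr K S)" "nonempty_faces (Restr K S) = S - {empty_face K}"
    "\<And>E. E \<in> S \<Longrightarrow> face_dim (Restr K S) E = face_dim K E"
proof -
  let ?R = "Restr K S"
  have SK: "S \<subseteq> Field K" and down: "\<And>x y. x \<in> S \<Longrightarrow> (y, x) \<in> K \<Longrightarrow> y \<in> S"
    using S by (auto simp: subcomplex_def under_def)
  have F: "Field ?R = S"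
  proof
    show "Field ?R \<subseteq> S" by (auto simp: Field_def)
    show "S \<subseteq> Field ?R"
    proof
      fix y assume "y \<in> S"
      then have "(y, y) \<in> ?R" using SK reflK by auto
      then show "y \<in> Field ?R" by (rule FieldI1)
    qed
  qed
  have po': "Partial_order ?R" using Partial_order_Restr[OF po] .
  have min: "is_min_element ?R (empty_face K)"
    using S(2) SK empty_face_le unfolding is_min_element_def F by auto
  have ef: "empty_face ?R = empty_face K"
    unfolding empty_face_def[of ?R]
  proof (rule the_equality)
    show "is_min_element ?R (empty_face K)" by fact
    fix m assume "is_min_element ?R m"
    then have "(m, empty_face K) \<in> ?R" "(empty_face K, m) \<in> ?R"
      using min by (auto simp: is_min_element_def)
    then show "m = empty_face K" using antisymK by auto
  qed
  then show N: "nonempty_faces ?R = S - {empty_face K}" by (simp add: nonempty_faces_def F)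
  have fc: "face_complex ?R E = face_complex K E" if "E \<in> S" for E
    using down[OF that] that unfolding face_complex_def under_def by auto
  then show "face_dim ?R E = face_dim K E" if "E \<in> S" for E
    using that by (simp add: face_dim_def)
  show "cubical_complex ?R"
    unfolding cubical_complex_def
  proof (intro conjI ballI)
    show "finite (Field ?R)" unfolding F using SK finite_Field finite_subset by blast
    show "Partial_order ?R" by fact
    show "\<exists>m. is_min_element ?R m" using min by blast
    show "\<exists>d. is_cube d (face_complex ?R E)" if "E \<in> nonempty_faces ?R" for E
    proof -
      have "E \<in> S" "E \<in> nonempty_faces K" using that[unfolded N] SK by (auto simp: nonempty_faces_def)
      then show ?thesis using fc is_cube_face_dim by auto
    qed
    fix x y assume "x \<in> Field ?R" "y \<in> Field ?R"
    then have xy: "x \<in> S" "y \<in> S" by (auto simp: F)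
    then obtain z where z: "(z, x) \<in> K" "(z, y) \<in> K" "\<forall>w. (w, x) \<in> K \<and> (w, y) \<in> K \<longrightarrow> (w, z) \<in> K"
      using K SK unfolding cubical_complex_def by (meson subsetD)
    then have "z \<in> S" using down xy by blast
    then show "\<exists>z. (z, x) \<in> ?R \<and> (z, y) \<in> ?R \<and> (\<forall>w. (w, x) \<in> ?R \<and> (w, y) \<in> ?R \<longrightarrow> (w, z) \<in> ?R)"
      using z xy down by (intro exI[of _ z]) auto
  qed
qed

text \<open>A top face turns the set of all nonempty faces into an interval, to which the interval
  sums apply.\<close>

lemma cube_top_face:
  assumes d: "is_cube d K"
  obtains T where "T \<in> nonempty_faces K" "\<And>F. F \<in> Field K \<Longrightarrow> (F, T) \<in> K" "face_dim K T = d"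
proof -
  obtain \<phi> where \<phi>: "bij_betw \<phi> (nonempty_faces K) (signs d)"
    "\<And>x y. x \<in> nonempty_faces K \<Longrightarrow> y \<in> nonempty_faces K \<Longrightarrow> (x, y) \<in> K \<longleftrightarrow> sign_le d (\<phi> x) (\<phi> y)"
    by (rule is_cube_signs[OF d min_empty_face]) (rule that, unfold nonempty_faces_def)
  define g :: "nat \<Rightarrow> bool option" where "g = (\<lambda>i\<in>{..<d}. None)"
  have "g \<in> signs d" by (simp add: g_def signs_def)
  then have "g \<in> \<phi> ` nonempty_faces K" by (simp only: bij_betw_imp_surj_on[OF \<phi>(1)])
  then obtain T where T: "T \<in> nonempty_faces K" "\<phi> T = g" by (metis imageE)
  have TF: "T \<in> Field K" using T(1) nonempty_FieldD by blast
  have top: "(F, T) \<in> K" if F: "F \<in> Field K" for F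
  proof (cases "F = empty_face K")
    case True
    then show ?thesis using empty_face_le[OF TF] by simp
  next
    case False
    then have "F \<in> nonempty_faces K" using F by (simp add: nonempty_faces_def)
    then show ?thesis using \<phi>(2)[OF _ T(1)] T(2) by (simp add: sign_le_def g_def)
  qed
  then have "face_complex K T = K" by (auto simp: face_complex_def under_def Field_def)
  then have "is_cube d (face_complex K T)" using d by simp
  then have "(3::nat) ^ d = 3 ^ face_dim K T"
    using is_cube_card[OF T(1)] is_cube_face_dim[OF T(1)] by metis
  then have "face_dim K T = d" by simp
  then show thesis using that[OF T(1) top] by blast
qed

end

lemma palindromic_coeffs:
  fixes p :: "real poly"
  assumes deg: "degree p \<le> d" and eq: "\<And>x. x \<noteq> 0 \<Longrightarrow> x ^ d * poly p (1 / x) = poly p x" and "i \<le> d"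
  shows "coeff p i = coeff p (d - i)"
proof -
  define r where "r = (\<Sum>j\<le>d. monom (coeff p (d - j)) j)"
  have "poly r x = poly p x" if x: "x \<noteq> 0" for x
  proof -
    have "poly p (1 / x) = (\<Sum>j\<le>d. coeff p j * (1 / x) ^ j)"
      unfolding poly_altdef
      by (rule sum.mono_neutral_left) (use deg in \<open>auto simp: coeff_eq_0\<close>)
    then have "poly p x = (\<Sum>j\<le>d. x ^ d * (coeff p j * (1 / x) ^ j))"
      using eq[OF x] by (simp add: sum_distrib_left)
    also have "\<dots> = (\<Sum>j\<le>d. coeff p j * x ^ (d - j))"
      using x by (intro sum.cong) (auto simp: power_diff power_divide)
    also have "\<dots> = (\<Sum>j\<le>d. coeff p (d - j) * x ^ j)"
      by (rule sum.reindex_bij_witness[of _ "\<lambda>j. d - j" "\<lambda>j. d - j"]) auto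
    also have "\<dots> = poly r x" by (simp add: r_def poly_sum poly_monom)
    finally show ?thesis ..
  qed
  \<comment> \<open>Multiplying by the variable absorbs the exceptional point 0, so the product
    vanishes everywhere.\<close>
  then have "poly ((r - p) * [:0, 1:]) x = 0" for x by (cases "x = 0") auto
  then have "(r - p) * [:0, 1:] = 0" using poly_all_0_iff_0 by blast
  then have "r = p" by simp
  then have "coeff p i = coeff r i" by simp
  also have "\<dots> = coeff p (d - i)"
    using assms(3) by (simp add: r_def coeff_sum)
  finally show ?thesis .
qed

theorem theorem4p2:
  fixes C :: "'a rel" and \<Gamma> :: "'b rel" and \<sigma> :: "'b \<Rightarrow> 'a" and d :: nat
  assumes "is_cube d C"
    and "cubical_subdivision C \<Gamma> \<sigma>"
  shows "degree (short_cubical_local_h d C \<Gamma> \<sigma>) \<le> d \<and>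
    (\<forall>x::real. x \<noteq> 0 \<longrightarrow>
       x ^ d * poly (short_cubical_local_h d C \<Gamma> \<sigma>) (1 / x) =
         poly (short_cubical_local_h d C \<Gamma> \<sigma>) x) \<and>
    (\<forall>i\<le>d. coeff (short_cubical_local_h d C \<Gamma> \<sigma>) i =
       coeff (short_cubical_local_h d C \<Gamma> \<sigma>) (d - i))"
proof -
  interpret C: cubical C using assms(2) by unfold_locales (simp add: cubical_subdivision_def)
  interpret G: cubical \<Gamma> using assms(2) by unfold_locales (simp add: cubical_subdivision_def)
  let ?NC = "nonempty_faces C" and ?NG = "nonempty_faces \<Gamma>"
  let ?c = "face_dim C" and ?e = "face_dim \<Gamma>"
  let ?l = "short_cubical_local_h d C \<Gamma> \<sigma>"
  define S where "S F = subdivided_face C \<Gamma> \<sigma> F" for F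
  define L where "L F = Restr \<Gamma> (S F)" for F
  obtain T where T: "T \<in> ?NC" "\<And>F. F \<in> Field C \<Longrightarrow> (F, T) \<in> C" "?c T = d"
    by (rule C.cube_top_face[OF assms(1)]) (rule that)
  have belowT: "below C T = ?NC" using T by (auto simp: below_def nonempty_faces_def)
  have dimC: "?c F \<le> d" if "F \<in> ?NC" for F
    using C.face_dim_mono[OF T(1)] that belowT T(3) by simp
  have \<sigma>: "\<sigma> E \<in> ?NC" if "E \<in> ?NG" for E
    using assms(2) that by (auto simp: cubical_subdivision_def)
  have sub: "subcomplex \<Gamma> (S F)" and hom: "realization (L F) homeomorphic_space unit_ball (?c F)"
    and int: "{E \<in> ?NG. \<sigma> E = F} = interior_faces (?c F) (L F)" if "F \<in> ?NC" for F
    using assms(2) that by (auto simp: cubical_subdivision_def S_def L_def)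
  have emp: "empty_face \<Gamma> \<in> S F" for F by (simp add: S_def subdivided_face_def)
  have NL: "nonempty_faces (L F) = {E \<in> ?NG. (\<sigma> E, F) \<in> C}" if F: "F \<in> ?NC" for F
    using G.restrict_subcomplex(2)[OF sub[OF F] emp] \<sigma>
    by (auto simp: L_def S_def subdivided_face_def nonempty_faces_def)
  have cL: "cubical (L F)" if F: "F \<in> ?NC" for F
    using G.restrict_subcomplex(1)[OF sub[OF F] emp] by unfold_locales (simp add: L_def)
  have dL: "face_dim (L F) E = ?e E" if F: "F \<in> ?NC" and E: "E \<in> nonempty_faces (L F)" for F E
    using G.restrict_subcomplex(2,3)[OF sub[OF F] emp] E by (simp add: L_def)
  have dim_le: "?e E \<le> ?c F" if "F \<in> ?NC" "E \<in> nonempty_faces (L F)" for F E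
    using cubical.face_dim_le_ball[OF cL hom] dL that by metis
  have poly_h: "short_cubical_h (?c F) (L F)
      = (\<Sum>E | E \<in> ?NG \<and> (\<sigma> E, F) \<in> C. [:0, 2:] ^ ?e E * [:1, -1:] ^ (?c F - ?e E))" if F: "F \<in> ?NC" for F
    unfolding short_cubical_h_def using dL[OF F] NL[OF F] by simp
  have l: "?l = (\<Sum>F\<in>?NC. (-1) ^ (d - ?c F) * short_cubical_h (?c F) (L F))"
    by (simp add: short_cubical_local_h_def L_def S_def)
  have deg: "degree ?l \<le> d"
    unfolding l
  proof (rule degree_sum_le[OF C.finite_nonempty_faces])
    fix F assume F: "F \<in> ?NC"
    have "degree (short_cubical_h (?c F) (L F)) \<le> d"
      unfolding poly_h[OF F]
    proof (rule degree_sum_le)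
      show "finite {E. E \<in> ?NG \<and> (\<sigma> E, F) \<in> C}" using G.finite_nonempty_faces by simp
      fix E assume "E \<in> {E. E \<in> ?NG \<and> (\<sigma> E, F) \<in> C}"
      then have le: "?e E \<le> ?c F" using dim_le[OF F] NL[OF F] by simp
      have "degree ([:0, 2::real:] ^ ?e E) \<le> ?e E" "degree ([:1, -1::real:] ^ (?c F - ?e E)) \<le> ?c F - ?e E"
        using degree_power_le[of "[:0, 2::real:]" "?e E"] degree_power_le[of "[:1, -1::real:]" "?c F - ?e E"] by auto
      then show "degree ([:0, 2::real:] ^ ?e E * [:1, -1:] ^ (?c F - ?e E)) \<le> d"
        using degree_mult_le[of "[:0, 2::real:] ^ ?e E" "[:1, -1:] ^ (?c F - ?e E)"] le dimC[OF F] by linarith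
    qed
    moreover have "degree ((-1 :: real poly) ^ (d - ?c F)) = 0"
      by (cases "even (d - ?c F)") auto
    ultimately show "degree ((-1) ^ (d - ?c F) * short_cubical_h (?c F) (L F)) \<le> d"
      using degree_mult_le[of "(-1 :: real poly) ^ (d - ?c F)" "short_cubical_h (?c F) (L F)"] by linarith
  qed
  define a where "a x E = (2 * x) ^ ?e E * (1 - x) ^ (?c (\<sigma> E) - ?e E) * (- x) ^ (d - ?c (\<sigma> E))"
    for x :: real and E
  have eval: "poly ?l x = (\<Sum>E\<in>?NG. a x E)" for x
  proof -
    have "poly ?l x = (\<Sum>F\<in>?NC. \<Sum>E | E \<in> ?NG \<and> (\<sigma> E, F) \<in> C.
        (-1) ^ (d - ?c F) * ((2 * x) ^ ?e E * (1 - x) ^ (?c F - ?e E)))"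
      unfolding l using poly_h by (simp add: poly_sum sum_distrib_left mult.commute)
    also have "\<dots> = (\<Sum>E\<in>?NG. \<Sum>F | F \<in> ?NC \<and> (\<sigma> E, F) \<in> C.
        (-1) ^ (d - ?c F) * ((2 * x) ^ ?e E * (1 - x) ^ (?c F - ?e E)))"
      by (rule sum.swap_restrict) (auto simp: C.finite_nonempty_faces G.finite_nonempty_faces)
    also have "\<dots> = (\<Sum>E\<in>?NG. a x E)"
    proof (rule sum.cong)
      fix E assume E: "E \<in> ?NG"
      have s: "\<sigma> E \<in> ?NC" using \<sigma>[OF E] .
      have ss: "(\<sigma> E, \<sigma> E) \<in> C" using s C.reflK C.nonempty_FieldD by blast
      then have le: "?e E \<le> ?c (\<sigma> E)" using dim_le[OF s] NL[OF s] E by simp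
      have "(\<Sum>F | F \<in> ?NC \<and> (\<sigma> E, F) \<in> C. (-1) ^ (d - ?c F) * ((2 * x) ^ ?e E * (1 - x) ^ (?c F - ?e E)))
          = (\<Sum>F | F \<in> below C T \<and> (\<sigma> E, F) \<in> C. (2 * x) ^ ?e E * (1 - x) ^ (?c (\<sigma> E) - ?e E) *
              ((1 - x) ^ (?c F - ?c (\<sigma> E)) * (-1) ^ (?c T - ?c F)))"
        unfolding belowT
      proof (rule sum.cong)
        fix F assume F: "F \<in> {F. F \<in> ?NC \<and> (\<sigma> E, F) \<in> C}"
        then have "?c (\<sigma> E) \<le> ?c F" using s by (intro C.face_dim_mono) (auto simp: below_def)
        then have "?c F - ?e E = (?c (\<sigma> E) - ?e E) + (?c F - ?c (\<sigma> E))" using le by simp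
        then show "(-1) ^ (d - ?c F) * ((2 * x) ^ ?e E * (1 - x) ^ (?c F - ?e E))
            = (2 * x) ^ ?e E * (1 - x) ^ (?c (\<sigma> E) - ?e E) * ((1 - x) ^ (?c F - ?c (\<sigma> E)) * (-1) ^ (?c T - ?c F))"
          by (simp only: power_add T(3) mult_ac)
      qed simp
      \<comment> \<open>\<open>sum_between\<close> from \<open>\<sigma> E\<close> up to the top
        \<open>T\<close>; the weights \<open>1 - x\<close> and -1 add up to
        \<open>- x\<close>.\<close>
      also have "\<dots> = (2 * x) ^ ?e E * (1 - x) ^ (?c (\<sigma> E) - ?e E) * ((1 - x) + (-1)) ^ (?c T - ?c (\<sigma> E))"
        using C.sum_between[OF T(1), of "\<sigma> E" "1 - x" "-1"] s belowT by (simp only: sum_distrib_left[symmetric])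
      also have "\<dots> = a x E" by (simp add: a_def T(3))
      finally show "(\<Sum>F | F \<in> ?NC \<and> (\<sigma> E, F) \<in> C. (-1) ^ (d - ?c F) * ((2 * x) ^ ?e E * (1 - x) ^ (?c F - ?e E))) = a x E" .
    qed simp
    finally show ?thesis .
  qed
  have sym: "x ^ d * poly ?l (1 / x) = poly ?l x" if x: "x \<noteq> 0" for x
  proof -
    have "x ^ d * poly ?l (1 / x) = (\<Sum>F\<in>?NC. x ^ d * ((-1) ^ (d - ?c F) * poly (short_cubical_h (?c F) (L F)) (1 / x)))"
      unfolding l by (simp add: poly_sum sum_distrib_left)
    also have "\<dots> = (\<Sum>F\<in>?NC. \<Sum>E | E \<in> ?NG \<and> \<sigma> E = F. a x E)"
    proof (rule sum.cong)
      fix F assume F: "F \<in> ?NC"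
      have xd: "x ^ d = x ^ (d - ?c F) * x ^ ?c F" using dimC[OF F] by (simp flip: power_add)
      have "x ^ d * ((-1) ^ (d - ?c F) * poly (short_cubical_h (?c F) (L F)) (1 / x))
          = (x ^ (d - ?c F) * (-1) ^ (d - ?c F)) * (x ^ ?c F * poly (short_cubical_h (?c F) (L F)) (1 / x))"
        unfolding xd by (simp only: mult_ac)
      \<comment> \<open>The sign from the definition and the surplus power of \<open>x\<close>
        together form the last factor of \<open>a\<close>.\<close>
      also have "x ^ (d - ?c F) * (-1) ^ (d - ?c F) = (- x) ^ (d - ?c F)"
        by (simp flip: power_mult_distrib)
      also have "x ^ ?c F * poly (short_cubical_h (?c F) (L F)) (1 / x)
          = (\<Sum>E\<in>interior_faces (?c F) (L F). (2 * x) ^ face_dim (L F) E * (1 - x) ^ (?c F - face_dim (L F) E))"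
        by (rule cubical.reversed_short_cubical_h[OF cL[OF F] hom[OF F] x])
      also have "\<dots> = (\<Sum>E\<in>interior_faces (?c F) (L F). (2 * x) ^ ?e E * (1 - x) ^ (?c F - ?e E))"
        using dL[OF F] by (intro sum.cong) (auto simp: interior_faces_def)
      also have "(- x) ^ (d - ?c F) * \<dots> = (\<Sum>E | E \<in> ?NG \<and> \<sigma> E = F. a x E)"
        unfolding int[OF F, symmetric] sum_distrib_left by (rule sum.cong) (auto simp: a_def)
      finally show "x ^ d * ((-1) ^ (d - ?c F) * poly (short_cubical_h (?c F) (L F)) (1 / x))
          = (\<Sum>E | E \<in> ?NG \<and> \<sigma> E = F. a x E)" .
    qed simp
    also have "\<dots> = (\<Sum>E\<in>?NG. a x E)"
      by (rule sum.group[OF G.finite_nonempty_faces C.finite_nonempty_faces]) (use \<sigma> in blast)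
    finally show ?thesis by (simp add: eval)
  qed
  show ?thesis
    using deg sym palindromic_coeffs[OF deg sym] by blast
qed

end
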